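(* Let $k>0$, $L>0$, let $f:\mathbb{R}\to\mathbb{R}$ be a bounded, Lipschitz continuous, $L$-periodic function, and let $\theta^I\in(-\pi/2,\pi/2)$. Let $u=u^I+u^S$ be the total field for the sound-soft diffraction grating scattering problem with incident plane wave $u^I(\mathbf{x})=\exp(\mathrm{i}k(\sin\theta^I\,x_1-\cos\theta^I\,x_2))$, for which $\partial_\nu u\in L^2(\Gamma^L)$. Let $N\in\mathbb{N}$, let $n_1,\dots,n_N$ be distinct integers, let $\psi_n:=\overline{\gamma v(\cdot,\theta_n)}$ for $n\in\mathbb{Z}$, and let $\mathcal{P}_N^\Gamma\subset L^2(\Gamma^L)$ be the space spanned by $\psi_{n_1},\dots,\psi_{n_N}$. Let $Q_N=\mathcal{P}_N^\Gamma$, let $\{\chi_1,\dots,\chi_N\}$ be a basis of $Q_N$, and let $$\phi_N=\sum_{m=1}^N c_m\chi_m,$$ where the coefficients $c_m\in\mathbb{C}$ satisfy the linear system $$\sum_{m=1}^N\left(\int_{\Gamma^L}\chi_m\,\overline{\psi_{n_j}}\,\mathrm{d}s\right)c_m=-2\mathrm{i}kL\beta_0\,\delta_{0,n_j},\quad j=1,\dots,N,$$ with $\beta_0=\cos\theta^I$ and $\delta_{m,n}$ the Kronecker delta. Then $\phi_N$ is the best $L^2(\Gamma^L)$ approximation to $\partial_\nu u$ in $\mathcal{P}_N^\Gamma$.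
   Context: Geometry: $\Omega_-:=\{\mathbf{x}=(x_1,x_2)\in\mathbb{R}^2:x_2<f(x_1)\}$, $\Omega_+:=\mathbb{R}^2\setminus\overline{\Omega_-}$, $\Gamma$ is the graph of $f$, $\Omega_+^L:=\{\mathbf{x}\in\Omega_+:0<x_1<L\}$, and $\Gamma^L:=\{\mathbf{x}\in\Gamma:0<x_1<L\}$. $\gamma$ is the trace operator onto the boundary, $\nu$ is the unit normal on $\Gamma$ directed into $\Omega_+$, and $\partial_\nu$ is the corresponding normal derivative operator. Quasi-periodicity: put $\mu:=k\sin\theta^I$. $C^2_\mu(\Omega_+^L)$ denotes the set of those $w\in C^2(\Omega_+)$ satisfying $w((x_1+L,x_2))=\exp(\mathrm{i}\mu L)w(\mathbf{x})$ for $\mathbf{x}\in\Omega_+$. For $n\in\mathbb{Z}$ let $\alpha_n:=\mu/k+2\pi n/(kL)$, and $\beta_n:=\sqrt{1-\alpha_n^2}$ if $|\alpha_n|\le1$, $\beta_n:=\mathrm{i}\sqrt{\alpha_n^2-1}$ if $|\alpha_n|>1$. In particular $\alpha_0=\sin\theta^I$ and $\beta_0=\cos\theta^I$. Rayleigh expansion radiation condition (RERC) for a function $w$: for some complex coefficients $c_n$, $w(\mathbf{x})=\sum_{n\in\mathbb{Z}}c_n\exp(\mathrm{i}k[\alpha_nx_1+\beta_nx_2])$ for $x_2>f_+:=\max f$. Scattering problem: the scattered field $u^S$ is the unique $u^S\in C^2_\mu(\Omega_+^L)\cap H^1_{\mathrm{loc}}(\Omega_+^L)$ (where $H^1_{\mathrm{loc}}$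 means $H^1$ on bounded parts of $\Omega_+^L$, up to the boundary) such that $\Delta u^S+k^2u^S=0$ in $\Omega_+$, $\gamma u^S=-u^I|_{\Gamma^L}$ on $\Gamma^L$, and $u^S$ satisfies the RERC. The total field is $u:=u^I+u^S$. It is known that this problem is uniquely solvable and that $\partial_\nu u\in L^2(\Gamma^L)$. Generalised plane waves: for $\theta\in\mathbb{C}$, $v(\mathbf{x},\theta):=\exp(\mathrm{i}k(\cos\theta\,x_1+\sin\theta\,x_2))$. For $n\in\mathbb{Z}$, $\theta_n\in\mathbb{C}$ is defined by $(\cos\theta_n,\sin\theta_n)=(-\alpha_n,\beta_n)$, so $v(\mathbf{x},\theta_n)=\exp(\mathrm{i}k(-\alpha_nx_1+\beta_nx_2))$. The functions $\gamma v(\cdot,\theta_n)$, $n\in\mathbb{Z}$, are known to be linearly independent in $L^2(\Gamma^L)$. $L^2(\Gamma^L)$ is the space of complex-valued square-integrable functions with respect to arc length $s$, with inner product $\int_{\Gamma^L}f\overline{g}\,\mathrm{d}s$. *)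

theory Defs
  imports "HOL-Analysis.Analysis"
begin

text \<open>An element of \<open>L\<^sup>2\<close> is represented by a measurable, square-integrable function; two such
  functions represent the same element iff they agree almost everywhere.\<close>

definition L2 :: "'a measure \<Rightarrow> ('a \<Rightarrow> complex) set" where
  "L2 M = {g \<in> borel_measurable M. integrable M (\<lambda>x. (cmod (g x))\<^sup>2)}"

definition L2_inner :: "'a measure \<Rightarrow> ('a \<Rightarrow> complex) \<Rightarrow> ('a \<Rightarrow> complex) \<Rightarrow> complex" where
  "L2_inner M g h = (LINT x|M. g x * cnj (h x))"

definition L2_norm :: "'a measure \<Rightarrow> ('a \<Rightarrow> complex) \<Rightarrow> real" where
  "L2_norm M g = sqrt (LINT x|M. (cmod (g x))\<^sup>2)"

definition L2_span :: "'a measure \<Rightarrow> 'i set \<Rightarrow> ('i \<Rightarrow> 'a \<Rightarrow> complex) \<Rightarrow> ('a \<Rightarrow> complex) set" where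
  "L2_span M I \<psi> = {g \<in> L2 M. \<exists>a. AE x in M. g x = (\<Sum>i\<in>I. a i * \<psi> i x)}"

definition L2_independent :: "'a measure \<Rightarrow> 'i set \<Rightarrow> ('i \<Rightarrow> 'a \<Rightarrow> complex) \<Rightarrow> bool" where
  "L2_independent M I \<psi> \<longleftrightarrow>
     (\<forall>a. (AE x in M. (\<Sum>i\<in>I. a i * \<psi> i x) = 0) \<longrightarrow> (\<forall>i\<in>I. a i = 0))"

definition L2_basis ::
    "'a measure \<Rightarrow> ('a \<Rightarrow> complex) set \<Rightarrow> 'i set \<Rightarrow> ('i \<Rightarrow> 'a \<Rightarrow> complex) \<Rightarrow> bool" where
  "L2_basis M Q I b \<longleftrightarrow>
     (\<forall>i\<in>I. b i \<in> L2 M) \<and> L2_independent M I b \<and> L2_span M I b = Q"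

text \<open>\<^emph>\<open>The\<close> best approximation: a minimiser of the distance which is unique as an element
  of \<open>L\<^sup>2\<close>.\<close>

definition is_best_L2_approx ::
    "'a measure \<Rightarrow> ('a \<Rightarrow> complex) set \<Rightarrow> ('a \<Rightarrow> complex) \<Rightarrow> ('a \<Rightarrow> complex) \<Rightarrow> bool" where
  "is_best_L2_approx M P g p \<longleftrightarrow> p \<in> P \<and>
     (\<forall>q\<in>P. L2_norm M (\<lambda>x. g x - p x) \<le> L2_norm M (\<lambda>x. g x - q x)) \<and>
     (\<forall>q\<in>P. L2_norm M (\<lambda>x. g x - q x) = L2_norm M (\<lambda>x. g x - p x) \<longrightarrow>
             (AE x in M. q x = p x))"

definition partial :: "'a::euclidean_space \<Rightarrow> ('a \<Rightarrow> complex) \<Rightarrow> 'a \<Rightarrow> complex" where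
  "partial i w x = frechet_derivative w (at x) i"

text \<open>Meant for open \<open>S\<close>.\<close>

definition C1_on :: "'a::euclidean_space set \<Rightarrow> ('a \<Rightarrow> complex) \<Rightarrow> bool" where
  "C1_on S w \<longleftrightarrow>
     (\<forall>x\<in>S. w differentiable (at x)) \<and> (\<forall>i\<in>Basis. continuous_on S (partial i w))"

definition C2_on :: "'a::euclidean_space set \<Rightarrow> ('a \<Rightarrow> complex) \<Rightarrow> bool" where
  "C2_on S w \<longleftrightarrow> C1_on S w \<and> (\<forall>i\<in>Basis. C1_on S (partial i w))"

definition laplacian :: "('a::euclidean_space \<Rightarrow> complex) \<Rightarrow> 'a \<Rightarrow> complex" where
  "laplacian w x = (\<Sum>i\<in>Basis. partial i (partial i w) x)"

text \<open>Test functions are once continuously differentiable with compact support (as, e.g., in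
  Gilbarg and Trudinger's definition of first-order weak derivatives); by mollification this is
  equivalent to using smooth test functions.\<close>

definition test_functions :: "'a::euclidean_space set \<Rightarrow> ('a \<Rightarrow> complex) set" where
  "test_functions S = {\<phi>. C1_on UNIV \<phi> \<and>
     compact (closure {x. \<phi> x \<noteq> 0}) \<and> closure {x. \<phi> x \<noteq> 0} \<subseteq> S}"

definition loc_integrable_on :: "'a::euclidean_space set \<Rightarrow> ('a \<Rightarrow> complex) \<Rightarrow> bool" where
  "loc_integrable_on S w \<longleftrightarrow> (\<forall>K. compact K \<and> K \<subseteq> S \<longrightarrow> set_integrable lborel K w)"

definition has_weak_partial ::
    "'a::euclidean_space set \<Rightarrow> 'a \<Rightarrow> ('a \<Rightarrow> complex) \<Rightarrow> ('a \<Rightarrow> complex) \<Rightarrow> bool" where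
  "has_weak_partial S i w g \<longleftrightarrow> loc_integrable_on S w \<and> loc_integrable_on S g \<and>
     (\<forall>\<phi>\<in>test_functions S.
        (LINT x:S|lborel. w x * partial i \<phi> x) = - (LINT x:S|lborel. g x * \<phi> x))"

text \<open>A representative of the weak derivative, which is determined almost everywhere.\<close>

definition weak_partial :: "'a::euclidean_space set \<Rightarrow> 'a \<Rightarrow> ('a \<Rightarrow> complex) \<Rightarrow> 'a \<Rightarrow> complex" where
  "weak_partial S i w = (SOME g. has_weak_partial S i w g)"

abbreviation leb_on :: "'a::euclidean_space set \<Rightarrow> 'a measure" where
  "leb_on S \<equiv> restrict_space lborel S"

definition H1 :: "'a::euclidean_space set \<Rightarrow> ('a \<Rightarrow> complex) set" where
  "H1 S = {w \<in> L2 (leb_on S). \<forall>i\<in>Basis. \<exists>g\<in>L2 (leb_on S). has_weak_partial S i w g}"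

definition H1_norm :: "'a::euclidean_space set \<Rightarrow> ('a \<Rightarrow> complex) \<Rightarrow> real" where
  "H1_norm S w =
     sqrt ((L2_norm (leb_on S) w)\<^sup>2 + (\<Sum>i\<in>Basis. (L2_norm (leb_on S) (weak_partial S i w))\<^sup>2))"

text \<open>\<open>H\<^sup>1\<close> on bounded parts of \<open>S\<close>, up to the boundary.\<close>

definition H1_loc :: "'a::euclidean_space set \<Rightarrow> ('a \<Rightarrow> complex) set" where
  "H1_loc S = {w. \<forall>R>0. w \<in> H1 (S \<inter> ball 0 R)}"

text \<open>Here \<open>\<sigma>\<close> is the surface measure on the boundary of \<open>S\<close>.
  The trace operator is the continuous extension (from \<open>H\<^sup>1\<close> to \<open>L\<^sup>2\<close> of the boundary, on bounded
  parts) of the restriction map on functions that are \<open>C\<^sup>1\<close> up to the boundary. In particular, the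
  trace of such a function is its restriction. A statement about the trace is a statement about any
  \<open>g\<close> with \<^term>\<open>has_trace S \<sigma> w g\<close>, these being equal \<open>\<sigma>\<close>-almost everywhere.\<close>

definition has_trace ::
    "'a::euclidean_space set \<Rightarrow> 'a measure \<Rightarrow> ('a \<Rightarrow> complex) \<Rightarrow> ('a \<Rightarrow> complex) \<Rightarrow> bool" where
  "has_trace S \<sigma> w g \<longleftrightarrow>
     w \<in> H1_loc S \<and> (\<forall>R>0. g \<in> L2 (restrict_space \<sigma> (ball 0 R))) \<and>
     (\<exists>\<phi> :: nat \<Rightarrow> 'a \<Rightarrow> complex. (\<forall>n. C1_on UNIV (\<phi> n)) \<and>
        (\<forall>R>0. (\<lambda>n. H1_norm (S \<inter> ball 0 R) (\<lambda>x. \<phi> n x - w x)) \<longlonglongrightarrow> 0 \<and>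
               (\<lambda>n. L2_norm (restrict_space \<sigma> (ball 0 R)) (\<lambda>x. \<phi> n x - g x)) \<longlonglongrightarrow> 0))"

text \<open>The normal derivative of a function in \<open>H\<^sup>1\<close> with Laplacian in \<open>L\<^sup>2\<close> (on bounded parts) is
  defined, as usual on Lipschitz domains, by Green's first identity
    \<open>\<integral>\<^sub>S (\<nabla>w \<cdot> \<nabla>\<phi> + \<phi> \<Delta>w) dx = - \<integral> \<phi> \<partial>\<^sub>\<nu>w d\<sigma>\<close>.
  The sign is that of the unit normal \<open>\<nu>\<close> directed \<^emph>\<open>into\<close> \<open>S\<close>. The relation says that this normal
  derivative is the locally integrable function \<open>g\<close> on the boundary. The Laplacian is the classical
  one, so \<open>w\<close> is required to be \<open>C\<^sup>2\<close> in the (open) interior \<open>S\<close>.\<close>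

definition has_normal_derivative ::
    "'a::euclidean_space set \<Rightarrow> 'a measure \<Rightarrow> ('a \<Rightarrow> complex) \<Rightarrow> ('a \<Rightarrow> complex) \<Rightarrow> bool" where
  "has_normal_derivative S \<sigma> w g \<longleftrightarrow>
     C2_on S w \<and> w \<in> H1_loc S \<and> (\<forall>R>0. laplacian w \<in> L2 (leb_on (S \<inter> ball 0 R))) \<and>
     (\<forall>R>0. set_integrable \<sigma> (ball 0 R) g) \<and>
     (\<forall>\<phi>\<in>test_functions UNIV.
        (LINT x:S|lborel. (\<Sum>i\<in>Basis. weak_partial S i w x * partial i \<phi> x) + \<phi> x * laplacian w x)
        = - (LINT x|\<sigma>. \<phi> x * g x))"

definition Omega_minus :: "(real \<Rightarrow> real) \<Rightarrow> (real \<times> real) set" where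
  "Omega_minus f = {x. snd x < f (fst x)}"

definition Omega_plus :: "(real \<Rightarrow> real) \<Rightarrow> (real \<times> real) set" where
  "Omega_plus f = UNIV - closure (Omega_minus f)"

definition Omega_plus_cell :: "(real \<Rightarrow> real) \<Rightarrow> real \<Rightarrow> (real \<times> real) set" where
  "Omega_plus_cell f L = {x \<in> Omega_plus f. 0 < fst x \<and> fst x < L}"

definition Gam :: "(real \<Rightarrow> real) \<Rightarrow> (real \<times> real) set" where
  "Gam f = {x. snd x = f (fst x)}"

definition Gam_cell :: "(real \<Rightarrow> real) \<Rightarrow> real \<Rightarrow> (real \<times> real) set" where
  "Gam_cell f L = {x \<in> Gam f. 0 < fst x \<and> fst x < L}"

text \<open>Arc length on the graph, \<open>ds = sqrt (1 + f'(t)\<^sup>2) dt\<close>, as a Borel measure on the plane. A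
  Lipschitz \<open>f\<close> is differentiable almost everywhere, so the values of \<^const>\<open>deriv\<close> at the remaining
  points are irrelevant.\<close>

definition arclength :: "(real \<Rightarrow> real) \<Rightarrow> (real \<times> real) measure" where
  "arclength f =
     distr (density lborel (\<lambda>t. ennreal (sqrt (1 + (deriv f t)\<^sup>2)))) borel (\<lambda>t. (t, f t))"

definition arclength_cell :: "(real \<Rightarrow> real) \<Rightarrow> real \<Rightarrow> (real \<times> real) measure" where
  "arclength_cell f L = restrict_space (arclength f) (Gam_cell f L)"

definition quasi_momentum :: "real \<Rightarrow> real \<Rightarrow> real" where
  "quasi_momentum k \<theta>I = k * sin \<theta>I"

definition C2_quasi_periodic :: "real \<Rightarrow> real \<Rightarrow> (real \<Rightarrow> real) \<Rightarrow> (real \<times> real \<Rightarrow> complex) set" where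
  "C2_quasi_periodic \<mu> L f = {w. C2_on (Omega_plus f) w \<and>
     (\<forall>x\<in>Omega_plus f. w (fst x + L, snd x) = exp (\<i> * of_real (\<mu> * L)) * w x)}"

definition alpha :: "real \<Rightarrow> real \<Rightarrow> real \<Rightarrow> int \<Rightarrow> real" where
  "alpha k L \<theta>I n = quasi_momentum k \<theta>I / k + 2 * pi * of_int n / (k * L)"

definition beta :: "real \<Rightarrow> real \<Rightarrow> real \<Rightarrow> int \<Rightarrow> complex" where
  "beta k L \<theta>I n =
     (if \<bar>alpha k L \<theta>I n\<bar> \<le> 1 then of_real (sqrt (1 - (alpha k L \<theta>I n)\<^sup>2))
      else \<i> * of_real (sqrt ((alpha k L \<theta>I n)\<^sup>2 - 1)))"

definition RERC :: "real \<Rightarrow> real \<Rightarrow> (real \<Rightarrow> real) \<Rightarrow> real \<Rightarrow> (real \<times> real \<Rightarrow> complex) \<Rightarrow> bool" where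
  "RERC k L f \<theta>I w \<longleftrightarrow> (\<exists>c :: int \<Rightarrow> complex. \<forall>x. snd x > (SUP t. f t) \<longrightarrow>
     ((\<lambda>n. c n * exp (\<i> * of_real k *
         (of_real (alpha k L \<theta>I n) * of_real (fst x) + beta k L \<theta>I n * of_real (snd x))))
       has_sum w x) UNIV)"

definition incident_field :: "real \<Rightarrow> real \<Rightarrow> real \<times> real \<Rightarrow> complex" where
  "incident_field k \<theta>I x = exp (\<i> * of_real (k * (sin \<theta>I * fst x - cos \<theta>I * snd x)))"

definition is_scattered_field ::
    "real \<Rightarrow> real \<Rightarrow> (real \<Rightarrow> real) \<Rightarrow> real \<Rightarrow> (real \<times> real \<Rightarrow> complex) \<Rightarrow> bool" where
  "is_scattered_field k L f \<theta>I uS \<longleftrightarrow>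
     uS \<in> C2_quasi_periodic (quasi_momentum k \<theta>I) L f \<and>
     uS \<in> H1_loc (Omega_plus_cell f L) \<and>
     (\<forall>x\<in>Omega_plus f. laplacian uS x + of_real (k\<^sup>2) * uS x = 0) \<and>
     (\<exists>g. has_trace (Omega_plus f) (arclength f) uS g \<and>
          (AE x in arclength_cell f L. g x = - incident_field k \<theta>I x)) \<and>
     RERC k L f \<theta>I uS"

definition total_field ::
    "real \<Rightarrow> real \<Rightarrow> (real \<times> real \<Rightarrow> complex) \<Rightarrow> real \<times> real \<Rightarrow> complex" where
  "total_field k \<theta>I uS x = incident_field k \<theta>I x + uS x"

definition gen_plane_wave :: "real \<Rightarrow> real \<times> real \<Rightarrow> complex \<Rightarrow> complex" where
  "gen_plane_wave k x \<theta> =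
     exp (\<i> * of_real k * (cos \<theta> * of_real (fst x) + sin \<theta> * of_real (snd x)))"

text \<open>The functions \<open>\<psi>\<^sub>n\<close>, for a choice of the complex angles \<open>\<theta>\<^sub>n\<close>. The trace of the entire function
  \<open>v(\<cdot>,\<theta>)\<close> is its restriction to the boundary.\<close>

definition psi :: "real \<Rightarrow> (int \<Rightarrow> complex) \<Rightarrow> int \<Rightarrow> real \<times> real \<Rightarrow> complex" where
  "psi k \<theta> n x = cnj (gen_plane_wave k x (\<theta> n))"

end

theory Submission
  imports Defs "HOL-Real_Asymp.Real_Asymp"
begin

text \<open>
  The Galerkin system says that \<open>\<phi>\<close> has prescribed inner products with the functions \<open>\<psi>\<^bsub>n\<^esub>\<close> for the chosen indices. The
  point of the theorem is that these prescribed values are the inner products of \<open>\<partial>\<^sub>\<nu> u\<close> itself: for every integer \<open>n\<close>,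
  \<open>\<integral> v(\<cdot>,\<theta>\<^sub>n) \<partial>\<^sub>\<nu> u ds = - 2 i k L \<beta>\<^sub>0 \<delta>\<^bsub>0,n\<^esub>\<close>, the integral extending over one period of the boundary
  (\<open>normal_derivative_moment\<close>). Then \<open>\<partial>\<^sub>\<nu> u - \<phi>\<close> is orthogonal to the span of the \<open>\<psi>\<^bsub>n\<^esub>\<close>, to which \<open>\<phi>\<close> belongs, and
  \<open>\<phi>\<close> is the best approximation by Pythagoras' theorem (\<open>best_L2_approx_if_orthogonal\<close>).

  The moments come from Green's second identity for \<open>u\<close> and \<open>v(\<cdot>,\<theta>\<^sub>n)\<close>, which solve the same Helmholtz
  equation. The trace of \<open>u\<close> is zero, the product of the two functions is \<open>L\<close>-periodic in \<open>x\<^sub>1\<close> so that the lateral sides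
  of the period cell cancel, and at the top \<open>u\<close> is the sum of the incident wave and a Rayleigh expansion. Integration over
  a period selects the \<open>n\<close>-th mode. An upward mode \<open>exp (i k \<beta>\<^sub>n x\<^sub>2)\<close> has no flux against \<open>v(\<cdot>,\<theta>\<^sub>n)\<close>, which depends on
  \<open>x\<^sub>2\<close> in the same way, and the incident wave contributes to the mode \<open>n = 0\<close> only.

  To make this rigorous for a Lipschitz boundary and a field that is merely in \<open>H\<^sup>1\<close> up to the boundary, all identities
  are tested with products \<open>A(x\<^sub>1) B(x\<^sub>2)\<close> of cut-off exponentials, and the derivatives are moved to these
  (\<open>green_second_identity\<close>, \<open>boundary_moment_eq_cutoff_integral\<close>). Two facts carry the analysis. First, \<open>u\<close> is \<open>C\<^sup>2\<close>
  inside the domain, so its weak derivatives are the classical ones (\<open>weak_partial_AE\<close>). Second, the integral over the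
  domain of a derivative of a \<open>C\<^sup>1\<close> function with bounded support is bounded by the \<open>L\<^sup>1\<close> norm of its boundary values,
  as one sees by translating the domain (\<open>norm_integral_partial_graph_le\<close>). Applied to the smooth functions that
  approximate the scattered field and its trace, this yields integration by parts without boundary term for \<open>u\<close>
  (\<open>has_trace_imp_defect_le\<close>, \<open>parts_defect_eq_0\<close>).
\<close>

section \<open>Continuously differentiable functions and their partial derivatives\<close>

lemma Basis_plane: "(Basis :: (real \<times> real) set) = {(1,0), (0,1)}"
  by (auto simp: Basis_prod_def)

lemma sum_Basis_plane: "(\<Sum>i\<in>(Basis :: (real \<times> real) set). F i) = F (1,0) + F (0,1)"
  by (simp add: Basis_plane)

lemma partial_eq: "(w has_derivative D) (at x) \<Longrightarrow> partial i w x = D i"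
  by (simp add: partial_def frechet_derivative_at[symmetric])

lemma C1_on_has_derivative:
  assumes "C1_on S w" "x \<in> S"
  shows "(w has_derivative (\<lambda>h. partial h w x)) (at x)"
  using assms by (simp add: C1_on_def partial_def frechet_derivative_works[symmetric])

lemma partial_scaleR:
  "C1_on S w \<Longrightarrow> x \<in> S \<Longrightarrow> partial (s *\<^sub>R e) w x = s *\<^sub>R partial e w x"
  using linear_scale[OF has_derivative_linear[OF C1_on_has_derivative]] .

lemma C1_onI:
  assumes "\<And>x. x \<in> S \<Longrightarrow> (w has_derivative D x) (at x)"
    and "\<And>i. i \<in> Basis \<Longrightarrow> continuous_on S (\<lambda>x. D x i)"
  shows "C1_on S w"
proof -
  have "continuous_on S (partial i w)" if "i \<in> Basis" for i
    by (subst continuous_on_cong[OF refl, of S "partial i w" "\<lambda>x. D x i"])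
       (use assms that in \<open>auto simp: partial_eq\<close>)
  then show ?thesis using assms unfolding C1_on_def differentiable_def by blast
qed

lemma C1_on_continuous_on: "C1_on S w \<Longrightarrow> continuous_on S w"
  unfolding C1_on_def
  by (meson continuous_at_imp_continuous_on differentiable_imp_continuous_within)

lemma C1_on_partial_continuous: "C1_on S w \<Longrightarrow> i \<in> Basis \<Longrightarrow> continuous_on S (partial i w)"
  by (simp add: C1_on_def)

lemma C1_on_subset: "C1_on T w \<Longrightarrow> S \<subseteq> T \<Longrightarrow> C1_on S w"
  unfolding C1_on_def by (blast intro: continuous_on_subset)

lemma partial_cong_open:
  assumes "open S" "x \<in> S" "\<And>y. y \<in> S \<Longrightarrow> w y = v y"
  shows "partial i w x = partial i v x"
proof -
  have "(w has_derivative D) (at x) \<longleftrightarrow> (v has_derivative D) (at x)" for D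
    using assms by (metis has_derivative_transform_within_open)
  then show ?thesis by (simp add: partial_def frechet_derivative_def)
qed

lemma C1_on_cong:
  assumes "open S" "\<And>y. y \<in> S \<Longrightarrow> w y = v y" "C1_on S v"
  shows "C1_on S w"
proof (rule C1_onI)
  fix x assume "x \<in> S"
  with assms show "(w has_derivative (\<lambda>h. partial h v x)) (at x)"
    using C1_on_has_derivative has_derivative_transform_within_open by metis
qed (use assms in \<open>auto simp: C1_on_def\<close>)

lemma C1_on_add: "C1_on S a \<Longrightarrow> C1_on S b \<Longrightarrow> C1_on S (\<lambda>x. a x + b x)"
  and partial_add: "C1_on S a \<Longrightarrow> C1_on S b \<Longrightarrow> x \<in> S \<Longrightarrow>
    partial i (\<lambda>x. a x + b x) x = partial i a x + partial i b x"
  by (rule C1_onI[where D = "\<lambda>x h. partial h a x + partial h b x"] partial_eq,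
      auto intro!: has_derivative_add C1_on_has_derivative continuous_on_add C1_on_partial_continuous)+

lemma C1_on_diff: "C1_on S a \<Longrightarrow> C1_on S b \<Longrightarrow> C1_on S (\<lambda>x. a x - b x)"
  and partial_diff: "C1_on S a \<Longrightarrow> C1_on S b \<Longrightarrow> x \<in> S \<Longrightarrow>
    partial i (\<lambda>x. a x - b x) x = partial i a x - partial i b x"
  by (rule C1_onI[where D = "\<lambda>x h. partial h a x - partial h b x"] partial_eq,
      auto intro!: has_derivative_diff C1_on_has_derivative continuous_on_diff C1_on_partial_continuous)+

lemma C1_on_mult: "C1_on S a \<Longrightarrow> C1_on S b \<Longrightarrow> C1_on S (\<lambda>x. a x * b x)"
  and partial_mult: "C1_on S a \<Longrightarrow> C1_on S b \<Longrightarrow> x \<in> S \<Longrightarrow>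
    partial i (\<lambda>x. a x * b x) x = partial i a x * b x + a x * partial i b x"
proof -
  have D: "((\<lambda>x. a x * b x) has_derivative (\<lambda>h. a x * partial h b x + partial h a x * b x)) (at x)"
    if "C1_on S a" "C1_on S b" "x \<in> S" for x
    using that by (intro has_derivative_mult C1_on_has_derivative)
  show "C1_on S (\<lambda>x. a x * b x)" if "C1_on S a" "C1_on S b"
    using that by (intro C1_onI[OF D] continuous_on_add continuous_on_mult)
      (auto intro: C1_on_continuous_on C1_on_partial_continuous)
  show "partial i (\<lambda>x. a x * b x) x = partial i a x * b x + a x * partial i b x"
    if "C1_on S a" "C1_on S b" "x \<in> S"
    using partial_eq[OF D[OF that]] by simp
qed

lemma partial_zero_outside_support:
  assumes "x \<notin> closure {x. \<phi> x \<noteq> 0}"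
  shows "partial i \<phi> x = 0"
proof -
  have "partial i \<phi> x = partial i (\<lambda>_. 0) x"
    using assms closure_subset[of "{x. \<phi> x \<noteq> 0}"]
    by (intro partial_cong_open[of "- closure {x. \<phi> x \<noteq> 0}"]) auto
  then show ?thesis using partial_eq[OF has_derivative_const[of 0 "at x"], of i] by simp
qed

lemma partial_zero_outside_cball:
  assumes "\<And>x. F x \<noteq> 0 \<Longrightarrow> norm x \<le> R" and "norm x > R"
  shows "partial i F x = 0"
proof -
  have "closure {x. F x \<noteq> 0} \<subseteq> cball 0 R"
    using assms(1) by (intro closure_minimal) (auto simp: dist_norm)
  then show ?thesis using assms(2) by (intro partial_zero_outside_support) auto
qed

text \<open>Off the support of \<open>\<phi>\<close> the product vanishes identically. This open set and
  \<open>S\<close> cover the space, and continuous differentiability is a local property.\<close>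

lemma C1_on_mult_test_function:
  assumes S: "open S" and w: "C1_on S w" and \<phi>: "\<phi> \<in> test_functions S"
  shows "C1_on UNIV (\<lambda>x. w x * \<phi> x)"
proof -
  let ?T = "- closure {x. \<phi> x \<noteq> 0}"
  from \<phi> have p: "C1_on UNIV \<phi>" "closure {x. \<phi> x \<noteq> 0} \<subseteq> S"
    by (auto simp: test_functions_def)
  have 1: "C1_on S (\<lambda>x. w x * \<phi> x)"
    by (rule C1_on_mult[OF w C1_on_subset[OF p(1)]]) simp
  have 2: "C1_on ?T (\<lambda>x. w x * \<phi> x)"
    by (rule C1_on_cong[where v = "\<lambda>_. 0"])
       (use closure_subset[of "{x. \<phi> x \<noteq> 0}"] in \<open>auto intro!: C1_onI[where D = "\<lambda>_ _. 0"]\<close>)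
  have U: "UNIV = S \<union> ?T" using p(2) by auto
  have "continuous_on (S \<union> ?T) (partial i (\<lambda>x. w x * \<phi> x))" if "i \<in> Basis" for i
    using 1 2 S that by (intro continuous_on_open_Un) (auto simp: C1_on_def)
  moreover have "(\<lambda>x. w x * \<phi> x) differentiable (at x)" for x
    using 1 2 U unfolding C1_on_def by blast
  ultimately show ?thesis using U unfolding C1_on_def by simp
qed

lemma test_functions_UNIV_iff:
  "\<phi> \<in> test_functions UNIV \<longleftrightarrow> C1_on UNIV \<phi> \<and> (\<exists>R. \<forall>x. \<phi> x \<noteq> 0 \<longrightarrow> norm x \<le> R)"
  by (auto simp: test_functions_def bounded_iff)

text \<open>The test functions constructed below have this form. It is preserved by partial derivatives,
  and it leaves only one-dimensional factors to be constructed: cut-offs and exponentials.\<close>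

definition tensor :: "(real \<Rightarrow> complex) \<Rightarrow> (real \<Rightarrow> complex) \<Rightarrow> real \<times> real \<Rightarrow> complex" where
  "tensor A B x = A (fst x) * B (snd x)"

lemma tensor_has_derivative:
  assumes "(A has_vector_derivative A') (at (fst x))" "(B has_vector_derivative B') (at (snd x))"
  shows "(tensor A B has_derivative
    (\<lambda>h. A (fst x) * (of_real (snd h) * B') + of_real (fst h) * A' * B (snd x))) (at x)"
proof -
  have 1: "((\<lambda>x. A (fst x)) has_derivative (\<lambda>h. fst h *\<^sub>R A')) (at x)"
    using assms(1) has_derivative_compose[OF has_derivative_fst[OF has_derivative_ident]]
    unfolding has_vector_derivative_def by blast
  have 2: "((\<lambda>x. B (snd x)) has_derivative (\<lambda>h. snd h *\<^sub>R B')) (at x)"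
    using assms(2) has_derivative_compose[OF has_derivative_snd[OF has_derivative_ident]]
    unfolding has_vector_derivative_def by blast
  show ?thesis
    unfolding tensor_def[abs_def] using has_derivative_mult[OF 1 2] by (simp add: scaleR_conv_of_real)
qed

lemma partial_tensor:
  assumes "\<And>t. (A has_vector_derivative A' t) (at t)" "\<And>t. (B has_vector_derivative B' t) (at t)"
  shows "partial (1,0) (tensor A B) = tensor A' B" "partial (0,1) (tensor A B) = tensor A B'"
  using partial_eq[OF tensor_has_derivative[OF assms]] by (auto simp: tensor_def)

lemma continuous_on_tensor:
  assumes "continuous_on UNIV A" "continuous_on UNIV B"
  shows "continuous_on S (tensor A B)"
  unfolding tensor_def[abs_def]
  by (intro continuous_on_mult continuous_on_compose2[OF assms(1)] continuous_on_compose2[OF assms(2)]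
        continuous_intros) auto

lemma C1_on_tensor:
  assumes "\<And>t. (A has_vector_derivative A' t) (at t)" "\<And>t. (B has_vector_derivative B' t) (at t)"
    and "continuous_on UNIV A'" "continuous_on UNIV B'"
  shows "C1_on S (tensor A B)"
proof -
  have c: "continuous_on UNIV A" "continuous_on UNIV B"
    using assms(1,2) by (meson continuous_on_eq_continuous_within has_vector_derivative_continuous
        has_vector_derivative_at_within)+
  show ?thesis unfolding C1_on_def
    using tensor_has_derivative[OF assms(1,2)] partial_tensor[OF assms(1,2)] assms c
    by (auto simp: Basis_plane differentiable_def intro: continuous_on_tensor)
qed

section \<open>One-dimensional cut-off functions\<close>

definition clamp01 :: "real \<Rightarrow> real" where "clamp01 t = max 0 (min 1 t)"

lemma clamp01_lipschitz: "\<bar>clamp01 s - clamp01 t\<bar> \<le> \<bar>s - t\<bar>"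
  by (auto simp: clamp01_def max_def min_def)

lemma continuous_clamp01: "continuous_on A clamp01"
  unfolding clamp01_def[abs_def] by (intro continuous_intros)

text \<open>Clamping has kinks at \<open>0\<close> and \<open>1\<close> only. There the slope of
  \<open>P\<close> tends to \<open>p = 0\<close>, while clamping does not increase distances, so the
  difference quotients still converge.\<close>

lemma DERIV_comp_clamp01:
  assumes P: "\<And>z. (P has_real_derivative p z) (at z)" and 01: "p 0 = 0" "p 1 = 0"
  shows "((\<lambda>t. P (clamp01 t)) has_real_derivative p (clamp01 t)) (at t)"
proof (cases "0 < t \<and> t < 1")
  case True
  then have "((\<lambda>t. P (clamp01 t)) has_real_derivative p t) (at t)"
    using P[of t] by (intro has_field_derivative_transform_within_open[OF P, of "{0<..<1}"])
      (auto simp: clamp01_def)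
  with True show ?thesis by (simp add: clamp01_def)
next
  case False
  define c where "c = clamp01 t"
  have c: "p c = 0" using False 01 by (auto simp: c_def clamp01_def max_def min_def)
  obtain g where g: "\<And>z. P z - P c = g z * (z - c)" "isCont g c" "g c = p c"
    using P[of c] unfolding CARAT_DERIV by blast
  have "isCont clamp01 t"
    using continuous_clamp01[of UNIV] by (simp add: continuous_on_eq_continuous_at)
  then have "isCont (\<lambda>s. g (clamp01 s)) t"
    using g(2) by (auto simp: c_def intro: isCont_o2)
  then have "((\<lambda>h. g (clamp01 (t + h))) \<longlongrightarrow> 0) (at 0)"
    using g(3) c LIM_offset_zero[of "\<lambda>s. g (clamp01 s)" 0 t] unfolding isCont_def c_def by simp
  then have "((\<lambda>h. (P (clamp01 (t + h)) - P c) / h) \<longlongrightarrow> 0) (at 0)"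
  proof (rule Lim_null_comparison[rotated, OF tendsto_norm_zero])
    show "\<forall>\<^sub>F h in at 0. norm ((P (clamp01 (t + h)) - P c) / h) \<le> norm (g (clamp01 (t + h)))"
    proof (rule eventually_at_filter[THEN iffD2, OF always_eventually], intro allI impI)
      fix h :: real assume "h \<noteq> 0"
      have "\<bar>g (clamp01 (t + h))\<bar> * \<bar>clamp01 (t + h) - c\<bar> \<le> \<bar>g (clamp01 (t + h))\<bar> * \<bar>h\<bar>"
        using clamp01_lipschitz[of "t + h" t] by (intro mult_left_mono) (auto simp: c_def)
      then show "norm ((P (clamp01 (t + h)) - P c) / h) \<le> norm (g (clamp01 (t + h)))"
        using \<open>h \<noteq> 0\<close> by (simp add: g(1) abs_mult pos_divide_le_eq mult.assoc)
    qed
  qed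
  with c show ?thesis by (simp add: DERIV_def c_def)
qed

text \<open>The polynomial \<open>6 z\<^sup>5 - 15 z\<^sup>4 + 10 z\<^sup>3\<close> rises from
  \<open>0\<close> to \<open>1\<close> on the unit interval, and its first two derivatives vanish at
  both ends; hence its composition with clamping is \<open>C\<^sup>2\<close>.\<close>

definition step :: "real \<Rightarrow> real" where
  "step t = (let z = clamp01 t in z^3 * (6 * z^2 - 15 * z + 10))"

definition step' :: "real \<Rightarrow> real" where
  "step' t = (let z = clamp01 t in 30 * z^2 * (1 - z)^2)"

definition step'' :: "real \<Rightarrow> real" where
  "step'' t = (let z = clamp01 t in 60 * z * (1 - z) * (1 - 2 * z))"

lemma step_deriv: "(step has_real_derivative step' t) (at t)"
proof -
  have *: "((\<lambda>z. z^3 * (6 * z^2 - 15 * z + 10)) has_real_derivative 30 * z^2 * (1 - z)^2) (at z)"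
    for z :: real
    by (auto intro!: derivative_eq_intros) (simp add: power2_eq_square power3_eq_cube algebra_simps)
  show ?thesis unfolding step_def[abs_def] step'_def Let_def
    by (rule DERIV_comp_clamp01[OF *]) auto
qed

lemma step'_deriv: "(step' has_real_derivative step'' t) (at t)"
proof -
  have *: "((\<lambda>z. 30 * z^2 * (1 - z)^2) has_real_derivative 60 * z * (1 - z) * (1 - 2 * z)) (at z)"
    for z :: real
    by (auto intro!: derivative_eq_intros) (simp add: power2_eq_square power3_eq_cube algebra_simps)
  show ?thesis unfolding step'_def[abs_def] step''_def Let_def
    by (rule DERIV_comp_clamp01[OF *]) auto
qed

lemma continuous_step''[continuous_intros]: "continuous_on A f \<Longrightarrow> continuous_on A (\<lambda>x. step'' (f x))"
  unfolding step''_def[abs_def] Let_def clamp01_def by (intro continuous_intros)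

lemma continuous_step'[continuous_intros]: "continuous_on A f \<Longrightarrow> continuous_on A (\<lambda>x. step' (f x))"
  unfolding step'_def[abs_def] Let_def clamp01_def by (intro continuous_intros)

lemma continuous_step[continuous_intros]: "continuous_on A f \<Longrightarrow> continuous_on A (\<lambda>x. step (f x))"
  unfolding step_def[abs_def] Let_def clamp01_def by (intro continuous_intros)

lemma step_eq_0: "t \<le> 0 \<Longrightarrow> step t = 0" and step_eq_1: "t \<ge> 1 \<Longrightarrow> step t = 1"
  and step'_eq_0: "t \<le> 0 \<or> t \<ge> 1 \<Longrightarrow> step' t = 0"
  and step''_eq_0: "t \<le> 0 \<or> t \<ge> 1 \<Longrightarrow> step'' t = 0"
  by (auto simp: step_def step'_def step''_def clamp01_def)

lemma step_bounds: "0 \<le> step t" "step t \<le> 1"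
proof -
  define z where "z = clamp01 t"
  have z: "0 \<le> z" "z \<le> 1" by (auto simp: z_def clamp01_def)
  \<comment> \<open>Both factorisations have only manifestly nonnegative factors on the unit interval.\<close>
  have "6 * z^2 - 15 * z + 10 = 6 * (z - 5/4)^2 + 5/8"
    by (simp add: power2_eq_square algebra_simps)
  then have "6 * z^2 - 15 * z + 10 \<ge> 0" by simp
  then show "0 \<le> step t" using z by (simp add: step_def Let_def z_def[symmetric])
  have "1 - step t = (1 - z)^3 * (6 * z^2 + 3 * z + 1)"
    unfolding step_def Let_def z_def[symmetric] by (simp add: power2_eq_square power3_eq_cube algebra_simps)
  also have "\<dots> \<ge> 0" using z by simp
  finally show "step t \<le> 1" by simp
qed

text \<open>\<open>C\<^sup>1\<close> approximations from below, as \<open>j\<close> grows, of the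
  indicator function of \<open>{a<..<b}\<close>.\<close>

definition bump :: "real \<Rightarrow> real \<Rightarrow> nat \<Rightarrow> real \<Rightarrow> complex" where
  "bump a b j t = of_real (step (real j * (t - a)) * step (real j * (b - t)))"

definition bump' :: "real \<Rightarrow> real \<Rightarrow> nat \<Rightarrow> real \<Rightarrow> complex" where
  "bump' a b j t = of_real (real j * step' (real j * (t - a)) * step (real j * (b - t))
     - real j * step (real j * (t - a)) * step' (real j * (b - t)))"

lemma bump_deriv: "(bump a b j has_vector_derivative bump' a b j t) (at t)"
proof -
  have "((\<lambda>t. step (real j * (t - a)) * step (real j * (b - t))) has_real_derivative
    real j * step' (real j * (t - a)) * step (real j * (b - t))
     - real j * step (real j * (t - a)) * step' (real j * (b - t))) (at t)"
    by (auto intro!: derivative_eq_intros DERIV_chain2[OF step_deriv])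
  then show ?thesis
    unfolding bump_def[abs_def] bump'_def
    by (intro has_vector_derivative_of_real) (simp add: has_real_derivative_iff_has_vector_derivative)
qed

lemma continuous_bump': "continuous_on UNIV (bump' a b j)"
  unfolding bump'_def[abs_def] by (intro continuous_intros)

lemma bump_eq_0: "t \<le> a \<or> t \<ge> b \<Longrightarrow> bump a b j t = 0"
  by (auto simp: bump_def step_eq_0 mult_nonneg_nonpos)

lemma bump_norm_le: "norm (bump a b j t) \<le> 1"
  using step_bounds mult_le_one[OF step_bounds(2) step_bounds]
  by (simp add: bump_def norm_mult)

lemma bump_tendsto:
  "(\<lambda>j. bump a b j t) \<longlonglongrightarrow> indicator {a<..<b} t"
proof (cases "a < t \<and> t < b")
  case True
  have "eventually (\<lambda>j::nat. real j * (t - a) \<ge> 1) sequentially"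
    "eventually (\<lambda>j::nat. real j * (b - t) \<ge> 1) sequentially"
    using True by real_asymp+
  then have "eventually (\<lambda>j. bump a b j t = 1) sequentially"
    by eventually_elim (simp add: bump_def step_eq_1)
  with True show ?thesis by (auto intro: tendsto_eventually)
next
  case False
  then show ?thesis by (auto simp: bump_eq_0)
qed

lemma C1_on_tensor_bump: "C1_on S (tensor (bump a b j) (bump c d k))"
  by (rule C1_on_tensor[OF bump_deriv bump_deriv continuous_bump' continuous_bump'])

section \<open>Difference quotients\<close>

lemma continuous_on_zero_outside_cball_bounded:
  fixes G :: "'a::euclidean_space \<Rightarrow> 'b::real_normed_vector"
  assumes "continuous_on UNIV G" "\<And>x. norm x > R \<Longrightarrow> G x = 0"
  obtains K where "K \<ge> 0" "\<And>x. norm (G x) \<le> K"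
proof -
  have "bounded (G ` cball 0 R)"
    using assms(1) by (intro compact_imp_bounded compact_continuous_image) (auto intro: continuous_on_subset)
  then obtain K where K: "K > 0" "\<And>x. x \<in> cball 0 R \<Longrightarrow> norm (G x) \<le> K"
    unfolding bounded_pos by auto
  have "norm (G x) \<le> K" for x
    using K assms(2)[of x] by (cases "norm x \<le> R") auto
  with K(1) that show ?thesis by (meson less_imp_le)
qed

lemma integrable_zero_outside_cball:
  fixes G :: "'a::euclidean_space \<Rightarrow> 'b::{banach, second_countable_topology}"
  assumes "G \<in> borel_measurable borel" "\<And>x. norm (G x) \<le> K" "\<And>x. norm x > R \<Longrightarrow> G x = 0"
  shows "integrable lborel G"
  by (rule integrableI_bounded_set[where A = "cball 0 R" and B = K])
    (use assms emeasure_bounded_finite[of "cball 0 R"] in auto)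

lemma lborel_integral_translate:
  fixes F :: "'a::euclidean_space \<Rightarrow> 'b::{banach, second_countable_topology}"
  assumes "F \<in> borel_measurable borel"
  shows "(LINT x|lborel. F (x + c)) = (LINT x|lborel. F x)"
proof -
  have "(LINT x|lborel. F x) = (LINT x|distr lborel borel ((+) c). F x)"
    by (simp add: lborel_distr_plus)
  also have "\<dots> = (LINT x|lborel. F (c + x))"
    using assms by (subst integral_distr) auto
  finally show ?thesis by (simp add: add.commute)
qed

lemma C1_on_difference_le:
  assumes F: "C1_on UNIV F" and K: "\<And>x. norm (partial e F x) \<le> K"
  shows "norm (F (x + h *\<^sub>R e) - F x) \<le> K * \<bar>h\<bar>"
proof -
  have D: "((\<lambda>t. F (x + t *\<^sub>R e)) has_derivative (\<lambda>s. s *\<^sub>R partial e F (x + t *\<^sub>R e))) (at t)" for t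
  proof -
    have 1: "((\<lambda>t. x + t *\<^sub>R e) has_derivative (\<lambda>s. s *\<^sub>R e)) (at t)"
      by (auto intro!: derivative_eq_intros)
    have 2: "(F has_derivative (\<lambda>h. partial h F (x + t *\<^sub>R e))) (at (x + t *\<^sub>R e))"
      by (rule C1_on_has_derivative[OF F]) simp
    from has_derivative_compose[OF 1 2] show ?thesis by (simp add: partial_scaleR[OF F])
  qed
  have "norm ((\<lambda>t. F (x + t *\<^sub>R e)) h - (\<lambda>t. F (x + t *\<^sub>R e)) 0) \<le> K * norm (h - 0)"
  proof (rule differentiable_bound[OF convex_UNIV])
    fix t :: real
    show "onorm (\<lambda>s. s *\<^sub>R partial e F (x + t *\<^sub>R e)) \<le> K"
      by (rule onorm_le) (metis K norm_scaleR mult.commute mult_left_mono norm_ge_zero real_norm_def)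
  qed (use D in auto)
  then show ?thesis by simp
qed

lemma difference_quotient_tendsto:
  assumes F: "C1_on UNIV F"
  shows "(\<lambda>n. (F (x + (1 / real (Suc n)) *\<^sub>R e) - F x) * of_nat (Suc n)) \<longlonglongrightarrow> partial e F x"
proof -
  have 1: "((\<lambda>t. x + t *\<^sub>R e) has_derivative (\<lambda>s. s *\<^sub>R e)) (at 0)"
    by (auto intro!: derivative_eq_intros)
  have 2: "(F has_derivative (\<lambda>h. partial h F x)) (at (x + 0 *\<^sub>R e))"
    using C1_on_has_derivative[OF F, of x] by simp
  from has_derivative_compose[OF 1 2]
  have "((\<lambda>t. F (x + t *\<^sub>R e)) has_vector_derivative partial e F x) (at 0)"
    by (simp add: has_vector_derivative_def partial_scaleR[OF F])
  then have "((\<lambda>h. norm (F (x + h *\<^sub>R e) - F x - h *\<^sub>R partial e F x) / \<bar>h\<bar>) \<longlongrightarrow> 0) (at 0)"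
    by (simp add: has_vector_derivative_def has_derivative_iff_norm)
  then have "((\<lambda>h. norm ((F (x + h *\<^sub>R e) - F x) /\<^sub>R h - partial e F x)) \<longlongrightarrow> 0) (at 0)"
  proof (rule Lim_transform_eventually, intro eventually_at_filter[THEN iffD2] always_eventually allI impI)
    fix h :: real assume "h \<noteq> 0"
    then have "F (x + h *\<^sub>R e) - F x - h *\<^sub>R partial e F x
        = h *\<^sub>R ((F (x + h *\<^sub>R e) - F x) /\<^sub>R h - partial e F x)"
      by (simp add: scaleR_diff_right)
    then show "norm (F (x + h *\<^sub>R e) - F x - h *\<^sub>R partial e F x) / \<bar>h\<bar>
        = norm ((F (x + h *\<^sub>R e) - F x) /\<^sub>R h - partial e F x)"
      using \<open>h \<noteq> 0\<close> by simp
  qed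
  then have "((\<lambda>h. (F (x + h *\<^sub>R e) - F x) /\<^sub>R h - partial e F x) \<longlongrightarrow> 0) (at 0)"
    by (rule tendsto_norm_zero_cancel)
  then have "((\<lambda>h. (F (x + h *\<^sub>R e) - F x) /\<^sub>R h) \<longlongrightarrow> partial e F x) (at 0)"
    by (rule LIM_zero_cancel)
  moreover have "filterlim (\<lambda>n. 1 / real (Suc n)) (at 0) sequentially"
    using LIMSEQ_Suc[OF lim_1_over_n[where 'a = real]] by (auto simp: filterlim_at)
  ultimately have "(\<lambda>n. (F (x + (1 / real (Suc n)) *\<^sub>R e) - F x) /\<^sub>R (1 / real (Suc n))) \<longlonglongrightarrow> partial e F x"
    by (rule filterlim_compose)
  then show ?thesis by (simp add: scaleR_conv_of_real mult.commute)
qed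

text \<open>Dominated convergence turns the difference quotient into the partial derivative. This is
  useful because the integral of a difference quotient can be rewritten by translating the domain
  \<open>S\<close>: it sees \<open>F\<close> only near the boundary of \<open>S\<close>.\<close>

lemma integral_difference_quotient_tendsto:
  fixes F :: "'a::euclidean_space \<Rightarrow> complex"
  assumes F: "C1_on UNIV F" and R: "\<And>x. F x \<noteq> 0 \<Longrightarrow> norm x \<le> R"
    and e: "e \<in> Basis" and S: "S \<in> sets borel"
  shows "(\<lambda>n. (LINT x:S|lborel. (F (x + (1 / real (Suc n)) *\<^sub>R e) - F x) * of_nat (Suc n)))
    \<longlonglongrightarrow> (LINT x:S|lborel. partial e F x)"
proof -
  have cF: "continuous_on UNIV F" using C1_on_continuous_on[OF F] .
  have cP: "continuous_on UNIV (partial e F)" using C1_on_partial_continuous[OF F e] .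
  have [measurable]: "F \<in> borel_measurable borel" "partial e F \<in> borel_measurable borel" "S \<in> sets borel"
    using cF cP S by (auto intro: borel_measurable_continuous_onI)
  obtain K where K: "K \<ge> 0" "\<And>x. norm (partial e F x) \<le> K"
    using continuous_on_zero_outside_cball_bounded[OF cP] partial_zero_outside_cball[OF R] by metis
  show ?thesis
    unfolding set_lebesgue_integral_def
  proof (rule integral_dominated_convergence[where w = "\<lambda>x. indicator (cball 0 (R + 1)) x * K"])
    show "integrable lborel (\<lambda>x::'a. indicator (cball 0 (R + 1)) x * K :: real)"
      using emeasure_bounded_finite[of "cball (0::'a) (R + 1)"]
      by (intro integrable_mult_left integrable_real_indicator) auto
    show "AE x in lborel. (\<lambda>n. indicator S x *\<^sub>R ((F (x + (1 / real (Suc n)) *\<^sub>R e) - F x) * of_nat (Suc n)))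
        \<longlonglongrightarrow> indicator S x *\<^sub>R partial e F x"
      by (intro AE_I2 tendsto_scaleR tendsto_const difference_quotient_tendsto[OF F])
    fix n
    define h where "h = 1 / real (Suc n)"
    have h: "0 < h" "h \<le> 1" by (auto simp: h_def)
    have "norm (indicator S x *\<^sub>R ((F (x + h *\<^sub>R e) - F x) * of_nat (Suc n)))
        \<le> indicator (cball 0 (R + 1)) x * K" for x
    proof (cases "norm x \<le> R + 1")
      case True
      have "norm (F (x + h *\<^sub>R e) - F x) * real (Suc n) \<le> K * \<bar>h\<bar> * real (Suc n)"
        by (intro mult_right_mono C1_on_difference_le[OF F K(2)]) auto
      also have "\<dots> = K" by (simp add: h_def)
      finally show ?thesis using True K(1) by (auto simp: indicator_def norm_mult simp del: of_nat_Suc)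
    next
      case False
      have "norm x \<le> norm (x + h *\<^sub>R e) + h"
        using norm_triangle_ineq4[of "x + h *\<^sub>R e" "h *\<^sub>R e"] h e by simp
      with False h have "norm (x + h *\<^sub>R e) > R" "norm x > R" by auto
      then have "F (x + h *\<^sub>R e) = 0" "F x = 0" using R by fastforce+
      with False show ?thesis by (simp add: K(1))
    qed
    then show "AE x in lborel. norm (indicator S x *\<^sub>R ((F (x + (1 / real (Suc n)) *\<^sub>R e) - F x) * of_nat (Suc n)))
        \<le> indicator (cball 0 (R + 1)) x * K"
      by (simp add: h_def)
  qed measurable
qed

text \<open>By translation invariance every difference quotient integrates to zero.\<close>

lemma integral_partial_eq_0:
  fixes F :: "'a::euclidean_space \<Rightarrow> complex"
  assumes F: "C1_on UNIV F" and R: "\<And>x. F x \<noteq> 0 \<Longrightarrow> norm x \<le> R" and e: "e \<in> Basis"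
  shows "(LINT x|lborel. partial e F x) = 0"
proof -
  have cF: "continuous_on UNIV F" using C1_on_continuous_on[OF F] .
  then have m [measurable]: "F \<in> borel_measurable borel" by (auto intro: borel_measurable_continuous_onI)
  obtain K where K: "\<And>x. norm (F x) \<le> K"
    using continuous_on_zero_outside_cball_bounded[OF cF] R by (metis not_le)
  have i: "integrable lborel F"
    by (rule integrable_zero_outside_cball[OF m K, of R]) (use R in fastforce)
  have i': "integrable lborel (\<lambda>x. F (x + c))" for c
  proof (rule integrable_zero_outside_cball[of _ K "R + norm c"])
    fix x :: 'a assume "norm x > R + norm c"
    then have "norm (x + c) > R" using norm_triangle_ineq4[of "x + c" c] by simp
    then show "F (x + c) = 0" using R by fastforce
  qed (use K in auto)
  have "(LINT x:UNIV|lborel. (F (x + (1 / real (Suc n)) *\<^sub>R e) - F x) * of_nat (Suc n)) = 0" for n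
    using i i' lborel_integral_translate[OF m] by (simp add: set_lebesgue_integral_def del: of_nat_Suc)
  with integral_difference_quotient_tendsto[OF F R e, of UNIV] show ?thesis
    by (simp add: set_lebesgue_integral_def LIMSEQ_const_iff del: of_nat_Suc)
qed

section \<open>Classical and weak derivatives\<close>

text \<open>The product of \<open>w\<close> with a test function is globally \<open>C\<^sup>1\<close>
  with bounded support, so its derivative integrates to zero; the product rule splits this integral into
  the two sides of the claim.\<close>

lemma has_weak_partial_classical:
  fixes w :: "'a::euclidean_space \<Rightarrow> complex"
  assumes S: "open S" and w: "C1_on S w" and i: "i \<in> Basis"
  shows "has_weak_partial S i w (partial i w)"
proof -
  have loc: "loc_integrable_on S g" if "continuous_on S g" for g :: "'a \<Rightarrow> complex"
    using that unfolding loc_integrable_on_def set_integrable_def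
    by (auto intro: borel_integrable_compact continuous_on_subset)
  have cw: "continuous_on S w" "continuous_on S (partial i w)"
    using w i C1_on_continuous_on C1_on_partial_continuous by blast+
  have "(LINT x:S|lborel. w x * partial i \<phi> x) = - (LINT x:S|lborel. partial i w x * \<phi> x)"
    if \<phi>: "\<phi> \<in> test_functions S" for \<phi>
  proof -
    define T where "T = closure {x. \<phi> x \<noteq> 0}"
    have T: "compact T" "T \<subseteq> S" "\<And>x. x \<notin> T \<Longrightarrow> \<phi> x = 0" "\<And>x. x \<notin> T \<Longrightarrow> partial i \<phi> x = 0"
      using \<phi> closure_subset[of "{x. \<phi> x \<noteq> 0}"] partial_zero_outside_support[of _ \<phi> i]
      by (auto simp: T_def test_functions_def)
    have c\<phi>: "C1_on UNIV \<phi>" using \<phi> by (simp add: test_functions_def)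
    then have c\<phi>': "continuous_on S \<phi>" "continuous_on S (partial i \<phi>)"
      using i C1_on_continuous_on C1_on_partial_continuous continuous_on_subset by blast+
    let ?F = "\<lambda>x. w x * \<phi> x"
    have F: "C1_on UNIV ?F" by (rule C1_on_mult_test_function[OF S w \<phi>])
    obtain R where R: "\<And>x. x \<in> T \<Longrightarrow> norm x \<le> R"
      using T(1) compact_imp_bounded bounded_iff by metis
    have 0: "(LINT x|lborel. partial i ?F x) = 0"
      by (rule integral_partial_eq_0[OF F _ i, of R]) (use R T(3) in fastforce)
    have eq: "partial i ?F x = indicator T x *\<^sub>R (partial i w x * \<phi> x) + indicator T x *\<^sub>R (w x * partial i \<phi> x)" for x
    proof (cases "x \<in> T")
      case True
      then have "x \<in> S" using T by auto
      then show ?thesis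
        using True partial_mult[OF w C1_on_subset[OF c\<phi>], of x i] by simp
    next
      case False
      have "closure {x. ?F x \<noteq> 0} \<subseteq> T" unfolding T_def by (intro closure_mono) auto
      with False show ?thesis by (auto intro!: partial_zero_outside_support)
    qed
    have i1: "integrable lborel (\<lambda>x. indicator T x *\<^sub>R (partial i w x * \<phi> x))"
      and i2: "integrable lborel (\<lambda>x. indicator T x *\<^sub>R (w x * partial i \<phi> x))"
      using T cw c\<phi>' by (auto intro!: borel_integrable_compact continuous_on_mult intro: continuous_on_subset)
    have a: "(\<lambda>x. indicator T x *\<^sub>R (partial i w x * \<phi> x)) = (\<lambda>x. indicator S x *\<^sub>R (partial i w x * \<phi> x))"
      "(\<lambda>x. indicator T x *\<^sub>R (w x * partial i \<phi> x)) = (\<lambda>x. indicator S x *\<^sub>R (w x * partial i \<phi> x))"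
      using T(2-4) by (auto simp: indicator_def fun_eq_iff)
    from 0 have "(LINT x|lborel. indicator T x *\<^sub>R (partial i w x * \<phi> x)) + (LINT x|lborel. indicator T x *\<^sub>R (w x * partial i \<phi> x)) = 0"
      unfolding eq by (subst (asm) Bochner_Integration.integral_add[OF i1 i2])
    then show ?thesis unfolding set_lebesgue_integral_def a by (simp add: eq_neg_iff_add_eq_0 add.commute)
  qed
  with cw loc show ?thesis by (simp add: has_weak_partial_def)
qed

text \<open>The sets over which \<open>G\<close> integrates to zero form a Dynkin system, and boxes are
  a generator of the Borel sets that is stable under intersection.\<close>

lemma integral_box_eq_0_imp_AE_eq_0:
  fixes G :: "'a::euclidean_space \<Rightarrow> complex"
  assumes G: "integrable lborel G" and 0: "\<And>a b. (LINT x:box a b|lborel. G x) = 0"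
    and UNIV: "(LINT x|lborel. G x) = 0"
  shows "AE x in lborel. G x = 0"
proof -
  note [measurable] = borel_measurable_integrable[OF G]
  have si: "set_integrable lborel A G" if "A \<in> sets borel" for A
    using that integrable_mult_indicator[of A lborel G] G by (simp add: set_integrable_def)
  have A: "(LINT x:A|lborel. G x) = 0" if "A \<in> sets borel" for A
  proof -
    have "Int_stable (range (\<lambda>(a, b). box a b :: 'a set))" "range (\<lambda>(a, b). box a b :: 'a set) \<subseteq> Pow UNIV"
      "A \<in> sigma_sets UNIV (range (\<lambda>(a, b). box a b))"
      using that by (auto simp: Int_stable_def box_Int_box borel_eq_box)
    then show ?thesis
    proof (induction rule: sigma_sets_induct_disjoint)
      case (basic A) then show ?case using 0 by auto
    next
      case empty then show ?case by (simp add: set_lebesgue_integral_def)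
    next
      case (compl A)
      then have A: "A \<in> sets borel" by (simp add: borel_eq_box)
      have "(LINT x|lborel. G x) = (LINT x:A \<union> (UNIV - A)|lborel. G x)"
        by (simp add: set_lebesgue_integral_def)
      also have "\<dots> = (LINT x:A|lborel. G x) + (LINT x:UNIV - A|lborel. G x)"
        using A by (intro set_integral_Un si) auto
      finally show ?case using compl UNIV by simp
    next
      case (union F)
      then have "\<And>i. F i \<in> sets borel" by (auto simp: borel_eq_box)
      then have "(LINT x:(\<Union>i. F i)|lborel. G x) = (\<Sum>i. LINT x:F i|lborel. G x)"
        using union(1) by (intro lebesgue_integral_countable_add si) (auto simp: disjoint_family_on_def)
      then show ?case using union(3) by simp
    qed
  qed
  have "AE x in lborel. Re (G x) = 0" "AE x in lborel. Im (G x) = 0"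
  proof -
    have "(LINT x:A|lborel. Re (G x)) = 0" "(LINT x:A|lborel. Im (G x)) = 0" if "A \<in> sets borel" for A
      using A[OF that] si[OF that] integral_Re[of lborel "\<lambda>x. indicator A x *\<^sub>R G x"]
        integral_Im[of lborel "\<lambda>x. indicator A x *\<^sub>R G x"]
      by (simp_all add: set_lebesgue_integral_def set_integrable_def)
    then show "AE x in lborel. Re (G x) = 0" "AE x in lborel. Im (G x) = 0"
      using G by (auto intro!: density_unique_real[where f' = "\<lambda>_. 0"])
  qed
  then show ?thesis by eventually_elim (simp add: complex_eq_iff)
qed

lemma tensor_bump_eq_0:
  assumes "x \<notin> cbox (a, c) (b, d)"
  shows "tensor (bump a b j) (bump c d k) x = 0"
proof -
  have "fst x < a \<or> fst x > b \<or> snd x < c \<or> snd x > d"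
    using assms by (cases x) (auto simp: cbox_Pair_eq)
  then show ?thesis by (auto simp: tensor_def bump_eq_0)
qed

lemma tensor_bump_test_function:
  assumes "cbox (a, c) (b, d) \<subseteq> S"
  shows "tensor (bump a b j) (bump c d j) \<in> test_functions S"
proof -
  have "{x. tensor (bump a b j) (bump c d j) x \<noteq> 0} \<subseteq> cbox (a, c) (b, d)"
    using tensor_bump_eq_0 by blast
  then have *: "closure {x. tensor (bump a b j) (bump c d j) x \<noteq> 0} \<subseteq> cbox (a, c) (b, d)"
    by (rule closure_minimal) (rule closed_cbox)
  then have "compact (closure {x. tensor (bump a b j) (bump c d j) x \<noteq> 0})"
    by (meson bounded_cbox bounded_subset compact_eq_bounded_closed closed_closure)
  with * assms show ?thesis by (auto simp: test_functions_def C1_on_tensor_bump)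
qed

lemma tensor_bump_tendsto:
  "(\<lambda>j. tensor (bump a b j) (bump c d j) x) \<longlonglongrightarrow> indicator (box (a, c) (b, d)) x"
proof -
  have "(\<lambda>j. tensor (bump a b j) (bump c d j) x)
      \<longlonglongrightarrow> indicator {a<..<b} (fst x) * indicator {c<..<d} (snd x)"
    unfolding tensor_def by (intro tendsto_mult bump_tendsto)
  moreover have "indicator {a<..<b} (fst x) * indicator {c<..<d} (snd x) = (indicator (box (a, c) (b, d)) x :: complex)"
    by (cases x) (auto simp: indicator_def box_def Basis_plane)
  ultimately show ?thesis by simp
qed

lemma tensor_bump_norm_le: "norm (tensor (bump a b j) (bump c d j) x) \<le> 1"
  unfolding tensor_def norm_mult using mult_le_one[OF bump_norm_le norm_ge_zero bump_norm_le] .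

text \<open>The fundamental lemma of the calculus of variations. Products of bumps approximate the
  indicator functions of boxes inside \<open>S\<close>, so \<open>g\<close> integrates to zero over
  these boxes, countably many of which cover \<open>S\<close>.\<close>

lemma AE_eq_0_if_orthogonal_to_test_functions:
  fixes g :: "real \<times> real \<Rightarrow> complex"
  assumes S: "open S" and g: "loc_integrable_on S g"
    and 0: "\<And>\<phi>. \<phi> \<in> test_functions S \<Longrightarrow> (LINT x:S|lborel. g x * \<phi> x) = 0"
  shows "AE x in lborel. x \<in> S \<longrightarrow> g x = 0"
proof -
  have box0: "(LINT x:box p q|lborel. g x) = 0" if K: "cbox p q \<subseteq> S" for p q
  proof -
    obtain a c b d where pq: "p = (a, c)" "q = (b, d)" by (cases p; cases q) auto
    let ?b = "\<lambda>j. tensor (bump a b j) (bump c d j)"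
    have int: "integrable lborel (\<lambda>x. indicator (cbox p q) x *\<^sub>R g x)"
      using g K by (simp add: loc_integrable_on_def set_integrable_def)
    have [measurable]: "?b j \<in> borel_measurable borel" for j
      by (intro borel_measurable_continuous_onI C1_on_continuous_on C1_on_tensor_bump)
    have [measurable]: "(\<lambda>x. indicator (cbox p q) x *\<^sub>R g x) \<in> borel_measurable borel"
      using borel_measurable_integrable[OF int] by simp
    have b0: "?b j x = 0" if "x \<notin> cbox p q" for x j
      using that tensor_bump_eq_0 by (simp add: pq)
    have 1: "(LINT x:S|lborel. g x * ?b j x) = (LINT x|lborel. (indicator (cbox p q) x *\<^sub>R g x) * ?b j x)" for j
      unfolding set_lebesgue_integral_def using K b0
      by (intro Bochner_Integration.integral_cong) (auto simp: indicator_def)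
    have "(\<lambda>j. LINT x|lborel. (indicator (cbox p q) x *\<^sub>R g x) * ?b j x)
        \<longlonglongrightarrow> (LINT x|lborel. (indicator (cbox p q) x *\<^sub>R g x) * indicator (box p q) x)"
    proof (rule integral_dominated_convergence[where w = "\<lambda>x. norm (indicator (cbox p q) x *\<^sub>R g x)"])
      show "AE x in lborel. (\<lambda>j. (indicator (cbox p q) x *\<^sub>R g x) * ?b j x)
        \<longlonglongrightarrow> (indicator (cbox p q) x *\<^sub>R g x) * indicator (box p q) x"
        unfolding pq by (intro AE_I2 tendsto_mult tendsto_const tensor_bump_tendsto)
      show "AE x in lborel. norm ((indicator (cbox p q) x *\<^sub>R g x) * ?b j x)
         \<le> norm (indicator (cbox p q) x *\<^sub>R g x)" for j
        unfolding norm_mult by (intro AE_I2 mult_left_le tensor_bump_norm_le norm_ge_zero)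
      show "integrable lborel (\<lambda>x. norm (indicator (cbox p q) x *\<^sub>R g x))"
        by (rule integrable_norm[OF int])
      show "(\<lambda>x. (indicator (cbox p q) x *\<^sub>R g x) * indicator (box p q) x) \<in> borel_measurable lborel"
        by (rule borel_measurable_times) simp_all
      show "(\<lambda>x. (indicator (cbox p q) x *\<^sub>R g x) * ?b j x) \<in> borel_measurable lborel" for j
        by (rule borel_measurable_times) simp_all
    qed
    moreover have "(LINT x|lborel. (indicator (cbox p q) x *\<^sub>R g x) * ?b j x) = 0" for j
      using 1 0 tensor_bump_test_function K unfolding pq by metis
    ultimately have "(LINT x|lborel. (indicator (cbox p q) x *\<^sub>R g x) * indicator (box p q) x) = 0"
      by (simp add: LIMSEQ_const_iff)
    also have "(\<lambda>x. (indicator (cbox p q) x *\<^sub>R g x) * indicator (box p q) x) = (\<lambda>x. indicator (box p q) x *\<^sub>R g x)"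
      using box_subset_cbox[of p q] by (auto simp: indicator_def fun_eq_iff)
    finally show ?thesis by (simp add: set_lebesgue_integral_def)
  qed
  have AE_box: "AE x in lborel. x \<in> box p q \<longrightarrow> g x = 0" if K: "cbox p q \<subseteq> S" for p q
  proof -
    have si: "set_integrable lborel (cbox p q) g"
      using g K by (simp add: loc_integrable_on_def)
    have "set_integrable lborel (box p q) g"
      by (rule set_integrable_subset[OF si]) (auto simp: box_subset_cbox)
    then have int: "integrable lborel (\<lambda>x. indicator (box p q) x *\<^sub>R g x)"
      by (simp add: set_integrable_def)
    have "AE x in lborel. indicator (box p q) x *\<^sub>R g x = 0"
    proof (rule integral_box_eq_0_imp_AE_eq_0[OF int])
      fix a b :: "real \<times> real"
      obtain r s where rs: "box a b \<inter> box p q = box r s" by (simp add: box_Int_box)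
      have "(LINT x:box r s|lborel. g x) = 0"
      proof (cases "box r s = {}")
        case False
        then have "cbox r s \<subseteq> cbox p q"
          using rs by (metis Int_lower2 closure_box closure_minimal closed_cbox box_subset_cbox order_trans)
        with K show ?thesis by (intro box0) auto
      qed (simp add: set_lebesgue_integral_def)
      moreover have "(\<lambda>x. indicator (box a b) x *\<^sub>R (indicator (box p q) x *\<^sub>R g x)) = (\<lambda>x. indicator (box r s) x *\<^sub>R g x)"
        by (simp add: indicator_inter_arith flip: rs)
      ultimately show "(LINT x:box a b|lborel. indicator (box p q) x *\<^sub>R g x) = 0"
        by (simp add: set_lebesgue_integral_def)
    next
      show "(LINT x|lborel. indicator (box p q) x *\<^sub>R g x) = 0"
        using box0[OF K] by (simp add: set_lebesgue_integral_def)
    qed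
    then show ?thesis by eventually_elim auto
  qed
  define B where "B = {box p q | p q :: real \<times> real. cbox p q \<subseteq> S}"
  obtain B' where B': "B' \<subseteq> B" "countable B'" "\<Union>B' = \<Union>B"
    using Lindelof[of B] by (auto simp: B_def)
  have cover: "S \<subseteq> \<Union>B"
  proof
    fix x assume "x \<in> S"
    then obtain p q where "cbox p q \<subseteq> S" "x \<in> box p q"
      using S by (metis open_contains_cbox)
    then show "x \<in> \<Union>B" unfolding B_def by blast
  qed
  have "AE x in lborel. \<forall>b\<in>B'. x \<in> b \<longrightarrow> g x = 0"
    using B' AE_box by (subst AE_ball_countable) (auto simp: B_def)
  then show ?thesis by eventually_elim (use cover B'(3) in blast)
qed

lemma has_weak_partial_unique_classical:
  fixes w :: "real \<times> real \<Rightarrow> complex"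
  assumes S: "open S" and w: "C1_on S w" and i: "i \<in> Basis" and g: "has_weak_partial S i w g"
  shows "AE x in lborel. x \<in> S \<longrightarrow> g x = partial i w x"
proof -
  have c: "has_weak_partial S i w (partial i w)" by (rule has_weak_partial_classical[OF S w i])
  have loc: "loc_integrable_on S g" "loc_integrable_on S (partial i w)"
    using g c by (auto simp: has_weak_partial_def)
  have prod: "set_integrable lborel S (\<lambda>x. h x * \<phi> x)"
    if h: "loc_integrable_on S h" and \<phi>: "\<phi> \<in> test_functions S" for h \<phi> :: "real \<times> real \<Rightarrow> complex"
  proof -
    define T where "T = closure {x. \<phi> x \<noteq> 0}"
    have T: "compact T" "T \<subseteq> S" "\<And>x. x \<notin> T \<Longrightarrow> \<phi> x = 0"
      using \<phi> closure_subset[of "{x. \<phi> x \<noteq> 0}"] by (auto simp: T_def test_functions_def)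
    have c\<phi>: "continuous_on UNIV \<phi>" using \<phi> C1_on_continuous_on by (auto simp: test_functions_def)
    obtain R where R: "\<And>x. x \<in> T \<Longrightarrow> norm x \<le> R" using T(1) compact_imp_bounded bounded_iff by metis
    obtain K where K: "\<And>x. norm (\<phi> x) \<le> K"
      using continuous_on_zero_outside_cball_bounded[OF c\<phi>, of R] R T(3) by (metis not_le)
    have K': "norm (\<phi> x) \<le> norm (complex_of_real K)" for x
      using order_trans[OF K[of x] abs_ge_self] by simp
    have [measurable]: "\<phi> \<in> borel_measurable borel" by (rule borel_measurable_continuous_onI[OF c\<phi>])
    have i: "integrable lborel (\<lambda>x. indicator T x *\<^sub>R h x)"
      using h T by (simp add: loc_integrable_on_def set_integrable_def)
    note [measurable] = borel_measurable_integrable[OF i]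
    have "integrable lborel (\<lambda>x. (indicator T x *\<^sub>R h x) * \<phi> x)"
    proof (rule Bochner_Integration.integrable_bound[where f = "\<lambda>x. (indicator T x *\<^sub>R h x) * complex_of_real K"])
      show "integrable lborel (\<lambda>x. (indicator T x *\<^sub>R h x) * complex_of_real K)"
        by (rule integrable_mult_left) (rule i)
      show "(\<lambda>x. (indicator T x *\<^sub>R h x) * \<phi> x) \<in> borel_measurable lborel"
        by (rule borel_measurable_times) simp_all
      have "norm ((indicator T x *\<^sub>R h x) * \<phi> x) \<le> norm ((indicator T x *\<^sub>R h x) * complex_of_real K)" for x
        using mult_left_mono[OF K'[of x] norm_ge_zero[of "indicator T x *\<^sub>R h x"]]
        by (simp only: norm_mult[of "indicator T x *\<^sub>R h x"])
      then show "AE x in lborel. norm ((indicator T x *\<^sub>R h x) * \<phi> x) \<le> norm ((indicator T x *\<^sub>R h x) * complex_of_real K)"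
        by simp
    qed
    moreover have "(\<lambda>x. (indicator T x *\<^sub>R h x) * \<phi> x) = (\<lambda>x. indicator S x *\<^sub>R (h x * \<phi> x))"
      using T by (auto simp: indicator_def fun_eq_iff)
    ultimately show ?thesis by (simp add: set_integrable_def)
  qed
  have "loc_integrable_on S (\<lambda>x. g x - partial i w x)"
    using loc by (auto simp: loc_integrable_on_def intro: set_integral_diff(1))
  then have "AE x in lborel. x \<in> S \<longrightarrow> g x - partial i w x = 0"
  proof (rule AE_eq_0_if_orthogonal_to_test_functions[OF S])
    fix \<phi> assume \<phi>: "\<phi> \<in> test_functions S"
    have "(LINT x:S|lborel. (g x - partial i w x) * \<phi> x)
      = (LINT x:S|lborel. g x * \<phi> x) - (LINT x:S|lborel. partial i w x * \<phi> x)"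
      unfolding left_diff_distrib by (intro set_integral_diff(2) prod loc \<phi>)
    also have "\<dots> = 0"
    proof -
      have "(LINT x:S|lborel. w x * partial i \<phi> x) = - (LINT x:S|lborel. g x * \<phi> x)"
        "(LINT x:S|lborel. w x * partial i \<phi> x) = - (LINT x:S|lborel. partial i w x * \<phi> x)"
        using g c \<phi> by (simp_all add: has_weak_partial_def)
      then show ?thesis by simp
    qed
    finally show "(LINT x:S|lborel. (g x - partial i w x) * \<phi> x) = 0" .
  qed
  then show ?thesis by eventually_elim simp
qed

text \<open>The constant \<^const>\<open>weak_partial\<close> chooses some weak derivative. For a
  \<open>C\<^sup>1\<close> function this fact makes the choice harmless: weak gradients in the
  \<open>H\<^sup>1\<close> norm and in Green's identity become classical ones.\<close>

lemma weak_partial_AE: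
  fixes w :: "real \<times> real \<Rightarrow> complex"
  assumes "open S" "C1_on S w" "i \<in> Basis"
  shows "AE x in lborel. x \<in> S \<longrightarrow> weak_partial S i w x = partial i w x"
proof -
  have "has_weak_partial S i w (weak_partial S i w)"
    unfolding weak_partial_def by (rule someI[where P = "has_weak_partial S i w", OF has_weak_partial_classical[OF assms]])
  then show ?thesis by (rule has_weak_partial_unique_classical[OF assms])
qed

lemma L2_leb_on_iff:
  assumes "open S"
  shows "g \<in> L2 (leb_on S) \<longleftrightarrow> (\<lambda>x. indicator S x *\<^sub>R g x) \<in> borel_measurable borel \<and>
    set_integrable lborel S (\<lambda>x. (norm (g x))\<^sup>2)"
  using assms by (simp add: L2_def integrable_restrict_space borel_measurable_restrict_space_iff
      set_integrable_def mult.commute)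

lemma L2_norm_leb_on:
  assumes "open S"
  shows "L2_norm (leb_on S) g = sqrt (LINT x:S|lborel. (norm (g x))\<^sup>2)"
  using assms by (simp add: L2_norm_def integral_restrict_space set_lebesgue_integral_def)

lemma indicator_norm_square_measurable:
  assumes "(\<lambda>x. indicator S x *\<^sub>R h x) \<in> borel_measurable M"
  shows "(\<lambda>x. indicator S x *\<^sub>R (norm (h x))\<^sup>2) \<in> borel_measurable M"
proof -
  have "(\<lambda>x. (norm (indicator S x *\<^sub>R h x))\<^sup>2) \<in> borel_measurable M" using assms by measurable
  also have "(\<lambda>x. (norm (indicator S x *\<^sub>R h x))\<^sup>2) = (\<lambda>x. indicator S x *\<^sub>R (norm (h x))\<^sup>2)"
    by (auto simp: indicator_def)
  finally show ?thesis .
qed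

text \<open>An open set is a countable union of compact boxes, on each of which \<open>g\<close> is
  measurable. Measurability matters since the Bochner integral of a non-measurable function is
  \<open>0\<close> by convention.\<close>

lemma loc_integrable_on_measurable:
  fixes g :: "'a::euclidean_space \<Rightarrow> complex"
  assumes S: "open S" and g: "loc_integrable_on S g"
  shows "(\<lambda>x. indicator S x *\<^sub>R g x) \<in> borel_measurable borel"
proof -
  obtain D :: "'a set set" where D: "countable D" "\<And>X. X \<in> D \<Longrightarrow> \<exists>a b. X = cbox a b" "\<Union>D = S"
    using open_countable_Union_open_cbox[OF S] by metis
  have "(\<lambda>x. indicator S x *\<^sub>R g x) \<in> measurable (restrict_space borel X) borel"
    if X: "X \<in> insert (- S) D" for X
  proof (cases "X = - S")
    case True
    have "(\<lambda>x. indicator S x *\<^sub>R g x) \<in> measurable (restrict_space borel X) borel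
      \<longleftrightarrow> (\<lambda>x. 0 :: complex) \<in> measurable (restrict_space borel X) borel"
      by (rule measurable_cong) (auto simp: True space_restrict_space)
    then show ?thesis by simp
  next
    case False
    with X have "X \<in> D" by simp
    with D(2)[of X] D(3) have K: "compact X" "X \<subseteq> S" by (auto simp: compact_cbox)
    then have "(\<lambda>x. indicator X x *\<^sub>R g x) \<in> borel_measurable borel"
      using g by (auto simp: loc_integrable_on_def set_integrable_def dest!: borel_measurable_integrable)
    then have "g \<in> borel_measurable (restrict_space borel X)"
      using K by (subst borel_measurable_restrict_space_iff) (auto simp: borel_compact mult.commute)
    moreover have "g \<in> borel_measurable (restrict_space borel X) \<longleftrightarrow>
      (\<lambda>x. indicator S x *\<^sub>R g x) \<in> measurable (restrict_space borel X) borel"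
      using K by (intro measurable_cong) (auto simp: space_restrict_space indicator_def)
    ultimately show ?thesis by simp
  qed
  then show ?thesis
  proof (rule measurable_piecewise_restrict[rotated 3])
    show "countable (insert (- S) D)" using D by simp
    show "space borel \<subseteq> \<Union>(insert (- S) D)" using D by auto
    show "X \<inter> space borel \<in> sets borel" if "X \<in> insert (- S) D" for X
      using that D(2)[of X] S by auto
  qed
qed

lemma H1_imp_partial_L2:
  fixes w :: "real \<times> real \<Rightarrow> complex"
  assumes S: "open S" and w: "C1_on S w" and i: "i \<in> Basis" and H: "w \<in> H1 S"
  shows "partial i w \<in> L2 (leb_on S)"
proof -
  obtain g where g: "g \<in> L2 (leb_on S)" "has_weak_partial S i w g"
    using H i by (auto simp: H1_def)
  have [measurable]: "S \<in> sets borel" using S by simp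
  have m: "(\<lambda>x. indicator S x *\<^sub>R partial i w x) \<in> borel_measurable borel"
    using S C1_on_partial_continuous[OF w i]
    by (intro borel_measurable_continuous_on_indicator) auto
  have "AE x in lborel. indicator S x *\<^sub>R (norm (g x))\<^sup>2 = indicator S x *\<^sub>R (norm (partial i w x))\<^sup>2"
    using has_weak_partial_unique_classical[OF S w i g(2)] by eventually_elim (auto simp: indicator_def)
  then have "set_integrable lborel S (\<lambda>x. (norm (partial i w x))\<^sup>2)"
    using g(1) indicator_norm_square_measurable[OF m] unfolding L2_leb_on_iff[OF S] set_integrable_def
    by (auto intro: integrable_cong_AE_imp[where g = "\<lambda>x. indicator S x *\<^sub>R (norm (g x))\<^sup>2"])
  then show ?thesis using m by (simp add: L2_leb_on_iff[OF S])
qed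

lemma H1_norm_C1:
  fixes w :: "real \<times> real \<Rightarrow> complex"
  assumes S: "open S" and w: "C1_on S w"
  shows "H1_norm S w = sqrt ((LINT x:S|lborel. (norm (w x))\<^sup>2) +
    (\<Sum>i\<in>Basis. LINT x:S|lborel. (norm (partial i w x))\<^sup>2))"
proof -
  have "L2_norm (leb_on S) (weak_partial S i w) = sqrt (LINT x:S|lborel. (norm (partial i w x))\<^sup>2)"
    if i: "i \<in> Basis" for i
  proof -
    have [measurable]: "S \<in> sets borel" using S by simp
    have "has_weak_partial S i w (weak_partial S i w)"
      unfolding weak_partial_def by (rule someI[where P = "has_weak_partial S i w", OF has_weak_partial_classical[OF S w i]])
    then have m: "(\<lambda>x. indicator S x *\<^sub>R weak_partial S i w x) \<in> borel_measurable borel"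
      by (intro loc_integrable_on_measurable[OF S]) (simp add: has_weak_partial_def)
    have m': "(\<lambda>x. indicator S x *\<^sub>R partial i w x) \<in> borel_measurable borel"
      using S C1_on_partial_continuous[OF w i]
      by (intro borel_measurable_continuous_on_indicator) auto
    have "AE x in lborel. indicator S x *\<^sub>R (norm (weak_partial S i w x))\<^sup>2 = indicator S x *\<^sub>R (norm (partial i w x))\<^sup>2"
      using weak_partial_AE[OF S w i] by eventually_elim (auto simp: indicator_def)
    then have "(LINT x:S|lborel. (norm (weak_partial S i w x))\<^sup>2) = (LINT x:S|lborel. (norm (partial i w x))\<^sup>2)"
      unfolding set_lebesgue_integral_def
      using indicator_norm_square_measurable[OF m] indicator_norm_square_measurable[OF m']
      by (intro integral_cong_AE) auto
    then show ?thesis by (simp add: L2_norm_leb_on[OF S])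
  qed
  moreover have "(LINT x:S|lborel. (norm (h x))\<^sup>2) \<ge> 0" for h :: "real \<times> real \<Rightarrow> complex"
    unfolding set_lebesgue_integral_def by (intro Bochner_Integration.integral_nonneg) auto
  ultimately show ?thesis unfolding H1_norm_def L2_norm_leb_on[OF S] by simp
qed

section \<open>A boundary estimate on Lipschitz graph domains\<close>

lemma Omega_plus_eq:
  assumes "continuous_on UNIV f"
  shows "Omega_plus f = {x. f (fst x) < snd x}"
proof -
  have cl: "closed {x. snd x \<le> f (fst x)}"
    by (intro closed_Collect_le continuous_intros continuous_on_compose2[OF assms]) auto
  have "closure {x. snd x < f (fst x)} = {x. snd x \<le> f (fst x)}"
  proof
    show "closure {x. snd x < f (fst x)} \<subseteq> {x. snd x \<le> f (fst x)}"
      by (rule closure_minimal[OF _ cl]) auto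
    show "{x. snd x \<le> f (fst x)} \<subseteq> closure {x. snd x < f (fst x)}"
    proof
      fix x assume x: "x \<in> {x. snd x \<le> f (fst x)}"
      show "x \<in> closure {x. snd x < f (fst x)}" unfolding closure_approachable
      proof (intro allI impI)
        fix e :: real assume "e > 0"
        have "dist (fst x, snd x - e / 2) (fst x, snd x) = \<bar>e / 2\<bar>"
          unfolding dist_Pair_Pair dist_real_def by simp
        with \<open>e > 0\<close> have "dist (fst x, snd x - e / 2) x < e" by simp
        moreover have "(fst x, snd x - e / 2) \<in> {x. snd x < f (fst x)}" using x \<open>e > 0\<close> by simp
        ultimately show "\<exists>y\<in>{x. snd x < f (fst x)}. dist y x < e" by (rule bexI)
      qed
    qed
  qed
  then have "Omega_plus f = UNIV - {x. snd x \<le> f (fst x)}"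
    unfolding Omega_plus_def Omega_minus_def by (rule arg_cong)
  also have "\<dots> = {x. f (fst x) < snd x}"
    by (simp add: set_eq_iff not_le)
  finally show ?thesis .
qed

lemma open_Omega_plus: "open (Omega_plus f)"
  unfolding Omega_plus_def by (intro open_Diff) auto

lemma borel_measurable_plane_coordinates:
  fixes f :: "real \<Rightarrow> real"
  assumes "continuous_on UNIV f"
  shows "(\<lambda>x::real \<times> real. f (fst x)) \<in> borel_measurable borel"
    and "(\<lambda>x::real \<times> real. snd x) \<in> borel_measurable borel"
  by (intro borel_measurable_continuous_onI continuous_intros continuous_on_compose2[OF assms]; simp)+

lemma lipschitz_real_le:
  fixes f :: "real \<Rightarrow> real"
  assumes "M-lipschitz_on UNIV f"
  shows "\<bar>f s - f t\<bar> \<le> M * \<bar>s - t\<bar>"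
  using lipschitz_onD[OF assms, of s t] by (simp add: dist_real_def)

lemma lipschitz_UNIV_continuous: "M-lipschitz_on UNIV f \<Longrightarrow> continuous_on A f"
  using lipschitz_on_continuous_on continuous_on_subset by blast

text \<open>Each vertical section of the strip has length \<open>2 d\<close>, and on it \<open>F\<close>
  deviates from its value on the graph by at most \<open>K d\<close>; sections with \<open>\<bar>t\<bar>
  > R\<close> contribute nothing.\<close>

lemma integral_graph_strip_le:
  fixes F :: "real \<times> real \<Rightarrow> complex"
  assumes F: "C1_on UNIV F" and R: "\<And>x. F x \<noteq> 0 \<Longrightarrow> norm x \<le> R" "R \<ge> 0"
    and K: "K \<ge> 0" "\<And>x. norm (partial (0,1) F x) \<le> K"
    and f: "continuous_on UNIV f" and d: "d \<ge> 0"
  shows "(LINT x:{x. \<bar>snd x - f (fst x)\<bar> \<le> d}|lborel. norm (F x))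
    \<le> 2 * d * ((LINT t|lborel. norm (F (t, f t))) + 2 * R * K * d)"
proof -
  note [measurable] = borel_measurable_plane_coordinates[OF f]
  have cF: "continuous_on UNIV F" by (rule C1_on_continuous_on[OF F])
  have [measurable]: "F \<in> borel_measurable borel" by (rule borel_measurable_continuous_onI[OF cF])
  obtain B where B: "\<And>x. norm (F x) \<le> B"
    using continuous_on_zero_outside_cball_bounded[OF cF] R(1) by (metis not_le)
  let ?g = "\<lambda>x. indicator {x. \<bar>snd x - f (fst x)\<bar> \<le> d} x * norm (F x)"
  have m: "?g \<in> borel_measurable borel" by measurable
  have ig: "integrable (lborel :: (real \<times> real) measure) ?g"
    by (rule integrable_zero_outside_cball[OF m, of B R])
       (use B order_trans[OF norm_ge_zero B] R(1) in \<open>auto simp: indicator_def\<close>, fastforce)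
  have cFf: "continuous_on UNIV (\<lambda>t. F (t, f t))"
    by (intro continuous_on_compose2[OF cF] continuous_on_Pair continuous_on_id f) auto
  have far: "F (t, y) = 0" if "\<bar>t\<bar> > R" for t y
    using R(1)[of "(t, y)"] that norm_fst_le[of t y] by (auto simp: real_norm_def)
  have iFf: "integrable lborel (\<lambda>t. norm (F (t, f t)))"
    by (rule integrable_norm, rule integrable_zero_outside_cball[of _ B R])
       (use B far in \<open>auto intro: borel_measurable_continuous_onI[OF cFf]\<close>)
  have iI: "integrable lborel (\<lambda>t. indicator {-R..R} t * (K * d) :: real)"
    by (intro integrable_mult_left integrable_real_indicator) (auto simp: emeasure_lborel_Icc_eq)
  have "(LINT x|lborel. ?g x) = (LINT t|lborel. (LINT y|lborel. ?g (t, y)))"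
    using lborel_pair.integral_fst'[of ?g] ig by (simp add: lborel_prod)
  also have "\<dots> \<le> (LINT t|lborel. 2 * d * (norm (F (t, f t)) + indicator {-R..R} t * (K * d)))"
  proof (rule integral_mono)
    show "integrable lborel (\<lambda>t. LINT y|lborel. ?g (t, y))"
      using lborel_pair.integrable_fst'[of ?g] ig by (simp add: lborel_prod)
    show "integrable lborel (\<lambda>t. 2 * d * (norm (F (t, f t)) + indicator {-R..R} t * (K * d)))"
      by (intro integrable_mult_right Bochner_Integration.integrable_add iFf iI)
    fix t
    show "(LINT y|lborel. ?g (t, y)) \<le> 2 * d * (norm (F (t, f t)) + indicator {-R..R} t * (K * d))"
    proof (cases "\<bar>t\<bar> \<le> R")
      case False
      then have "t \<notin> {-R..R}" "\<And>y. F (t, y) = 0" using far[of t] by auto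
      then show ?thesis by simp
    next
      case True
      let ?c = "norm (F (t, f t)) + K * d"
      have "?g (t, y) \<le> indicator {f t - d..f t + d} y * ?c" for y
      proof (cases "\<bar>y - f t\<bar> \<le> d")
        case True
        have "norm (F ((t, f t) + (y - f t) *\<^sub>R (0,1)) - F (t, f t)) \<le> K * \<bar>y - f t\<bar>"
          by (rule C1_on_difference_le[OF F K(2)])
        also have "\<dots> \<le> K * d" using True K(1) by (intro mult_left_mono) auto
        finally have "norm (F (t, y)) \<le> ?c"
          using norm_triangle_sub[of "F (t, y)" "F (t, f t)"] by simp
        with True show ?thesis by (auto simp: indicator_def abs_le_iff)
      qed (auto simp: indicator_def abs_le_iff)
      then have "(LINT y|lborel. ?g (t, y)) \<le> (LINT y|lborel. indicator {f t - d..f t + d} y * ?c)"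
        by (intro Bochner_Integration.integral_mono' integrable_mult_left integrable_real_indicator) (auto simp: K(1) d emeasure_lborel_Icc_eq)
      also have "\<dots> = 2 * d * ?c" using d by simp
      finally show ?thesis using True by (simp add: indicator_def abs_le_iff)
    qed
  qed
  also have "\<dots> = 2 * d * ((LINT t|lborel. norm (F (t, f t))) + 2 * R * K * d)"
    using iFf iI R(2) by (simp add: Bochner_Integration.integral_add)
  finally show ?thesis by (simp add: set_lebesgue_integral_def)
qed

text \<open>The integral of a difference quotient of \<open>F\<close> over the domain is, up to signs,
  the integral of \<open>F / h\<close>, \<open>h\<close> being the increment, over the symmetric
  difference of the domain and its translate. For a Lipschitz graph this set lies in a strip about the
  graph whose width is proportional to \<open>h\<close>. So the estimate replaces the divergence theorem
  by translation invariance and Fubini's theorem.\<close>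

lemma norm_integral_partial_graph_le:
  fixes F :: "real \<times> real \<Rightarrow> complex"
  assumes F: "C1_on UNIV F" and R: "\<And>x. F x \<noteq> 0 \<Longrightarrow> norm x \<le> R"
    and f: "M-lipschitz_on UNIV f" and e: "e \<in> Basis"
  shows "norm (LINT x:{x. f (fst x) < snd x}|lborel. partial e F x)
    \<le> 2 * (M + 1) * (LINT t|lborel. norm (F (t, f t)))"
proof -
  define S where "S = {x. f (fst x) < snd x}"
  define I where "I = (LINT t|lborel. norm (F (t, f t)))"
  have M: "M \<ge> 0" using f by (rule lipschitz_on_nonneg)
  have R': "F x \<noteq> 0 \<Longrightarrow> norm x \<le> max 0 R" for x using R[of x] by simp
  have cf: "continuous_on UNIV f" by (rule lipschitz_UNIV_continuous[OF f])
  note [measurable] = borel_measurable_plane_coordinates[OF cf]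
  have cF: "continuous_on UNIV F" by (rule C1_on_continuous_on[OF F])
  have mF [measurable]: "F \<in> borel_measurable borel" by (rule borel_measurable_continuous_onI[OF cF])
  have S [measurable]: "S \<in> sets borel" unfolding S_def by measurable
  obtain B where B: "\<And>x. norm (F x) \<le> B"
    using continuous_on_zero_outside_cball_bounded[OF cF] R by (metis not_le)
  obtain K where K: "K \<ge> 0" "\<And>x. norm (partial (0,1) F x) \<le> K"
    using continuous_on_zero_outside_cball_bounded[OF C1_on_partial_continuous[OF F, of "(0,1)"]]
      partial_zero_outside_cball[OF R] by (metis Basis_plane insert_iff)
  have iA: "integrable lborel (\<lambda>x. indicator A x *\<^sub>R F x)" if "A \<in> sets borel" for A
  proof (rule integrable_zero_outside_cball[of _ B R])
    show "(\<lambda>x. indicator A x *\<^sub>R F x) \<in> borel_measurable borel" using that by measurable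
    show "norm (indicator A x *\<^sub>R F x) \<le> B" for x
      using B[of x] order_trans[OF norm_ge_zero B] by (simp add: indicator_def)
    show "indicator A x *\<^sub>R F x = 0" if "norm x > R" for x using that R[of x] by auto
  qed
  have "norm (LINT x:S|lborel. (F (x + (1 / real (Suc n)) *\<^sub>R e) - F x) * of_nat (Suc n))
      \<le> 2 * (M + 1) * (I + 2 * max 0 R * K * (M + 1) * (1 / real (Suc n)))" for n
  proof -
    define h where "h = 1 / real (Suc n)"
    have h: "h > 0" by (simp add: h_def)
    define d where "d = (M + 1) * h"
    have d: "d \<ge> 0" using M h by (simp add: d_def)
    define T where "T = (\<lambda>x. x - h *\<^sub>R e) -` S"
    have T: "T \<in> sets borel"
      unfolding T_def using measurable_sets_borel[OF _ S, of "\<lambda>x. x - h *\<^sub>R e"] by simp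
    \<comment> \<open>Moving the increment from \<open>F\<close> to the domain replaces \<open>S\<close> by its translate \<open>T\<close>.\<close>
    have "(LINT x:S|lborel. F (x + h *\<^sub>R e)) = (LINT x|lborel. indicator T (x + h *\<^sub>R e) *\<^sub>R F (x + h *\<^sub>R e))"
      by (simp add: set_lebesgue_integral_def T_def indicator_def)
    also have "\<dots> = (LINT x:T|lborel. F x)"
      unfolding set_lebesgue_integral_def
      using lborel_integral_translate[of "\<lambda>x. indicator T x *\<^sub>R F x" "h *\<^sub>R e"] T by simp
    finally have 1: "(LINT x:S|lborel. F (x + h *\<^sub>R e)) = (LINT x:T|lborel. F x)" .
    have iSh: "integrable lborel (\<lambda>x. indicator S x *\<^sub>R F (x + h *\<^sub>R e))"
    proof (rule integrable_zero_outside_cball[of _ B "R + h"])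
      show "norm (indicator S x *\<^sub>R F (x + h *\<^sub>R e)) \<le> B" for x
        using B[of "x + h *\<^sub>R e"] order_trans[OF norm_ge_zero B] by (simp add: indicator_def)
      show "indicator S x *\<^sub>R F (x + h *\<^sub>R e) = 0" if "norm x > R + h" for x
        using that R[of "x + h *\<^sub>R e"] norm_triangle_ineq4[of "x + h *\<^sub>R e" "h *\<^sub>R e"] h e by auto
    qed measurable
    have "(LINT x:S|lborel. F (x + h *\<^sub>R e) - F x) = (LINT x:T|lborel. F x) - (LINT x:S|lborel. F x)"
      unfolding 1[symmetric] by (rule set_integral_diff(2)) (use iSh iA[OF S] in \<open>auto simp: set_integrable_def\<close>)
    also have "\<dots> = (LINT x|lborel. indicator T x *\<^sub>R F x - indicator S x *\<^sub>R F x)"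
      unfolding set_lebesgue_integral_def by (rule Bochner_Integration.integral_diff[symmetric]) (intro iA S T)+
    also have "norm \<dots> \<le> (LINT x|lborel. norm (indicator T x *\<^sub>R F x - indicator S x *\<^sub>R F x))"
      by (rule integral_norm_bound)
    also have "\<dots> \<le> (LINT x|lborel. indicator {x. \<bar>snd x - f (fst x)\<bar> \<le> d} x *\<^sub>R norm (F x))"
    proof (rule integral_mono)
      show "integrable lborel (\<lambda>x. norm (indicator T x *\<^sub>R F x - indicator S x *\<^sub>R F x))"
        by (intro integrable_norm Bochner_Integration.integrable_diff iA S T)
      have "integrable lborel (\<lambda>x. norm (indicator {x. \<bar>snd x - f (fst x)\<bar> \<le> d} x *\<^sub>R F x))"
        by (intro integrable_norm iA) measurable
      then show "integrable lborel (\<lambda>x. indicator {x. \<bar>snd x - f (fst x)\<bar> \<le> d} x *\<^sub>R norm (F x))"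
        by simp
      fix x :: "real \<times> real"
      \<comment> \<open>\<open>M h\<close> bounds the change of \<open>f\<close> for a horizontal step, \<open>h\<close> is the length of a vertical one.\<close>
      have "\<bar>snd x - f (fst x)\<bar> \<le> d" if "(x \<in> T) \<noteq> (x \<in> S)"
      proof -
        from e consider "e = (1,0)" | "e = (0,1)" by (auto simp: Basis_plane)
        then show ?thesis
        proof cases
          case 1
          have "\<bar>f (fst x - h) - f (fst x)\<bar> \<le> M * h"
            using lipschitz_real_le[OF f, of "fst x - h" "fst x"] h by simp
          then show ?thesis using that h M by (auto simp: T_def S_def 1 d_def algebra_simps)
        next
          case 2
          have "0 \<le> M * h" using M h by simp
          then show ?thesis using that h by (auto simp: T_def S_def 2 d_def algebra_simps)
        qed
      qed
      then show "norm (indicator T x *\<^sub>R F x - indicator S x *\<^sub>R F x)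
          \<le> indicator {x. \<bar>snd x - f (fst x)\<bar> \<le> d} x *\<^sub>R norm (F x)"
        by (auto simp: indicator_def)
    qed
    also have "\<dots> \<le> 2 * d * (I + 2 * max 0 R * K * d)"
      using integral_graph_strip_le[OF F R' _ K cf d] by (simp add: set_lebesgue_integral_def I_def)
    finally have "norm (LINT x:S|lborel. F (x + h *\<^sub>R e) - F x) * real (Suc n)
        \<le> 2 * d * (I + 2 * max 0 R * K * d) * real (Suc n)"
      by (rule mult_right_mono) simp
    also have "\<dots> = 2 * (M + 1) * (I + 2 * max 0 R * K * (M + 1) * h)"
      by (simp add: d_def h_def)
    finally show ?thesis
      by (simp add: norm_mult h_def[symmetric] del: of_nat_Suc)
  qed
  moreover have "(\<lambda>n. 2 * (M + 1) * (I + 2 * max 0 R * K * (M + 1) * (1 / real (Suc n))))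
      \<longlonglongrightarrow> 2 * (M + 1) * (I + 2 * max 0 R * K * (M + 1) * 0)"
    by (intro tendsto_mult tendsto_add tendsto_const LIMSEQ_Suc[OF lim_1_over_n])
  moreover note tendsto_norm[OF integral_difference_quotient_tendsto[OF F R e S]]
  ultimately show ?thesis
    using LIMSEQ_le[of _ "norm (LINT x:S|lborel. partial e F x)" _ "2 * (M + 1) * (I + 2 * max 0 R * K * (M + 1) * 0)"]
    unfolding S_def I_def by auto
qed

section \<open>Arc length on a Lipschitz graph\<close>

definition rational_increments :: "nat \<Rightarrow> real set" where
  "rational_increments n = \<rat> \<inter> {h. h \<noteq> 0 \<and> \<bar>h\<bar> < 1 / real (Suc n)}"

text \<open>Differentiability is a Cauchy condition on the difference quotients for small increments. As
  these are continuous in the increment, rational increments suffice, which makes the condition a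
  countable one.\<close>

lemma differentiable_iff_rational_Cauchy:
  fixes f :: "real \<Rightarrow> real"
  assumes f: "continuous_on UNIV f"
  defines "q \<equiv> \<lambda>t h. (f (t + h) - f t) / h"
  shows "(\<exists>l. (f has_real_derivative l) (at t)) \<longleftrightarrow>
    (\<forall>m. \<exists>n. \<forall>r\<in>rational_increments n. \<forall>s\<in>rational_increments n.
       \<bar>q t r - q t s\<bar> \<le> 1 / real (Suc m))" (is "?L \<longleftrightarrow> ?R")
proof
  assume ?L
  then obtain l where l: "((\<lambda>h. q t h) \<longlongrightarrow> l) (at 0)"
    by (auto simp: DERIV_def q_def)
  show ?R
  proof
    fix m
    have "1 / (2 * real (Suc m)) > 0" by simp
    from LIM_D[OF l this] obtain d where d: "d > 0"
      "\<And>h. h \<noteq> 0 \<Longrightarrow> \<bar>h\<bar> < d \<Longrightarrow> \<bar>q t h - l\<bar> < 1 / (2 * real (Suc m))"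
      by (auto simp del: of_nat_Suc)
    obtain n where n: "1 / real (Suc n) < d" using d(1) by (rule nat_approx_posE) simp
    have "\<bar>q t r - q t s\<bar> \<le> 1 / real (Suc m)"
      if "r \<noteq> 0" "\<bar>r\<bar> < 1 / real (Suc n)" "s \<noteq> 0" "\<bar>s\<bar> < 1 / real (Suc n)" for r s
    proof -
      have "\<bar>q t r - l\<bar> < 1 / (2 * real (Suc m))" "\<bar>q t s - l\<bar> < 1 / (2 * real (Suc m))"
        using that n by (auto intro!: d(2) simp del: of_nat_Suc)
      then have "\<bar>q t r - q t s\<bar> < 2 * (1 / (2 * real (Suc m)))" by linarith
      also have "\<dots> = 1 / real (Suc m)" by (simp del: of_nat_Suc)
      finally show ?thesis by simp
    qed
    then show "\<exists>n. \<forall>r\<in>rational_increments n. \<forall>s\<in>rational_increments n.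
       \<bar>q t r - q t s\<bar> \<le> 1 / real (Suc m)" unfolding rational_increments_def by (intro exI[of _ n]) auto
  qed
next
  assume R: ?R
  have cq: "continuous_on {h. h \<noteq> 0} (q t)"
    unfolding q_def by (intro continuous_intros continuous_on_compose2[OF f]) auto
  have Cauchy: "\<exists>n. \<forall>r s. r \<noteq> 0 \<and> \<bar>r\<bar> < 1 / real (Suc n) \<and> s \<noteq> 0 \<and> \<bar>s\<bar> < 1 / real (Suc n)
      \<longrightarrow> \<bar>q t r - q t s\<bar> \<le> 1 / real (Suc m)" for m
  proof -
    obtain n where n: "\<And>r s. r \<in> \<rat> \<Longrightarrow> r \<noteq> 0 \<Longrightarrow> \<bar>r\<bar> < 1 / real (Suc n) \<Longrightarrow> s \<in> \<rat> \<Longrightarrow> s \<noteq> 0 \<Longrightarrow> \<bar>s\<bar> < 1 / real (Suc n)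
      \<Longrightarrow> \<bar>q t r - q t s\<bar> \<le> 1 / real (Suc m)" using R unfolding rational_increments_def by blast
    define U where "U = {h. h \<noteq> 0 \<and> \<bar>h\<bar> < 1 / real (Suc n)}"
    have U: "open U" unfolding U_def
      by (intro open_Collect_conj open_Collect_neq open_Collect_less continuous_intros)
    have cU: "continuous_on U (q t)" by (rule continuous_on_subset[OF cq]) (auto simp: U_def)
    have approx: "\<exists>x. (\<forall>k. x k \<in> \<rat> \<inter> U) \<and> x \<longlonglongrightarrow> h" if "h \<in> U" for h
    proof -
      have "U \<subseteq> closure (U \<inter> \<rat>)"
        using open_Int_closure_subset[OF U, of \<rat>] by (simp add: Rats_closure_real)
      then have "h \<in> closure (\<rat> \<inter> U)" using that by (auto simp: Int_commute)
      then show ?thesis unfolding closure_sequential by simp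
    qed
    have "\<bar>q t r - q t s\<bar> \<le> 1 / real (Suc m)" if r: "r \<in> U" and s: "s \<in> U" for r s
    proof -
      obtain x where x: "\<And>k. x k \<in> \<rat> \<inter> U" "x \<longlonglongrightarrow> r" using approx[OF r] by auto
      obtain y where y: "\<And>k. y k \<in> \<rat> \<inter> U" "y \<longlonglongrightarrow> s" using approx[OF s] by auto
      have "(\<lambda>k. q t (x k)) \<longlonglongrightarrow> q t r"
        by (rule continuous_on_tendsto_compose[OF cU x(2) r]) (use x in auto)
      moreover have "(\<lambda>k. q t (y k)) \<longlonglongrightarrow> q t s"
        by (rule continuous_on_tendsto_compose[OF cU y(2) s]) (use y in auto)
      ultimately have "(\<lambda>k. \<bar>q t (x k) - q t (y k)\<bar>) \<longlonglongrightarrow> \<bar>q t r - q t s\<bar>"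
        by (intro tendsto_intros)
      then show ?thesis
        by (rule LIMSEQ_le_const2) (use n x(1) y(1) in \<open>auto simp: U_def\<close>)
    qed
    then show ?thesis unfolding U_def by blast
  qed
  define z where "z = (\<lambda>k. q t (1 / real (Suc (Suc k))))"
  have small: "1 / real (Suc (Suc k)) < 1 / real (Suc n)" if "k \<ge> n" for k n
    using that by (intro divide_strict_left_mono) auto
  have "Cauchy z"
  proof (rule CauchyI)
    fix e :: real assume "e > 0"
    then obtain m where m: "1 / real (Suc m) < e" by (rule nat_approx_posE)
    obtain n where n: "\<And>r s. r \<noteq> 0 \<Longrightarrow> \<bar>r\<bar> < 1 / real (Suc n) \<Longrightarrow> s \<noteq> 0 \<Longrightarrow> \<bar>s\<bar> < 1 / real (Suc n)
      \<Longrightarrow> \<bar>q t r - q t s\<bar> \<le> 1 / real (Suc m)" using Cauchy[of m] by blast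
    have "norm (z j - z k) < e" if "j \<ge> n" "k \<ge> n" for j k
      using n[of "1 / real (Suc (Suc j))" "1 / real (Suc (Suc k))"] small[OF that(1)] small[OF that(2)] m
      by (simp add: z_def del: of_nat_Suc)
    then show "\<exists>M. \<forall>m\<ge>M. \<forall>n\<ge>M. norm (z m - z n) < e" by blast
  qed
  then obtain l where l: "z \<longlonglongrightarrow> l" using Cauchy_convergent_iff convergent_def by blast
  have "((\<lambda>h. q t h) \<longlongrightarrow> l) (at 0)"
  proof (rule LIM_I)
    fix e :: real assume "e > 0"
    then obtain m where m: "1 / real (Suc m) < e" by (rule nat_approx_posE)
    obtain n where n: "\<And>r s. r \<noteq> 0 \<Longrightarrow> \<bar>r\<bar> < 1 / real (Suc n) \<Longrightarrow> s \<noteq> 0 \<Longrightarrow> \<bar>s\<bar> < 1 / real (Suc n)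
      \<Longrightarrow> \<bar>q t r - q t s\<bar> \<le> 1 / real (Suc m)" using Cauchy[of m] by blast
    have "\<bar>q t h - l\<bar> < e" if h: "h \<noteq> 0" "\<bar>h\<bar> < 1 / real (Suc n)" for h
    proof -
      have "(\<lambda>k. \<bar>q t h - z k\<bar>) \<longlonglongrightarrow> \<bar>q t h - l\<bar>" by (intro tendsto_intros l)
      moreover have "\<bar>q t h - z k\<bar> \<le> 1 / real (Suc m)" if "k \<ge> n" for k
        using n[OF h, of "1 / real (Suc (Suc k))"] small[OF that] by (simp add: z_def del: of_nat_Suc)
      ultimately have "\<bar>q t h - l\<bar> \<le> 1 / real (Suc m)" by (intro LIMSEQ_le_const2) auto
      with m show ?thesis by simp
    qed
    then show "\<exists>s>0. \<forall>x. x \<noteq> 0 \<and> norm (x - 0) < s \<longrightarrow> norm (q t x - l) < e"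
      by (intro exI[of _ "1 / real (Suc n)"]) auto
  qed
  then show ?L by (auto simp: DERIV_def q_def)
qed

text \<open>The density of arc length involves \<open>f'\<close>, and integrals against it can be
  computed only if it is measurable. The derivative is a limit of difference quotients on the Borel set
  where \<open>f\<close> is differentiable, and \<^const>\<open>deriv\<close> takes one and the same
  default value elsewhere.\<close>

lemma borel_measurable_deriv_continuous:
  fixes f :: "real \<Rightarrow> real"
  assumes f: "continuous_on UNIV f"
  shows "deriv f \<in> borel_measurable borel"
proof -
  have fb [measurable]: "f \<in> borel_measurable borel" by (rule borel_measurable_continuous_onI[OF f])
  define q where "q = (\<lambda>t h. (f (t + h) - f t) / h)"
  have q [measurable]: "(\<lambda>t. q t h) \<in> borel_measurable borel" for h unfolding q_def by measurable
  define D where "D = {t. \<exists>l. (f has_real_derivative l) (at t)}"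
  have cQ: "countable (rational_increments n)" for n unfolding rational_increments_def using countable_rat by (rule countable_Int1)
  have "D = {t. \<forall>m. \<exists>n. \<forall>r\<in>rational_increments n. \<forall>s\<in>rational_increments n. \<bar>q t r - q t s\<bar> \<le> 1 / real (Suc m)}"
    unfolding D_def q_def by (subst differentiable_iff_rational_Cauchy[OF f]) (rule refl)
  also have "\<dots> = (\<Inter>m. \<Union>n. \<Inter>r\<in>rational_increments n. \<Inter>s\<in>rational_increments n. {t. \<bar>q t r - q t s\<bar> \<le> 1 / real (Suc m)})"
    by auto
  also have "\<dots> \<in> sets borel"
  proof -
    have "{t. \<bar>q t r - q t s\<bar> \<le> 1 / real (Suc m)} \<in> sets borel" for m r s by measurable
    then have "(\<Inter>s\<in>rational_increments n. {t. \<bar>q t r - q t s\<bar> \<le> 1 / real (Suc m)}) \<in> sets borel" for m n r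
      by (intro sets.countable_INT''[OF _ cQ]) auto
    then have "(\<Inter>r\<in>rational_increments n. \<Inter>s\<in>rational_increments n. {t. \<bar>q t r - q t s\<bar> \<le> 1 / real (Suc m)}) \<in> sets borel" for m n
      by (intro sets.countable_INT''[OF _ cQ]) auto
    then show ?thesis by (intro sets.countable_INT'' sets.countable_UN' countableI_type) auto
  qed
  finally have D: "D \<in> sets borel" .
  \<comment> \<open>the value of \<^const>\<open>deriv\<close> at points where \<open>f\<close> is not differentiable\<close>
  define c where "c = (SOME D::real. False)"
  have "(\<lambda>n. indicator D t * q t (1 / real (Suc n)) + indicator (- D) t * c) \<longlonglongrightarrow> deriv f t" for t
  proof (cases "t \<in> D")
    case True
    then have "(f has_real_derivative deriv f t) (at t)"
      unfolding D_def by (auto dest: DERIV_imp_deriv)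
    then have "((\<lambda>h. q t h) \<longlongrightarrow> deriv f t) (at 0)" by (simp add: DERIV_def q_def)
    moreover have "filterlim (\<lambda>n. 1 / real (Suc n)) (at 0) sequentially"
      using LIMSEQ_Suc[OF lim_1_over_n[where 'a = real]] by (auto simp: filterlim_at)
    ultimately have "(\<lambda>n. q t (1 / real (Suc n))) \<longlonglongrightarrow> deriv f t" by (rule filterlim_compose)
    with True show ?thesis by simp
  next
    case False
    then have "deriv f t = c" by (simp add: deriv_def c_def D_def)
    with False show ?thesis by simp
  qed
  then show ?thesis
    by (rule borel_measurable_LIMSEQ_metric[rotated]) (use D in measurable)
qed

lemma deriv_lipschitz_bounded:
  fixes f :: "real \<Rightarrow> real"
  assumes f: "M-lipschitz_on UNIV f"
  obtains K where "\<And>t. \<bar>deriv f t\<bar> \<le> K"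
proof -
  \<comment> \<open>the value of \<^const>\<open>deriv\<close> at points where \<open>f\<close> is not differentiable\<close>
  define c where "c = (SOME D::real. False)"
  have "\<bar>deriv f t\<bar> \<le> max M \<bar>c\<bar>" for t
  proof (cases "\<exists>l. (f has_real_derivative l) (at t)")
    case True
    then have "(f has_real_derivative deriv f t) (at t)" by (auto dest: DERIV_imp_deriv)
    then have "((\<lambda>h. (f (t + h) - f t) / h) \<longlongrightarrow> deriv f t) (at 0)" by (simp add: DERIV_def)
    then have "((\<lambda>h. \<bar>(f (t + h) - f t) / h\<bar>) \<longlongrightarrow> \<bar>deriv f t\<bar>) (at 0)" by (intro tendsto_intros)
    moreover have "eventually (\<lambda>h. \<bar>(f (t + h) - f t) / h\<bar> \<le> M) (at 0)"
    proof (intro eventually_at_filter[THEN iffD2] always_eventually allI impI)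
      fix h :: real assume "h \<noteq> 0"
      then show "\<bar>(f (t + h) - f t) / h\<bar> \<le> M"
        using lipschitz_real_le[OF f, of "t + h" t] by (simp add: abs_divide pos_divide_le_eq)
    qed
    ultimately have "\<bar>deriv f t\<bar> \<le> M" by (intro tendsto_upperbound) auto
    then show ?thesis by simp
  next
    case False
    then show ?thesis by (simp add: deriv_def c_def)
  qed
  then show ?thesis by (rule that)
qed

definition speed :: "(real \<Rightarrow> real) \<Rightarrow> real \<Rightarrow> real" where
  "speed f t = sqrt (1 + (deriv f t)\<^sup>2)"

lemma speed_ge_1: "speed f t \<ge> 1"
  by (simp add: speed_def)

lemma arclength_eq: "arclength f = distr (density lborel (\<lambda>t. ennreal (speed f t))) borel (\<lambda>t. (t, f t))"
  by (simp add: arclength_def speed_def)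

lemma sets_arclength [simp, measurable_cong]: "sets (arclength f) = sets borel"
  and space_arclength [simp]: "space (arclength f) = UNIV"
  by (simp_all add: arclength_def)

lemma borel_measurable_speed:
  "continuous_on UNIV f \<Longrightarrow> speed f \<in> borel_measurable borel"
  unfolding speed_def[abs_def] using borel_measurable_deriv_continuous by measurable

lemma borel_measurable_graph_map:
  fixes f :: "real \<Rightarrow> real"
  shows "continuous_on UNIV f \<Longrightarrow> (\<lambda>t. (t, f t)) \<in> borel_measurable borel"
  by (intro borel_measurable_continuous_onI continuous_on_Pair continuous_on_id)

lemma integral_arclength:
  fixes F :: "real \<times> real \<Rightarrow> 'b::{banach, second_countable_topology}"
  assumes f: "continuous_on UNIV f" and F: "F \<in> borel_measurable borel"
  shows "(LINT x|arclength f. F x) = (LINT t|lborel. speed f t *\<^sub>R F (t, f t))"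
proof -
  note [measurable] = borel_measurable_graph_map[OF f] F borel_measurable_speed[OF f]
  have "(LINT x|arclength f. F x) = (LINT t|density lborel (\<lambda>t. ennreal (speed f t)). F (t, f t))"
    unfolding arclength_eq by (subst integral_distr) auto
  also have "\<dots> = (LINT t|lborel. speed f t *\<^sub>R F (t, f t))"
    using order_trans[OF zero_le_one speed_ge_1] by (subst integral_density) auto
  finally show ?thesis .
qed

lemma integrable_arclength:
  fixes F :: "real \<times> real \<Rightarrow> 'b::{banach, second_countable_topology}"
  assumes f: "continuous_on UNIV f" and F: "F \<in> borel_measurable borel"
  shows "integrable (arclength f) F \<longleftrightarrow> integrable lborel (\<lambda>t. speed f t *\<^sub>R F (t, f t))"
proof -
  note [measurable] = borel_measurable_graph_map[OF f] F borel_measurable_speed[OF f]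
  have "integrable (arclength f) F \<longleftrightarrow> integrable (density lborel (\<lambda>t. ennreal (speed f t))) (\<lambda>t. F (t, f t))"
    unfolding arclength_eq by (subst integrable_distr_eq) auto
  also have "\<dots> \<longleftrightarrow> integrable lborel (\<lambda>t. speed f t *\<^sub>R F (t, f t))"
    using order_trans[OF zero_le_one speed_ge_1] by (subst integrable_density) auto
  finally show ?thesis .
qed

lemma AE_arclength:
  fixes f :: "real \<Rightarrow> real"
  assumes f: "continuous_on UNIV f" and P: "{x. P x} \<in> sets borel"
  shows "(AE x in arclength f. P x) \<longleftrightarrow> (AE t in lborel. P (t, f t))"
proof -
  note [measurable] = borel_measurable_graph_map[OF f] borel_measurable_speed[OF f]
  have "(AE x in arclength f. P x) \<longleftrightarrow> (AE t in density lborel (\<lambda>t. ennreal (speed f t)). P (t, f t))"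
    unfolding arclength_eq using P by (subst AE_distr_iff) auto
  also have "\<dots> \<longleftrightarrow> (AE t in lborel. P (t, f t))"
    using less_le_trans[OF zero_less_one speed_ge_1] by (subst AE_density) auto
  finally show ?thesis .
qed

lemma emeasure_arclength_strip_finite:
  assumes f: "M-lipschitz_on UNIV f"
  shows "emeasure (arclength f) {x. a \<le> fst x \<and> fst x \<le> b} < \<infinity>"
proof -
  have cf: "continuous_on UNIV f" by (rule lipschitz_UNIV_continuous[OF f])
  note [measurable] = borel_measurable_graph_map[OF cf] borel_measurable_speed[OF cf]
  obtain K where K: "\<And>t. \<bar>deriv f t\<bar> \<le> K" using deriv_lipschitz_bounded[OF f] by blast
  have sp: "speed f t \<le> sqrt (1 + K\<^sup>2)" for t
    unfolding speed_def using power_mono[OF K[of t] abs_ge_zero, of 2] by simp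
  have S: "{x::real \<times> real. a \<le> fst x \<and> fst x \<le> b} \<in> sets borel"
    by (intro borel_closed closed_Collect_conj closed_Collect_le continuous_intros)
  have "emeasure (arclength f) {x. a \<le> fst x \<and> fst x \<le> b}
      = emeasure (density lborel (\<lambda>t. ennreal (speed f t))) {a..b}"
    unfolding arclength_eq using S by (subst emeasure_distr) (auto simp: vimage_def atLeastAtMost_def atLeast_def atMost_def Collect_conj_eq)
  also have "\<dots> = (\<integral>\<^sup>+t. ennreal (speed f t) * indicator {a..b} t \<partial>lborel)"
    by (subst emeasure_density) auto
  also have "\<dots> \<le> (\<integral>\<^sup>+t. ennreal (sqrt (1 + K\<^sup>2)) * indicator {a..b} t \<partial>lborel)"
    by (intro nn_integral_mono mult_right_mono ennreal_leI sp) auto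
  also have "\<dots> < \<infinity>"
    by (subst nn_integral_cmult_indicator) (auto simp: emeasure_lborel_Icc_eq ennreal_mult_less_top)
  finally show ?thesis .
qed

section \<open>Square-integrable functions\<close>

lemma L2_measurable: "a \<in> L2 M \<Longrightarrow> a \<in> borel_measurable M"
  by (simp add: L2_def)

lemma L2_integrable_square: "a \<in> L2 M \<Longrightarrow> integrable M (\<lambda>x. (norm (a x))\<^sup>2)"
  by (simp add: L2_def)

lemma L2_integrable_norm_mult:
  assumes "a \<in> L2 M" "b \<in> L2 M"
  shows "integrable M (\<lambda>x. norm (a x) * norm (b x))"
proof (rule Bochner_Integration.integrable_bound)
  show "integrable M (\<lambda>x. (norm (a x))\<^sup>2 + (norm (b x))\<^sup>2)"
    using assms by (intro Bochner_Integration.integrable_add L2_integrable_square)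
  show "(\<lambda>x. norm (a x) * norm (b x)) \<in> borel_measurable M"
    using assms[THEN L2_measurable] by measurable
  have "p * q \<le> p\<^sup>2 + q\<^sup>2" if "p \<ge> 0" "q \<ge> 0" for p q :: real
    using sum_squares_bound[of p q] mult_nonneg_nonneg[OF that] by simp
  then show "AE x in M. norm (norm (a x) * norm (b x)) \<le> norm ((norm (a x))\<^sup>2 + (norm (b x))\<^sup>2)"
    by (intro AE_I2) (simp add: abs_mult)
qed

lemma L2_integrable_mult:
  assumes "a \<in> L2 M" "b \<in> L2 M"
  shows "integrable M (\<lambda>x. a x * b x)"
  by (rule Bochner_Integration.integrable_bound[OF L2_integrable_norm_mult[OF assms]])
     (use assms[THEN L2_measurable] in \<open>auto simp: norm_mult\<close>)

lemma L2_cnj: "a \<in> L2 M \<Longrightarrow> (\<lambda>x. cnj (a x)) \<in> L2 M"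
  by (auto simp: L2_def intro: borel_measurable_continuous_on[OF continuous_on_cnj[OF continuous_on_id]])

lemma L2_mult_const: "a \<in> L2 M \<Longrightarrow> (\<lambda>x. c * a x) \<in> L2 M"
  by (auto simp: L2_def norm_mult power_mult_distrib)

lemma L2_add:
  assumes "a \<in> L2 M" "b \<in> L2 M"
  shows "(\<lambda>x. a x + b x) \<in> L2 M"
  unfolding L2_def
proof (intro CollectI conjI)
  note [measurable] = assms[THEN L2_measurable]
  show "(\<lambda>x. a x + b x) \<in> borel_measurable M" by measurable
  show "integrable M (\<lambda>x. (norm (a x + b x))\<^sup>2)"
  proof (rule Bochner_Integration.integrable_bound)
    show "integrable M (\<lambda>x. 2 * (norm (a x))\<^sup>2 + 2 * (norm (b x))\<^sup>2)"
      using assms by (intro Bochner_Integration.integrable_add integrable_mult_right L2_integrable_square)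
    have "(norm (p + q))\<^sup>2 \<le> 2 * (norm p)\<^sup>2 + 2 * (norm q)\<^sup>2" for p q :: complex
    proof -
      have "(norm (p + q))\<^sup>2 \<le> (norm p + norm q)\<^sup>2" by (intro power_mono norm_triangle_ineq) simp
      also have "\<dots> \<le> 2 * (norm p)\<^sup>2 + 2 * (norm q)\<^sup>2"
        using sum_squares_bound[of "norm p" "norm q"] by (simp add: power2_sum)
      finally show ?thesis .
    qed
    then show "AE x in M. norm ((norm (a x + b x))\<^sup>2) \<le> norm (2 * (norm (a x))\<^sup>2 + 2 * (norm (b x))\<^sup>2)"
      by (intro AE_I2) simp
  qed measurable
qed

lemma L2_diff:
  assumes "a \<in> L2 M" "b \<in> L2 M"
  shows "(\<lambda>x. a x - b x) \<in> L2 M"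
  using L2_add[OF assms(1) L2_mult_const[OF assms(2), of "-1"]] by simp

lemma L2_zero: "(\<lambda>_. 0) \<in> L2 M"
  by (simp add: L2_def)

lemma L2_sum:
  "(\<And>i. i \<in> I \<Longrightarrow> a i \<in> L2 M) \<Longrightarrow> (\<lambda>x. \<Sum>i\<in>I. a i x) \<in> L2 M"
  by (induction I rule: infinite_finite_induct) (simp_all add: L2_zero L2_add)

lemma L2_bounded:
  assumes "b \<in> borel_measurable M" "\<And>x. x \<in> space M \<Longrightarrow> norm (b x) \<le> K" "emeasure M (space M) < \<infinity>"
  shows "b \<in> L2 M"
proof -
  have "integrable M (\<lambda>x. (norm (b x))\<^sup>2)"
    using assms by (intro integrableI_bounded_set[where A = "space M" and B = "K\<^sup>2"])
      (auto intro!: AE_I2 power_mono)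
  with assms show ?thesis by (simp add: L2_def)
qed

lemma Cauchy_Schwarz_L2:
  assumes "a \<in> L2 M" "b \<in> L2 M"
  shows "(LINT x|M. norm (a x) * norm (b x)) \<le> L2_norm M a * L2_norm M b"
proof -
  note [measurable] = assms[THEN L2_measurable]
  let ?I = "LINT x|M. norm (a x) * norm (b x)"
  have sq: "(\<integral>\<^sup>+x. ennreal (norm (c x))^2 \<partial>M) = ennreal (LINT x|M. (norm (c x))\<^sup>2)" if "c \<in> L2 M" for c
    using L2_integrable_square[OF that] by (subst nn_integral_eq_integral[symmetric]) (auto simp: ennreal_power)
  have "(\<integral>\<^sup>+x. ennreal (norm (a x)) * ennreal (norm (b x)) \<partial>M) = ennreal ?I"
    using L2_integrable_norm_mult[OF assms]
    by (subst nn_integral_eq_integral[symmetric]) (auto simp: ennreal_mult)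
  then have "(ennreal ?I)^2 \<le> (\<integral>\<^sup>+x. ennreal (norm (a x))^2 \<partial>M) * (\<integral>\<^sup>+x. ennreal (norm (b x))^2 \<partial>M)"
    using Cauchy_Schwarz_nn_integral[of "\<lambda>x. ennreal (norm (a x))" M "\<lambda>x. ennreal (norm (b x))"] by simp
  also have "\<dots> = ennreal ((LINT x|M. (norm (a x))\<^sup>2) * (LINT x|M. (norm (b x))\<^sup>2))"
    by (simp add: sq assms ennreal_mult)
  finally have "?I\<^sup>2 \<le> (LINT x|M. (norm (a x))\<^sup>2) * (LINT x|M. (norm (b x))\<^sup>2)"
    by (simp add: ennreal_power)
  then have "sqrt (?I\<^sup>2) \<le> sqrt ((LINT x|M. (norm (a x))\<^sup>2) * (LINT x|M. (norm (b x))\<^sup>2))"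
    by (rule real_sqrt_le_mono)
  then show ?thesis by (simp add: L2_norm_def real_sqrt_mult)
qed

lemma L2_pairing_tendsto_0:
  assumes a: "\<And>n. a n \<in> L2 M" and b: "b \<in> L2 M" and lim: "(\<lambda>n. L2_norm M (a n)) \<longlonglongrightarrow> 0"
  shows "(\<lambda>n. LINT x|M. norm (a n x) * norm (b x)) \<longlonglongrightarrow> 0"
proof (rule real_tendsto_sandwich)
  show "\<forall>\<^sub>F n in sequentially. 0 \<le> (LINT x|M. norm (a n x) * norm (b x))"
    by (intro always_eventually allI Bochner_Integration.integral_nonneg) simp
  show "\<forall>\<^sub>F n in sequentially. (LINT x|M. norm (a n x) * norm (b x)) \<le> L2_norm M (a n) * L2_norm M b"
    by (intro always_eventually allI Cauchy_Schwarz_L2 a b)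
  show "(\<lambda>n. L2_norm M (a n) * L2_norm M b) \<longlonglongrightarrow> 0"
    by (intro tendsto_mult_left_zero lim)
qed simp

text \<open>Covers both bounded parts of the domain, with Lebesgue measure, and bounded parts of the
  boundary, with arc length.\<close>

lemma continuous_L2_restrict_bounded:
  fixes h :: "'a::euclidean_space \<Rightarrow> complex"
  assumes M: "sets M = sets borel" and B: "B \<in> sets borel" "bounded B" and fin: "emeasure M B < \<infinity>"
    and h: "continuous_on UNIV h"
  shows "h \<in> L2 (restrict_space M B)"
proof -
  have sp: "space M = UNIV" using sets_eq_imp_space_eq[OF M] by simp
  obtain r where "\<And>x. x \<in> B \<Longrightarrow> norm x \<le> r" using B(2) unfolding bounded_iff by blast
  then have r: "B \<subseteq> cball 0 r" by auto
  have "bounded (h ` cball 0 r)"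
    using h by (intro compact_imp_bounded compact_continuous_image) (auto intro: continuous_on_subset)
  then obtain K where K: "\<And>x. x \<in> cball 0 r \<Longrightarrow> norm (h x) \<le> K" unfolding bounded_iff by blast
  have "h \<in> borel_measurable (restrict_space M B)"
    using borel_measurable_continuous_onI[OF h]
    by (intro measurable_restrict_space1) (simp add: measurable_cong_sets[OF M refl])
  moreover have "norm (h x) \<le> K" if "x \<in> space (restrict_space M B)" for x
    using that r K by (auto simp: space_restrict_space)
  moreover have "emeasure (restrict_space M B) (space (restrict_space M B)) < \<infinity>"
    using fin B M sp by (subst emeasure_restrict_space) (auto simp: space_restrict_space)
  ultimately show ?thesis by (rule L2_bounded)
qed

lemma continuous_L2_leb_on_ball:
  assumes S: "open S" and \<phi>: "continuous_on UNIV \<phi>"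
  shows "\<phi> \<in> L2 (leb_on (S \<inter> ball (0::'a::euclidean_space) r))"
proof -
  have "bounded (S \<inter> ball 0 r)" by (simp add: bounded_Int)
  with S show ?thesis
    by (intro continuous_L2_restrict_bounded \<phi> emeasure_bounded_finite) auto
qed

lemma continuous_L2_arclength:
  fixes f :: "real \<Rightarrow> real"
  assumes f: "M-lipschitz_on UNIV f" and B: "B \<in> sets borel" "bounded B" and h: "continuous_on UNIV h"
  shows "h \<in> L2 (restrict_space (arclength f) B)"
proof (rule continuous_L2_restrict_bounded[OF sets_arclength B _ h])
  obtain r where r: "\<And>x. x \<in> B \<Longrightarrow> norm x \<le> r" using B(2) unfolding bounded_iff by blast
  have "B \<subseteq> {x. - r \<le> fst x \<and> fst x \<le> r}"
  proof
    fix x assume "x \<in> B"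
    then have "\<bar>fst x\<bar> \<le> r" using norm_fst_le[of "fst x" "snd x"] r[of x] by simp
    then show "x \<in> {x. - r \<le> fst x \<and> fst x \<le> r}" by auto
  qed
  then have "emeasure (arclength f) B \<le> emeasure (arclength f) {x. - r \<le> fst x \<and> fst x \<le> r}"
    by (intro emeasure_mono) (auto intro!: borel_closed closed_Collect_conj closed_Collect_le continuous_intros)
  also have "\<dots> < \<infinity>" by (rule emeasure_arclength_strip_finite[OF f])
  finally show "emeasure (arclength f) B < \<infinity>" .
qed

lemma set_integral_eq_leb_on_ball:
  fixes F :: "'a::euclidean_space \<Rightarrow> 'b::{banach, second_countable_topology}"
  assumes S: "open S" and F: "\<And>x. x \<in> S \<Longrightarrow> norm x \<ge> r \<Longrightarrow> F x = 0"
  shows "(LINT x:S|lborel. F x) = (LINT x|leb_on (S \<inter> ball 0 r). F x)"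
    and "set_integrable lborel S F \<longleftrightarrow> integrable (leb_on (S \<inter> ball 0 r)) F"
proof -
  have "(\<lambda>x. indicator S x *\<^sub>R F x) = (\<lambda>x. indicator (S \<inter> ball 0 r) x *\<^sub>R F x)"
    using F by (auto simp: indicator_def fun_eq_iff)
  with S show "(LINT x:S|lborel. F x) = (LINT x|leb_on (S \<inter> ball 0 r). F x)"
    "set_integrable lborel S F \<longleftrightarrow> integrable (leb_on (S \<inter> ball 0 r)) F"
    by (simp_all add: set_lebesgue_integral_def set_integrable_def integral_restrict_space integrable_restrict_space)
qed

definition L2_loc :: "'a::euclidean_space set \<Rightarrow> ('a \<Rightarrow> complex) set" where
  "L2_loc S = {w. \<forall>r. w \<in> L2 (leb_on (S \<inter> ball 0 r))}"

lemma L2_loc_mult_integrable: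
  assumes S: "open S" and w: "w \<in> L2_loc S" and b: "continuous_on UNIV b" "\<And>x. norm x > R \<Longrightarrow> b x = 0"
  shows "set_integrable lborel S (\<lambda>x. w x * b x)"
proof (subst set_integral_eq_leb_on_ball(2)[OF S, of "R + 1"])
  show "integrable (leb_on (S \<inter> ball 0 (R + 1))) (\<lambda>x. w x * b x)"
    using w by (intro L2_integrable_mult[OF _ continuous_L2_leb_on_ball[OF S b(1)]]) (auto simp: L2_loc_def)
qed (use b in auto)

lemma H1_loc_imp_L2_loc:
  fixes w :: "real \<times> real \<Rightarrow> complex"
  assumes S: "open S" and w: "C1_on S w" and H: "w \<in> H1_loc S"
  shows "w \<in> L2_loc S" and "i \<in> Basis \<Longrightarrow> partial i w \<in> L2_loc S"
proof -
  have "w \<in> H1 (S \<inter> ball 0 r)" if "r > 0" for r using H that by (simp add: H1_loc_def)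
  moreover have "h \<in> L2 (leb_on (S \<inter> ball 0 r))" if "r \<le> 0" for r :: real and h :: "real \<times> real \<Rightarrow> complex"
  proof -
    have "ball (0 :: real \<times> real) r = {}" using that by simp
    then have "S \<inter> ball 0 r = {}" by blast
    then have "space (leb_on (S \<inter> ball 0 r)) = {}" by (simp add: space_restrict_space)
    then show ?thesis by (intro L2_bounded[of _ _ 0]) (auto simp: measurable_def)
  qed
  moreover have "open (S \<inter> ball 0 r)" "C1_on (S \<inter> ball 0 r) w" for r
    using S C1_on_subset[OF w] by auto
  ultimately have "w \<in> L2 (leb_on (S \<inter> ball 0 r))"
    "i \<in> Basis \<Longrightarrow> partial i w \<in> L2 (leb_on (S \<inter> ball 0 r))" for r
    using H1_imp_partial_L2 by (cases "r > 0"; simp add: H1_def)+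
  then show "w \<in> L2_loc S" "i \<in> Basis \<Longrightarrow> partial i w \<in> L2_loc S"
    by (simp_all add: L2_loc_def)
qed

section \<open>Integration by parts for functions with zero trace\<close>

text \<open>By the divergence theorem this is minus the boundary integral of \<open>u \<psi> (e
  \<bullet> \<nu>)\<close>. That it vanishes for all \<open>\<psi>\<close> and \<open>e\<close> is
  therefore a way of saying, inside the domain alone, that \<open>u\<close> has zero trace.\<close>

definition parts_defect ::
    "(real \<times> real) set \<Rightarrow> real \<times> real \<Rightarrow> (real \<times> real \<Rightarrow> complex) \<Rightarrow> (real \<times> real \<Rightarrow> complex) \<Rightarrow> complex" where
  "parts_defect S e u \<psi> = (LINT x:S|lborel. partial e u x * \<psi> x + u x * partial e \<psi> x)"

text \<open>The boundary estimate for smooth functions passes to the limit along the approximants in the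
  definition of the trace: their defects converge by convergence in \<open>H\<^sup>1\<close>, their
  boundary integrals by convergence in \<open>L\<^sup>2\<close>. The smooth summand \<open>v\<close> is
  its own trace; in the application it is the incident field, and \<open>v + g\<close> vanishes on one
  period of the boundary.\<close>

lemma has_trace_imp_defect_le:
  fixes f :: "real \<Rightarrow> real"
  assumes f: "M-lipschitz_on UNIV f"
    and w: "C1_on (Omega_plus f) w" and tr: "has_trace (Omega_plus f) (arclength f) w g"
    and v: "C1_on UNIV v"
    and \<psi>: "C1_on UNIV \<psi>" "\<And>x. \<psi> x \<noteq> 0 \<Longrightarrow> norm x \<le> R" and e: "e \<in> Basis"
  shows "integrable (arclength f) (\<lambda>x. norm (v x + g x) * norm (\<psi> x))"
    and "norm (parts_defect (Omega_plus f) e (\<lambda>x. v x + w x) \<psi>)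
    \<le> 2 * (M + 1) * (LINT x|arclength f. norm (v x + g x) * norm (\<psi> x))"
proof -
  let ?A = "\<lambda>x. (partial e v x + partial e w x) * \<psi> x + (v x + w x) * partial e \<psi> x"
  define S where "S = Omega_plus f"
  define \<sigma> where "\<sigma> = arclength f"
  define r where "r = max 0 R + 1"
  define N where "N = leb_on (S \<inter> ball 0 r)"
  define \<tau> where "\<tau> = restrict_space \<sigma> (ball 0 r)"
  have r: "r > 0" by (simp add: r_def)
  have M: "M \<ge> 0" using f by (rule lipschitz_on_nonneg)
  have cf: "continuous_on UNIV f" by (rule lipschitz_UNIV_continuous[OF f])
  have S: "open S" unfolding S_def by (rule open_Omega_plus)
  have Sr: "open (S \<inter> ball 0 r)" by (intro open_Int S open_ball)
  have wS: "C1_on S w" using w by (simp add: S_def)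
  from tr obtain \<phi> where \<phi>: "\<And>n. C1_on UNIV (\<phi> n)"
      "\<And>r. r > 0 \<Longrightarrow> (\<lambda>n. H1_norm (S \<inter> ball 0 r) (\<lambda>x. \<phi> n x - w x)) \<longlonglongrightarrow> 0"
      "\<And>r. r > 0 \<Longrightarrow> (\<lambda>n. L2_norm (restrict_space \<sigma> (ball 0 r)) (\<lambda>x. \<phi> n x - g x)) \<longlonglongrightarrow> 0"
    and wH: "w \<in> H1_loc S" and g: "\<And>r. r > 0 \<Longrightarrow> g \<in> L2 (restrict_space \<sigma> (ball 0 r))"
    by (auto simp: has_trace_def S_def \<sigma>_def)
  let ?B = "\<lambda>n x. (partial e v x + partial e (\<phi> n) x) * \<psi> x + (v x + \<phi> n x) * partial e \<psi> x"
  let ?p = "\<lambda>n x. norm (partial e (\<phi> n) x - partial e w x) * norm (\<psi> x)"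
    and ?q = "\<lambda>n x. norm (\<phi> n x - w x) * norm (partial e \<psi> x)"
    and ?r = "\<lambda>n x. norm (\<phi> n x - g x) * norm (\<psi> x)"
    and ?s = "\<lambda>n x. norm (v x + \<phi> n x) * norm (\<psi> x)"
  have wL: "w \<in> L2 N" "partial e w \<in> L2 N"
    using H1_loc_imp_L2_loc[OF S wS wH] e by (auto simp: L2_loc_def N_def)
  have zero: "\<psi> x = 0" "partial e \<psi> x = 0" if "norm x \<ge> r" for x
  proof -
    have "norm x > R" using that by (simp add: r_def)
    then show "\<psi> x = 0" "partial e \<psi> x = 0"
      using \<psi>(2) partial_zero_outside_cball[of \<psi> R x e] by fastforce+
  qed
  have cont: "continuous_on UNIV \<psi>" "continuous_on UNIV (partial e \<psi>)" "continuous_on UNIV v"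
      "continuous_on UNIV (\<phi> n)" "continuous_on UNIV (partial e (\<phi> n))" "continuous_on UNIV (partial e v)" for n
    using \<psi>(1) v \<phi>(1) e by (auto intro: C1_on_continuous_on C1_on_partial_continuous)
  have cN: "h \<in> L2 N" if "continuous_on UNIV h" for h
    unfolding N_def by (rule continuous_L2_leb_on_ball[OF S that])
  have c\<tau>: "h \<in> L2 \<tau>" if h: "continuous_on UNIV h" for h
    unfolding \<tau>_def \<sigma>_def by (rule continuous_L2_arclength[OF f _ _ h]) auto
  have g\<tau>: "g \<in> L2 \<tau>" unfolding \<tau>_def by (rule g[OF r])
  have \<sigma>\<tau>: "(LINT x|\<sigma>. norm (h x) * norm (\<psi> x)) = (LINT x|\<tau>. norm (h x) * norm (\<psi> x))"
      "integrable \<sigma> (\<lambda>x. norm (h x) * norm (\<psi> x)) \<longleftrightarrow> integrable \<tau> (\<lambda>x. norm (h x) * norm (\<psi> x))"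
    for h :: "real \<times> real \<Rightarrow> complex"
  proof -
    have "(\<lambda>x. norm (h x) * norm (\<psi> x)) = (\<lambda>x. indicator (ball 0 r) x *\<^sub>R (norm (h x) * norm (\<psi> x)))"
      using zero(1) by (auto simp: indicator_def fun_eq_iff not_less)
    then show "(LINT x|\<sigma>. norm (h x) * norm (\<psi> x)) = (LINT x|\<tau>. norm (h x) * norm (\<psi> x))"
      "integrable \<sigma> (\<lambda>x. norm (h x) * norm (\<psi> x)) \<longleftrightarrow> integrable \<tau> (\<lambda>x. norm (h x) * norm (\<psi> x))"
      unfolding \<tau>_def by (subst integral_restrict_space integrable_restrict_space; simp add: \<sigma>_def)+
  qed
  have vg: "(\<lambda>x. v x + g x) \<in> L2 \<tau>" by (intro L2_add c\<tau> cont g\<tau>)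
  then show int: "integrable (arclength f) (\<lambda>x. norm (v x + g x) * norm (\<psi> x))"
    using \<sigma>\<tau>(2)[of "\<lambda>x. v x + g x"] L2_integrable_norm_mult[OF vg c\<tau>[OF cont(1)]] by (simp add: \<sigma>_def)
  define I where "I = (LINT x|\<sigma>. norm (v x + g x) * norm (\<psi> x))"
  let ?F = "\<lambda>n x. (v x + \<phi> n x) * \<psi> x"
  define E where "E n = (LINT x|N. ?p n x)
      + (LINT x|N. ?q n x)" for n
  have vw: "C1_on S (\<lambda>x. v x + w x)" by (intro C1_on_add wS C1_on_subset[OF v]) simp
  have F: "C1_on UNIV (?F n)" for n by (intro C1_on_mult C1_on_add v \<phi> \<psi>)
  \<comment> \<open>The smooth approximants obey the boundary estimate; their defects converge to that of \<open>v + w\<close>.\<close>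
  have dF: "partial e (?F n) x = ?B n x" for n x
    using partial_mult[OF C1_on_add[OF v \<phi>(1)] \<psi>(1)] partial_add[OF v \<phi>(1)] by simp
  have dvw: "partial e (\<lambda>x. v x + w x) x = partial e v x + partial e w x" if "x \<in> S" for x
    using partial_add[OF C1_on_subset[OF v] wS that] by simp
  have defectN: "parts_defect S e (\<lambda>x. v x + w x) \<psi>
      = (LINT x|N. ?A x)"
  proof -
    have "parts_defect S e (\<lambda>x. v x + w x) \<psi>
        = (LINT x:S|lborel. ?A x)"
      unfolding parts_defect_def using S by (intro set_lebesgue_integral_cong) (auto simp: dvw)
    also have "\<dots> = (LINT x|N. ?A x)"
      unfolding N_def by (rule set_integral_eq_leb_on_ball(1)[OF S]) (simp add: zero)
    finally show ?thesis .
  qed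
  have FN: "(LINT x:S|lborel. partial e (?F n) x)
      = (LINT x|N. ?B n x)" for n
    unfolding dF N_def by (rule set_integral_eq_leb_on_ball(1)[OF S]) (simp add: zero)
  have step1: "norm (parts_defect S e (\<lambda>x. v x + w x) \<psi>) \<le> norm (LINT x:S|lborel. partial e (?F n) x) + E n" for n
  proof -
    have iA: "integrable N ?A" and iB: "integrable N (?B n)"
      by (intro Bochner_Integration.integrable_add L2_integrable_mult L2_add cN cont wL)+
    have L2d: "(\<lambda>x. partial e (\<phi> n) x - partial e w x) \<in> L2 N" "(\<lambda>x. \<phi> n x - w x) \<in> L2 N"
      by (intro L2_diff cN cont wL)+
    have "norm ((LINT x|N. ?B n x) - (LINT x|N. ?A x)) = norm (LINT x|N. ?B n x - ?A x)"
      by (subst Bochner_Integration.integral_diff[OF iB iA]) (rule refl)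
    also have "\<dots> \<le> (LINT x|N. norm (?B n x - ?A x))" by (rule integral_norm_bound)
    also have "\<dots> \<le> (LINT x|N. ?p n x
        + ?q n x)"
    proof (rule integral_mono)
      show "integrable N (\<lambda>x. norm (?B n x - ?A x))"
        by (intro integrable_norm Bochner_Integration.integrable_diff iA iB)
      show "integrable N (\<lambda>x. ?p n x
        + ?q n x)"
        by (intro Bochner_Integration.integrable_add L2_integrable_norm_mult L2d cN cont)
      fix x
      have "?B n x - ?A x = (partial e (\<phi> n) x - partial e w x) * \<psi> x + (\<phi> n x - w x) * partial e \<psi> x"
        by (simp add: algebra_simps)
      then show "norm (?B n x - ?A x) \<le> ?p n x
        + ?q n x"
        by (metis norm_mult norm_triangle_ineq)
    qed
    also have "\<dots> = E n" unfolding E_def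
      by (intro Bochner_Integration.integral_add L2_integrable_norm_mult L2d cN cont)
    finally have "norm ((LINT x|N. ?B n x) - (LINT x|N. ?A x)) \<le> E n" .
    then show ?thesis unfolding defectN FN
      using norm_triangle_sub[of "LINT x|N. ?A x" "LINT x|N. ?B n x"] norm_minus_commute[of "LINT x|N. ?A x" "LINT x|N. ?B n x"]
      by linarith
  qed
  have step2: "norm (LINT x:S|lborel. partial e (?F n) x)
      \<le> 2 * (M + 1) * ((LINT x|\<tau>. ?r n x) + I)" for n
  proof -
    have cF: "continuous_on UNIV (?F n)" by (rule C1_on_continuous_on[OF F])
    have mF: "(\<lambda>x. norm (?F n x)) \<in> borel_measurable borel"
      by (intro borel_measurable_continuous_onI continuous_on_norm cF)
    have iF: "integrable \<sigma> (\<lambda>x. ?s n x)"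
      unfolding \<sigma>\<tau>(2) by (intro L2_integrable_norm_mult L2_add c\<tau> cont)
    then have iF': "integrable lborel (\<lambda>t. speed f t *\<^sub>R norm (?F n (t, f t)))"
      using integrable_arclength[OF cf mF] by (simp add: \<sigma>_def norm_mult)
    have mFf: "(\<lambda>t. norm (?F n (t, f t))) \<in> borel_measurable borel"
      using measurable_compose[OF borel_measurable_graph_map[OF cf] mF] .
    have "norm (LINT x:S|lborel. partial e (?F n) x) \<le> 2 * (M + 1) * (LINT t|lborel. norm (?F n (t, f t)))"
      unfolding S_def Omega_plus_eq[OF cf]
      by (rule norm_integral_partial_graph_le[OF F _ f e, of _ R]) (use \<psi>(2) in auto)
    also have "(LINT t|lborel. norm (?F n (t, f t))) \<le> (LINT t|lborel. speed f t *\<^sub>R norm (?F n (t, f t)))"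
    proof (rule integral_mono)
      have le: "norm (?F n (t, f t)) \<le> speed f t *\<^sub>R norm (?F n (t, f t))" for t
        using mult_right_mono[OF speed_ge_1[of f t] norm_ge_zero[of "?F n (t, f t)"]] by simp
      then show "norm (?F n (t, f t)) \<le> speed f t *\<^sub>R norm (?F n (t, f t))" for t .
      show "integrable lborel (\<lambda>t. norm (?F n (t, f t)))"
        by (rule Bochner_Integration.integrable_bound[OF iF'])
          (use mFf le in \<open>auto intro!: AE_I2 order_trans[OF le] simp del: real_scaleR_def\<close>)
    qed (rule iF')
    also have "\<dots> = (LINT x|\<sigma>. ?s n x)"
      unfolding \<sigma>_def integral_arclength[OF cf mF, symmetric] by (simp add: norm_mult)
    also have "\<dots> = (LINT x|\<tau>. ?s n x)" by (rule \<sigma>\<tau>(1))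
    also have "\<dots> \<le> (LINT x|\<tau>. ?r n x + norm (v x + g x) * norm (\<psi> x))"
    proof (rule integral_mono)
      fix x
      have "norm (v x + \<phi> n x) \<le> norm (\<phi> n x - g x) + norm (v x + g x)"
        using norm_triangle_ineq[of "\<phi> n x - g x" "v x + g x"] by (simp add: add.commute)
      then show "?s n x \<le> ?r n x + norm (v x + g x) * norm (\<psi> x)"
        using mult_right_mono[OF _ norm_ge_zero] by (metis distrib_right)
    qed (intro Bochner_Integration.integrable_add L2_integrable_norm_mult L2_add L2_diff c\<tau> cont g\<tau>)+
    also have "\<dots> = (LINT x|\<tau>. ?r n x) + I"
      unfolding I_def \<sigma>\<tau>(1)
      by (intro Bochner_Integration.integral_add L2_integrable_norm_mult L2_add L2_diff c\<tau> cont g\<tau>)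
    finally show ?thesis using M by (simp add: mult_left_mono)
  qed
  have H1n: "(\<lambda>n. H1_norm (S \<inter> ball 0 r) (\<lambda>x. \<phi> n x - w x)) \<longlonglongrightarrow> 0" by (rule \<phi>(2)[OF r])
  have le_H1: "L2_norm N (\<lambda>x. \<phi> n x - w x) \<le> H1_norm (S \<inter> ball 0 r) (\<lambda>x. \<phi> n x - w x)"
    "L2_norm N (\<lambda>x. partial e (\<phi> n) x - partial e w x) \<le> H1_norm (S \<inter> ball 0 r) (\<lambda>x. \<phi> n x - w x)" for n
  proof -
    let ?D = "\<lambda>x. \<phi> n x - w x"
    have c: "C1_on (S \<inter> ball 0 r) (\<phi> n)" "C1_on (S \<inter> ball 0 r) w"
      using C1_on_subset \<phi>(1) wS by blast+
    have D: "C1_on (S \<inter> ball 0 r) ?D" by (intro C1_on_diff c)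
    have pos: "(LINT x:S \<inter> ball 0 r|lborel. (norm (h x))\<^sup>2) \<ge> 0" for h :: "real \<times> real \<Rightarrow> complex"
      unfolding set_lebesgue_integral_def by (intro Bochner_Integration.integral_nonneg) auto
    show "L2_norm N ?D \<le> H1_norm (S \<inter> ball 0 r) ?D"
      unfolding N_def L2_norm_leb_on[OF Sr] H1_norm_C1[OF Sr D] using pos
      by (intro real_sqrt_le_mono) (simp add: sum_nonneg)
    have "(LINT x:S \<inter> ball 0 r|lborel. (norm (partial e (\<phi> n) x - partial e w x))\<^sup>2)
        = (LINT x:S \<inter> ball 0 r|lborel. (norm (partial e ?D x))\<^sup>2)"
      using Sr by (intro set_lebesgue_integral_cong) (auto simp: partial_diff[OF c])
    also have "\<dots> \<le> (\<Sum>i\<in>Basis. LINT x:S \<inter> ball 0 r|lborel. (norm (partial i ?D x))\<^sup>2)"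
      using e pos by (intro member_le_sum) auto
    finally show "L2_norm N (\<lambda>x. partial e (\<phi> n) x - partial e w x) \<le> H1_norm (S \<inter> ball 0 r) ?D"
      unfolding N_def L2_norm_leb_on[OF Sr] H1_norm_C1[OF Sr D] using pos[of ?D]
      by (intro real_sqrt_le_mono) simp
  qed
  have L2pos: "L2_norm N' h \<ge> 0" for N' :: "(real \<times> real) measure" and h
    by (simp add: L2_norm_def Bochner_Integration.integral_nonneg)
  have L2lim: "(\<lambda>n. L2_norm N (\<lambda>x. \<phi> n x - w x)) \<longlonglongrightarrow> 0"
    "(\<lambda>n. L2_norm N (\<lambda>x. partial e (\<phi> n) x - partial e w x)) \<longlonglongrightarrow> 0"
    by (rule real_tendsto_sandwich[OF _ _ tendsto_const H1n]; use L2pos le_H1 in simp)+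
  have Elim: "E \<longlonglongrightarrow> 0 + 0"
    unfolding E_def[abs_def] by (intro tendsto_add L2_pairing_tendsto_0 L2lim L2_diff cN cont wL)
  have glim: "(\<lambda>n. LINT x|\<tau>. ?r n x) \<longlonglongrightarrow> 0"
    by (intro L2_pairing_tendsto_0 L2_diff c\<tau> cont g\<tau>) (use \<phi>(3)[OF r] in \<open>simp add: \<tau>_def\<close>)
  have "(\<lambda>n. 2 * (M + 1) * ((LINT x|\<tau>. ?r n x) + I) + E n)
      \<longlonglongrightarrow> 2 * (M + 1) * (0 + I) + (0 + 0)"
    by (intro tendsto_add tendsto_mult tendsto_const glim Elim)
  moreover have "norm (parts_defect S e (\<lambda>x. v x + w x) \<psi>)
      \<le> 2 * (M + 1) * ((LINT x|\<tau>. ?r n x) + I) + E n" for n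
    using step1[of n] step2[of n] by linarith
  ultimately have "norm (parts_defect S e (\<lambda>x. v x + w x) \<psi>) \<le> 2 * (M + 1) * (0 + I) + (0 + 0)"
    by (intro LIMSEQ_le_const) auto
  then show "norm (parts_defect (Omega_plus f) e (\<lambda>x. v x + w x) \<psi>)
    \<le> 2 * (M + 1) * (LINT x|arclength f. norm (v x + g x) * norm (\<psi> x))"
    by (simp add: S_def I_def \<sigma>_def)
qed

section \<open>Zero trace on one period suffices\<close>

lemma partial_translate:
  assumes w: "C1_on T w" and x: "x + a \<in> T"
  shows "partial e (\<lambda>y. w (y + a)) x = partial e w (x + a)"
proof -
  have "((\<lambda>y. y + a) has_derivative (\<lambda>h. h)) (at x)" by (auto intro!: derivative_eq_intros)
  from has_derivative_compose[OF this C1_on_has_derivative[OF w x]]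
  show ?thesis by (rule partial_eq)
qed

lemma C1_on_translate:
  assumes "C1_on UNIV w"
  shows "C1_on UNIV (\<lambda>y. w (y + a))"
proof (rule C1_onI)
  fix x
  have "((\<lambda>y. y + a) has_derivative (\<lambda>h. h)) (at x)" by (auto intro!: derivative_eq_intros)
  from has_derivative_compose[OF this C1_on_has_derivative[OF assms, of "x + a"]]
  show "((\<lambda>y. w (y + a)) has_derivative (\<lambda>h. partial h w (x + a))) (at x)" by simp
next
  fix i :: 'a assume "i \<in> Basis"
  then show "continuous_on UNIV (\<lambda>x. partial i w (x + a))"
    by (intro continuous_on_compose2[OF C1_on_partial_continuous[OF assms]] continuous_intros) auto
qed

lemma C1_on_const: "C1_on S (\<lambda>_. c)"
  by (rule C1_onI[where D = "\<lambda>_ _. 0"]) auto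

lemma partial_cmult:
  assumes "C1_on S u" "x \<in> S"
  shows "partial e (\<lambda>y. c * u y) x = c * partial e u x"
  using partial_mult[OF C1_on_const assms, of e c] partial_eq[OF has_derivative_const[of c "at x"], of e] by simp

lemma partial_quasi_periodic:
  assumes S: "open S" "\<And>x. x + a \<in> S \<longleftrightarrow> x \<in> S" and u: "C1_on S u"
    and qp: "\<And>x. x \<in> S \<Longrightarrow> u (x + a) = c * u x" and x: "x \<in> S"
  shows "partial e u (x + a) = c * partial e u x"
proof -
  have "partial e u (x + a) = partial e (\<lambda>y. u (y + a)) x"
    using partial_translate[OF u] S(2) x by simp
  also have "\<dots> = partial e (\<lambda>y. c * u y) x"
    by (rule partial_cong_open[OF S(1) x]) (rule qp)
  also have "\<dots> = c * partial e u x" by (rule partial_cmult[OF u x])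
  finally show ?thesis .
qed

lemma parts_defect_translate:
  assumes S: "open S" "\<And>x. x + a \<in> S \<longleftrightarrow> x \<in> S" and u: "C1_on S u"
    and qp: "\<And>x. x \<in> S \<Longrightarrow> u (x + a) = c * u x"
    and \<psi>: "C1_on UNIV \<psi>" and e: "e \<in> Basis"
  shows "parts_defect S e u \<psi> = c * parts_defect S e u (\<lambda>x. \<psi> (x + a))"
proof -
  let ?H = "\<lambda>x. partial e u x * \<psi> x + u x * partial e \<psi> x"
  have "continuous_on S ?H"
    using u C1_on_subset[OF \<psi>, of S] e
    by (intro continuous_on_add continuous_on_mult C1_on_continuous_on C1_on_partial_continuous) auto
  then have m: "(\<lambda>x. indicator S x *\<^sub>R ?H x) \<in> borel_measurable borel"
    using S(1) by (intro borel_measurable_continuous_on_indicator) auto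
  have "parts_defect S e u \<psi> = (LINT x|lborel. indicator S (x + a) *\<^sub>R ?H (x + a))"
    unfolding parts_defect_def set_lebesgue_integral_def by (rule lborel_integral_translate[OF m, symmetric])
  also have "\<dots> = (LINT x|lborel. c * (indicator S x *\<^sub>R
      (partial e u x * \<psi> (x + a) + u x * partial e (\<lambda>x. \<psi> (x + a)) x)))"
  proof (rule Bochner_Integration.integral_cong[OF refl])
    fix x
    show "indicator S (x + a) *\<^sub>R ?H (x + a) = c * (indicator S x *\<^sub>R
      (partial e u x * \<psi> (x + a) + u x * partial e (\<lambda>x. \<psi> (x + a)) x))"
    proof (cases "x \<in> S")
      case True
      then show ?thesis
        using S(2)[of x] qp[OF True] partial_quasi_periodic[OF S u qp True, of e] partial_translate[OF \<psi>, of x a e]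
        by (simp add: algebra_simps)
    qed (use S(2)[of x] in simp)
  qed
  also have "\<dots> = c * parts_defect S e u (\<lambda>x. \<psi> (x + a))"
    unfolding parts_defect_def set_lebesgue_integral_def by (rule integral_mult_right_zero)
  finally show ?thesis .
qed

lemma parts_defect_integrable:
  assumes S: "open S" and u: "u \<in> L2_loc S" "partial e u \<in> L2_loc S"
    and \<psi>: "C1_on UNIV \<psi>" "\<And>x. \<psi> x \<noteq> 0 \<Longrightarrow> norm x \<le> R" and e: "e \<in> Basis"
  shows "set_integrable lborel S (\<lambda>x. partial e u x * \<psi> x)"
    and "set_integrable lborel S (\<lambda>x. u x * partial e \<psi> x)"
proof -
  have z: "\<psi> x = 0" "partial e \<psi> x = 0" if "norm x > R" for x
    using that \<psi>(2) partial_zero_outside_cball[of \<psi> R x e] by fastforce+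
  show "set_integrable lborel S (\<lambda>x. partial e u x * \<psi> x)"
    by (rule L2_loc_mult_integrable[OF S u(2) C1_on_continuous_on[OF \<psi>(1)] z(1)])
  show "set_integrable lborel S (\<lambda>x. u x * partial e \<psi> x)"
    by (rule L2_loc_mult_integrable[OF S u(1) C1_on_partial_continuous[OF \<psi>(1) e] z(2)])
qed

lemma parts_defect_diff:
  assumes S: "open S" and u: "u \<in> L2_loc S" "partial e u \<in> L2_loc S"
    and a: "C1_on UNIV a" "\<And>x. a x \<noteq> 0 \<Longrightarrow> norm x \<le> R"
    and b: "C1_on UNIV b" "\<And>x. b x \<noteq> 0 \<Longrightarrow> norm x \<le> R" and e: "e \<in> Basis"
  shows "parts_defect S e u (\<lambda>x. a x - b x) = parts_defect S e u a - parts_defect S e u b"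
proof -
  have "parts_defect S e u (\<lambda>x. a x - b x) = (LINT x:S|lborel.
      (partial e u x * a x + u x * partial e a x) - (partial e u x * b x + u x * partial e b x))"
    unfolding parts_defect_def by (simp add: partial_diff[OF a(1) b(1)] algebra_simps)
  also have "\<dots> = parts_defect S e u a - parts_defect S e u b"
    unfolding parts_defect_def
    by (intro set_integral_diff(2) set_integral_add(1) parts_defect_integrable[OF S u a e] parts_defect_integrable[OF S u b e])
  finally show ?thesis .
qed

lemma tensor_support:
  assumes "\<And>t. A t \<noteq> 0 \<Longrightarrow> \<bar>t\<bar> \<le> p" "\<And>t. B t \<noteq> 0 \<Longrightarrow> \<bar>t\<bar> \<le> q" "tensor A B x \<noteq> 0"
  shows "norm x \<le> p + q"
proof -
  have "\<bar>fst x\<bar> \<le> p" "\<bar>snd x\<bar> \<le> q" using assms by (auto simp: tensor_def)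
  then show ?thesis using norm_Pair_le[of "fst x" "snd x"] by simp
qed

lemma tensor_mult_left:
  assumes A: "\<And>t. (A has_vector_derivative A' t) (at t)" "continuous_on UNIV A'"
    and K: "\<And>t. (K has_vector_derivative K' t) (at t)" "continuous_on UNIV K'"
    and B: "\<And>t. (B has_vector_derivative B' t) (at t)" "continuous_on UNIV B'"
  shows "C1_on S (tensor (\<lambda>t. A t * K t) B)"
proof (rule C1_on_tensor[OF _ B(1) _ B(2)])
  have c: "continuous_on UNIV A" "continuous_on UNIV K"
    using A(1) K(1) by (meson continuous_on_eq_continuous_within has_vector_derivative_continuous
        has_vector_derivative_at_within)+
  show "((\<lambda>t. A t * K t) has_vector_derivative A t * K' t + A' t * K t) (at t)" for t
    by (rule has_vector_derivative_mult[OF A(1) K(1)])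
  show "continuous_on UNIV (\<lambda>t. A t * K' t + A' t * K t)"
    by (intro continuous_intros c A K)
qed

text \<open>The boundary datum \<open>h\<close> vanishes over one period. A test function supported over
  a single period is moved there by quasi-periodicity. What remains after cutting out neighbourhoods of
  the period end points is small by the boundary estimate, in which no derivative of the cut-off
  occurs.\<close>

lemma parts_defect_eq_0:
  assumes S: "open S" "\<And>x. x + (L, 0) \<in> S \<longleftrightarrow> x \<in> S" and u: "C1_on S u"
    and uL: "u \<in> L2_loc S" "partial e u \<in> L2_loc S"
    and qp: "\<And>x. x \<in> S \<Longrightarrow> u (x + (L, 0)) = c * u x"
    and e: "e \<in> Basis"
    and bound: "\<And>\<psi> R. C1_on UNIV \<psi> \<Longrightarrow> (\<And>x. \<psi> x \<noteq> 0 \<Longrightarrow> norm x \<le> R) \<Longrightarrow>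
      integrable \<sigma> (\<lambda>x. norm (h x) * norm (\<psi> x)) \<and>
      norm (parts_defect S e u \<psi>) \<le> C * (LINT x|\<sigma>. norm (h x) * norm (\<psi> x))"
    and h0: "AE x in \<sigma>. 0 < fst x \<and> fst x < L \<longrightarrow> h x = 0"
    and null: "\<And>d. AE x in \<sigma>. fst x \<noteq> d"
    and A: "\<And>t. (A has_vector_derivative A' t) (at t)" "continuous_on UNIV A'"
    and B: "\<And>t. (B has_vector_derivative B' t) (at t)" "continuous_on UNIV B'"
    and supp: "\<And>t. A t \<noteq> 0 \<Longrightarrow> 0 \<le> t \<and> t \<le> 2 * L" "\<And>t. B t \<noteq> 0 \<Longrightarrow> \<bar>t\<bar> \<le> r"
  shows "parts_defect S e u (tensor A B) = 0"
proof -
  define R where "R = 2 * L + r"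
  have single: "parts_defect S e u \<psi> = 0"
    if \<psi>: "C1_on UNIV \<psi>" "\<And>x. \<psi> x \<noteq> 0 \<Longrightarrow> norm x \<le> R'" "\<And>x. \<psi> x \<noteq> 0 \<Longrightarrow> 0 < fst x \<and> fst x < L" for \<psi> R'
  proof -
    have "AE x in \<sigma>. norm (h x) * norm (\<psi> x) = 0"
      using h0 by eventually_elim (use \<psi>(3) in auto)
    then have "(LINT x|\<sigma>. norm (h x) * norm (\<psi> x)) = 0" by (rule integral_eq_zero_AE)
    with bound[OF \<psi>(1,2)] show ?thesis by simp
  qed
  let ?\<psi> = "tensor A B"
  let ?p = "\<lambda>j. tensor (\<lambda>t. A t * bump 0 L j t) B"
  let ?q = "\<lambda>j. tensor (\<lambda>t. A t * bump L (2 * L) j t) B"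
  have C1: "C1_on UNIV ?\<psi>" "C1_on UNIV (?p j)" "C1_on UNIV (?q j)" for j
    by (intro C1_on_tensor[OF A(1) B(1) A(2) B(2)] tensor_mult_left[OF A bump_deriv continuous_bump' B])+
  have sA: "\<bar>t\<bar> \<le> 2 * L" if "A t \<noteq> 0" for t using supp(1)[OF that] by simp
  have supp\<psi>: "norm x \<le> R" if "?\<psi> x \<noteq> 0" for x
    unfolding R_def by (rule tensor_support[OF sA supp(2) that])
  have pq: "?p j x = ?\<psi> x * bump 0 L j (fst x)" "?q j x = ?\<psi> x * bump L (2 * L) j (fst x)" for j x
    by (simp_all add: tensor_def)
  have suppp: "norm x \<le> R" if "?p j x \<noteq> 0" for j x using that supp\<psi> by (simp add: pq)
  have suppq: "norm x \<le> R" if "?q j x \<noteq> 0" for j x using that supp\<psi> by (simp add: pq)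
  have p0: "parts_defect S e u (?p j) = 0" for j
  proof (rule single[OF C1(2) suppp])
    show "0 < fst x \<and> fst x < L" if "?p j x \<noteq> 0" for x
      using that bump_eq_0[of "fst x" 0 L j] by (auto simp: pq not_le[symmetric])
  qed
  have q0: "parts_defect S e u (?q j) = 0" for j
  proof -
    have "parts_defect S e u (\<lambda>x. ?q j (x + (L, 0))) = 0"
    proof (rule single[OF C1_on_translate[OF C1(3)]])
      fix x assume x: "?q j (x + (L, 0)) \<noteq> 0"
      have "norm x \<le> norm (x + (L, 0)) + norm (L, 0::real)"
        using norm_triangle_ineq4[of "x + (L, 0)" "(L, 0)"] by simp
      with suppq[OF x] show "norm x \<le> R + norm (L, 0::real)" by simp
      show "0 < fst x \<and> fst x < L"
        using x bump_eq_0[of "fst x + L" L "2 * L" j] by (auto simp: pq not_le[symmetric])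
    qed
    then show ?thesis using parts_defect_translate[OF S u qp C1(3) e] by simp
  qed
  let ?d = "\<lambda>j x. ?\<psi> x - ?p j x - ?q j x"
  have C1d: "C1_on UNIV (\<lambda>x. ?\<psi> x - ?p j x)" for j by (rule C1_on_diff[OF C1(1,2)])
  have suppd: "norm x \<le> R" if "?\<psi> x - ?p j x \<noteq> 0" for j x using that supp\<psi>[of x] unfolding pq by fastforce
  have d: "C1_on UNIV (?d j)" "\<And>x. ?d j x \<noteq> 0 \<Longrightarrow> norm x \<le> R" for j
  proof -
    show "C1_on UNIV (?d j)" by (rule C1_on_diff[OF C1d C1(3)])
    show "norm x \<le> R" if "?d j x \<noteq> 0" for x using that supp\<psi>[of x] unfolding pq by fastforce
  qed
  have "parts_defect S e u (?d j) = parts_defect S e u ?\<psi>" for j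
  proof -
    have "parts_defect S e u (?d j) = parts_defect S e u (\<lambda>x. ?\<psi> x - ?p j x) - parts_defect S e u (?q j)"
      by (rule parts_defect_diff[OF S(1) uL C1d suppd C1(3) suppq e])
    also have "parts_defect S e u (\<lambda>x. ?\<psi> x - ?p j x) = parts_defect S e u ?\<psi> - parts_defect S e u (?p j)"
      by (rule parts_defect_diff[OF S(1) uL C1(1) supp\<psi> C1(2) suppp e])
    finally show ?thesis by (simp add: p0 q0)
  qed
  then have le: "norm (parts_defect S e u ?\<psi>) \<le> C * (LINT x|\<sigma>. norm (h x) * norm (?d j x))" for j
    using bound[OF d, of j] by simp
  have int: "integrable \<sigma> (\<lambda>x. norm (h x) * norm (?\<psi> x))" "integrable \<sigma> (\<lambda>x. norm (h x) * norm (?d j x))" for j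
    using bound[OF C1(1) supp\<psi>] bound[OF d, of j] by auto
  have "(\<lambda>j. LINT x|\<sigma>. norm (h x) * norm (?d j x)) \<longlonglongrightarrow> (LINT x|\<sigma>. 0)"
  proof (rule integral_dominated_convergence[where w = "\<lambda>x. 3 * (norm (h x) * norm (?\<psi> x))"])
    show "integrable \<sigma> (\<lambda>x. 3 * (norm (h x) * norm (?\<psi> x)))" by (intro integrable_mult_right int)
    show "(\<lambda>x. norm (h x) * norm (?d j x)) \<in> borel_measurable \<sigma>" for j
      using int(2) by (rule borel_measurable_integrable)
    show "AE x in \<sigma>. norm (norm (h x) * norm (?d j x)) \<le> 3 * (norm (h x) * norm (?\<psi> x))" for j
    proof (rule AE_I2)
      fix x
      have n: "norm (?p j x) \<le> norm (?\<psi> x)" "norm (?q j x) \<le> norm (?\<psi> x)"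
        unfolding pq norm_mult by (intro mult_left_le bump_norm_le norm_ge_zero)+
      have "norm (?d j x) \<le> 3 * norm (?\<psi> x)"
        using norm_triangle_ineq4[of "?\<psi> x - ?p j x" "?q j x"] norm_triangle_ineq4[of "?\<psi> x" "?p j x"] n
        by linarith
      then have "norm (h x) * norm (?d j x) \<le> norm (h x) * (3 * norm (?\<psi> x))"
        by (intro mult_left_mono) auto
      then show "norm (norm (h x) * norm (?d j x)) \<le> 3 * (norm (h x) * norm (?\<psi> x))"
        by (simp add: abs_mult ac_simps)
    qed
    have "AE x in \<sigma>. fst x \<noteq> 0 \<and> fst x \<noteq> L \<and> fst x \<noteq> 2 * L"
      using null[of 0] null[of L] null[of "2 * L"] by eventually_elim simp
    then show "AE x in \<sigma>. (\<lambda>j. norm (h x) * norm (?d j x)) \<longlonglongrightarrow> 0"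
    proof eventually_elim
      case (elim x)
      have "(\<lambda>j. ?d j x) \<longlonglongrightarrow> ?\<psi> x - ?\<psi> x * indicator {0<..<L} (fst x) - ?\<psi> x * indicator {L<..<2*L} (fst x)"
        unfolding pq by (intro tendsto_diff tendsto_mult tendsto_const bump_tendsto)
      also have "?\<psi> x - ?\<psi> x * indicator {0<..<L} (fst x) - ?\<psi> x * indicator {L<..<2*L} (fst x) = 0"
      proof (cases "?\<psi> x = 0")
        case False
        then have "0 \<le> fst x" "fst x \<le> 2 * L" using supp(1)[of "fst x"] by (auto simp: tensor_def)
        with elim show ?thesis by (auto simp: indicator_def)
      qed simp
      finally have "(\<lambda>j. norm (h x) * norm (?d j x)) \<longlonglongrightarrow> norm (h x) * norm (0::complex)"
        by (intro tendsto_mult tendsto_const tendsto_norm)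
      then show ?case by simp
    qed
  qed simp
  then have "(\<lambda>j. C * (LINT x|\<sigma>. norm (h x) * norm (?d j x))) \<longlonglongrightarrow> C * 0"
    by (intro tendsto_mult tendsto_const) simp
  then have "norm (parts_defect S e u ?\<psi>) \<le> C * 0"
    by (rule LIMSEQ_le_const) (use le in auto)
  then show ?thesis by simp
qed

lemma AE_arclength_fst_neq:
  assumes f: "continuous_on UNIV f"
  shows "AE x in arclength f. fst x \<noteq> d"
proof -
  have "{x::real \<times> real. fst x \<noteq> d} \<in> sets borel"
    by (intro borel_open open_Collect_neq continuous_intros)
  then show ?thesis by (subst AE_arclength[OF f]) (auto intro: AE_lborel_singleton)
qed

lemma AE_arclength_on_graph:
  assumes f: "continuous_on UNIV f"
  shows "AE x in arclength f. x \<in> Gam f"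
proof -
  have "{x. snd x = f (fst x)} \<in> sets borel"
    by (intro borel_closed closed_Collect_eq continuous_intros continuous_on_compose2[OF f]) auto
  then show ?thesis unfolding Gam_def by (subst AE_arclength[OF f]) auto
qed

lemma Gam_cell_sets:
  assumes f: "continuous_on UNIV f"
  shows "Gam_cell f L \<in> sets borel"
proof -
  have "{x. snd x = f (fst x)} \<in> sets borel"
    by (intro borel_closed closed_Collect_eq continuous_intros continuous_on_compose2[OF f]) auto
  moreover have "{x::real \<times> real. 0 < fst x \<and> fst x < L} \<in> sets borel"
    by (intro borel_open open_Collect_conj open_Collect_less continuous_intros)
  moreover have "Gam_cell f L = {x. snd x = f (fst x)} \<inter> {x. 0 < fst x \<and> fst x < L}"
    by (auto simp: Gam_cell_def Gam_def)
  ultimately show ?thesis by simp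
qed

section \<open>Green's second identity\<close>

lemma L2_loc_set_integrable:
  fixes w :: "'a::euclidean_space \<Rightarrow> complex"
  assumes S: "open S" and w: "w \<in> L2_loc S"
  shows "set_integrable lborel (S \<inter> ball 0 r) w"
proof -
  have "integrable (leb_on (S \<inter> ball 0 r)) (\<lambda>x. w x * 1)"
    using w by (intro L2_integrable_mult[OF _ continuous_L2_leb_on_ball[OF S continuous_on_const]])
      (auto simp: L2_loc_def)
  moreover have "S \<inter> ball 0 r \<in> sets borel" using S by simp
  ultimately show ?thesis by (simp add: set_integrable_def integrable_restrict_space)
qed

text \<open>The second part gives one integrable majorant for all multipliers with a common bound and a
  common bounded support, ready for dominated convergence.\<close>

lemma L2_loc_dominated:
  fixes w :: "'a::euclidean_space \<Rightarrow> complex"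
  assumes S: "open S" and w: "w \<in> L2_loc S"
    and b: "b \<in> borel_measurable borel" "\<And>x. x \<in> S \<Longrightarrow> norm (b x) \<le> K" "\<And>x. x \<in> S \<Longrightarrow> norm x > R \<Longrightarrow> b x = 0"
  shows "set_integrable lborel S (\<lambda>x. w x * b x)"
    and "norm (indicator S x *\<^sub>R (w x * b x)) \<le> K * norm (indicator (S \<inter> ball 0 (R + 1)) x *\<^sub>R w x)"
proof -
  have i: "integrable lborel (\<lambda>x. indicator (S \<inter> ball 0 (R + 1)) x *\<^sub>R w x)"
    using L2_loc_set_integrable[OF S w] by (simp add: set_integrable_def)
  have le: "norm (indicator S x *\<^sub>R (w x * b x)) \<le> K * norm (indicator (S \<inter> ball 0 (R + 1)) x *\<^sub>R w x)" for x
  proof (cases "x \<in> S \<and> norm x \<le> R")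
    case True
    then show ?thesis using mult_right_mono[OF b(2)[of x] norm_ge_zero[of "w x"]] by (simp add: norm_mult mult.commute)
  next
    case False
    then have "indicator S x *\<^sub>R (w x * b x) = 0" using b(3)[of x] by (auto simp: indicator_def)
    moreover have "x \<in> S \<Longrightarrow> 0 \<le> K" using order_trans[OF norm_ge_zero b(2)] .
    ultimately show ?thesis by (auto simp: indicator_def)
  qed
  then show "norm (indicator S x *\<^sub>R (w x * b x)) \<le> K * norm (indicator (S \<inter> ball 0 (R + 1)) x *\<^sub>R w x)" .
  have eq: "indicator S x *\<^sub>R (w x * b x) = (indicator (S \<inter> ball 0 (R + 1)) x *\<^sub>R w x) * b x" for x
    using b(3)[of x] by (auto simp: indicator_def not_less)
  show "set_integrable lborel S (\<lambda>x. w x * b x)" unfolding set_integrable_def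
  proof (rule Bochner_Integration.integrable_bound)
    show "integrable lborel (\<lambda>x. K * norm (indicator (S \<inter> ball 0 (R + 1)) x *\<^sub>R w x))"
      by (intro integrable_mult_right integrable_norm i)
    show "(\<lambda>x. indicator S x *\<^sub>R (w x * b x)) \<in> borel_measurable lborel"
      unfolding eq using borel_measurable_integrable[OF i] b(1) by (intro borel_measurable_times) auto
    show "AE x in lborel. norm (indicator S x *\<^sub>R (w x * b x)) \<le> norm (K * norm (indicator (S \<inter> ball 0 (R + 1)) x *\<^sub>R w x))"
      using le by (intro AE_I2) (metis abs_ge_self order_trans real_norm_def)
  qed
qed

lemma exp_deriv:
  fixes z :: complex
  shows "((\<lambda>t::real. exp (z * of_real t)) has_vector_derivative z * exp (z * of_real t)) (at t)"
proof -
  have "((\<lambda>w. exp (z * w)) has_field_derivative z * exp (z * of_real t)) (at (of_real t))"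
    by (auto intro!: derivative_eq_intros)
  from has_vector_derivative_real_field[OF this] show ?thesis .
qed

definition modulate :: "complex \<Rightarrow> (real \<Rightarrow> complex) \<Rightarrow> real \<Rightarrow> complex" where
  "modulate z g t = exp (z * of_real t) * g t"

lemma modulate_deriv:
  assumes "(g has_vector_derivative g') (at t)"
  shows "(modulate z g has_vector_derivative exp (z * of_real t) * (z * g t + g')) (at t)"
  unfolding modulate_def[abs_def]
  using has_vector_derivative_mult[OF exp_deriv[of z t] assms] by (simp add: algebra_simps)

lemma modulate_second_deriv:
  assumes "\<And>t. (g has_vector_derivative g' t) (at t)" "\<And>t. (g' has_vector_derivative g'' t) (at t)"
  shows "(modulate z g has_vector_derivative modulate z (\<lambda>t. z * g t + g' t) t) (at t)"
    and "(modulate z (\<lambda>t. z * g t + g' t) has_vector_derivative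
      modulate z (\<lambda>t. z\<^sup>2 * g t + 2 * z * g' t + g'' t) t) (at t)"
proof -
  show "(modulate z g has_vector_derivative modulate z (\<lambda>t. z * g t + g' t) t) (at t)"
    using modulate_deriv[OF assms(1)] by (simp add: modulate_def)
  have "((\<lambda>t. z * g t + g' t) has_vector_derivative z * g' t + g'' t) (at t)"
    by (intro has_vector_derivative_add has_vector_derivative_mult_right assms)
  from modulate_deriv[OF this, of z]
  show "(modulate z (\<lambda>t. z * g t + g' t) has_vector_derivative
      modulate z (\<lambda>t. z\<^sup>2 * g t + 2 * z * g' t + g'' t) t) (at t)"
    by (simp add: modulate_def algebra_simps power2_eq_square)
qed

lemma continuous_modulate: "continuous_on UNIV g \<Longrightarrow> continuous_on UNIV (modulate z g)"
  unfolding modulate_def[abs_def] by (intro continuous_intros)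

lemma has_vector_derivative_UNIV_continuous:
  "(\<And>t. (g has_vector_derivative g' t) (at t)) \<Longrightarrow> continuous_on A g"
  by (meson continuous_at_imp_continuous_on has_vector_derivative_continuous)

text \<open>Green's first identity, which defines the normal derivative, is tested with
  \<open>A(x\<^sub>1) B(x\<^sub>2)\<close>. A further integration by parts moves the derivatives of
  \<open>u\<close> to the test function; as \<open>u\<close> has zero trace in the sense of
  \<open>parts\<close>, it leaves no boundary term. In the result only values of \<open>u\<close> occur,
  no derivatives.\<close>

lemma green_second_identity:
  fixes f :: "real \<Rightarrow> real" and k :: complex
  assumes f: "continuous_on UNIV f"
  defines "S \<equiv> Omega_plus f" and "\<sigma> \<equiv> arclength f"
  assumes hnd: "has_normal_derivative S \<sigma> u g"
    and lap: "\<And>x. x \<in> S \<Longrightarrow> laplacian u x = - k * u x"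
    and A: "\<And>t. (A has_vector_derivative A1 t) (at t)" "\<And>t. (A1 has_vector_derivative A2 t) (at t)" "continuous_on UNIV A2"
    and B: "\<And>t. (B has_vector_derivative B1 t) (at t)" "\<And>t. (B1 has_vector_derivative B2 t) (at t)" "continuous_on UNIV B2"
    and supp: "\<And>t. \<bar>t\<bar> > p \<Longrightarrow> A t = 0" "\<And>t. \<bar>t\<bar> > p \<Longrightarrow> A1 t = 0" "\<And>t. \<bar>t\<bar> > p \<Longrightarrow> A2 t = 0"
      "\<And>t. \<bar>t\<bar> > q \<Longrightarrow> B t = 0" "\<And>t. \<bar>t\<bar> > q \<Longrightarrow> B1 t = 0" "\<And>t. \<bar>t\<bar> > q \<Longrightarrow> B2 t = 0"
    and parts: "parts_defect S (1,0) u (tensor A1 B) = 0" "parts_defect S (0,1) u (tensor A B1) = 0"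
  shows "(LINT x:S|lborel. u x * (tensor A2 B x + tensor A B2 x + k * tensor A B x)) = (LINT x|\<sigma>. tensor A B x * g x)"
proof -
  let ?I = "\<lambda>x. partial (1,0) u x * tensor A1 B x + partial (0,1) u x * tensor A B1 x - k * (u x * tensor A B x)"
  let ?J = "\<lambda>x. (\<Sum>i\<in>Basis. weak_partial S i u x * partial i (tensor A B) x) + tensor A B x * laplacian u x"
  have S: "open S" unfolding S_def by (rule open_Omega_plus)
  have u: "C1_on S u" "u \<in> H1_loc S" using hnd by (auto simp: has_normal_derivative_def C2_on_def)
  note uL = H1_loc_imp_L2_loc[OF S u]
  have uL1: "partial (1,0) u \<in> L2_loc S" and uL2: "partial (0,1) u \<in> L2_loc S"
    by (auto intro: uL(2) simp: Basis_plane)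
  have cA: "continuous_on UNIV A" "continuous_on UNIV A1" and cB: "continuous_on UNIV B" "continuous_on UNIV B1"
    using has_vector_derivative_UNIV_continuous[OF A(1)] has_vector_derivative_UNIV_continuous[OF A(2)]
      has_vector_derivative_UNIV_continuous[OF B(1)] has_vector_derivative_UNIV_continuous[OF B(2)] by auto
  have i: "set_integrable lborel S (\<lambda>x. w x * tensor G H x)"
    if "w \<in> L2_loc S" "continuous_on UNIV G" "continuous_on UNIV H"
      "\<And>t. \<bar>t\<bar> > p \<Longrightarrow> G t = 0" "\<And>t. \<bar>t\<bar> > q \<Longrightarrow> H t = 0" for w G H
  proof (rule L2_loc_mult_integrable[OF S that(1) continuous_on_tensor[OF that(2,3)]])
    fix x :: "real \<times> real" assume "norm x > p + q"
    then show "tensor G H x = 0"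
      using tensor_support[of G p H q x] that(4,5) by (meson not_le)
  qed
  have C1: "C1_on UNIV (tensor A B)" by (rule C1_on_tensor[OF A(1) B(1) cA(2) cB(2)])
  have "tensor A B \<in> test_functions UNIV"
    unfolding test_functions_UNIV_iff using C1 tensor_support[of A p B q] supp(1,4) by (meson not_le)
  then have "(LINT x:S|lborel. ?J x)
      = - (LINT x|\<sigma>. tensor A B x * g x)"
    using hnd by (auto simp: has_normal_derivative_def)
  also have "(LINT x:S|lborel. ?J x)
      = (LINT x:S|lborel. ?I x)"
  proof -
    have wm: "(\<lambda>x. indicator S x *\<^sub>R weak_partial S i u x) \<in> borel_measurable borel" if "i \<in> Basis" for i
    proof (rule loc_integrable_on_measurable[OF S])
      have "has_weak_partial S i u (weak_partial S i u)"
        unfolding weak_partial_def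
        by (rule someI[where P = "has_weak_partial S i u", OF has_weak_partial_classical[OF S u(1) that]])
      then show "loc_integrable_on S (weak_partial S i u)" by (simp add: has_weak_partial_def)
    qed
    have tm: "tensor G H \<in> borel_measurable borel" if "continuous_on UNIV G" "continuous_on UNIV H" for G H
      by (rule borel_measurable_continuous_onI[OF continuous_on_tensor[OF that]])
    have um: "(\<lambda>x. indicator S x *\<^sub>R u x) \<in> borel_measurable borel"
      using S C1_on_continuous_on[OF u(1)] by (intro borel_measurable_continuous_on_indicator) auto
    have i0: "integrable lborel (\<lambda>x. indicator S x *\<^sub>R (?I x))"
      using i[OF uL1 cA(2) cB(1) supp(2,4)] i[OF uL2 cA(1) cB(2) supp(1,5)] i[OF uL(1) cA(1) cB(1) supp(1,4)]
      unfolding set_integrable_def[symmetric]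
      by (intro set_integral_diff(1) set_integral_add(1) set_integrable_mult_right)
    let ?W = "\<lambda>x. (indicator S x *\<^sub>R weak_partial S (1,0) u x) * tensor A1 B x
        + (indicator S x *\<^sub>R weak_partial S (0,1) u x) * tensor A B1 x - k * ((indicator S x *\<^sub>R u x) * tensor A B x)"
    have "(LINT x:S|lborel. ?J x)
      = (LINT x|lborel. ?W x)"
      unfolding set_lebesgue_integral_def
      by (intro Bochner_Integration.integral_cong)
        (auto simp: sum_Basis_plane partial_tensor[OF A(1) B(1)] lap indicator_def)
    also have "\<dots> = (LINT x|lborel. indicator S x *\<^sub>R (?I x))"
    proof (rule integral_cong_AE)
      show "?W \<in> borel_measurable lborel"
        using wm um tm cA cB by (intro borel_measurable_diff borel_measurable_add borel_measurable_times borel_measurable_const) (auto simp: Basis_plane)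
      show "AE x in lborel. ?W x = indicator S x *\<^sub>R (?I x)"
      proof -
        have "AE x in lborel. x \<in> S \<longrightarrow> weak_partial S (1,0) u x = partial (1,0) u x"
          "AE x in lborel. x \<in> S \<longrightarrow> weak_partial S (0,1) u x = partial (0,1) u x"
          by (intro weak_partial_AE[OF S u(1)]; simp add: Basis_plane)+
        then show ?thesis by eventually_elim (auto simp: indicator_def)
      qed
    qed (rule borel_measurable_integrable[OF i0])
    finally show ?thesis by (simp add: set_lebesgue_integral_def)
  qed
  also have "\<dots> = (LINT x:S|lborel. partial (1,0) u x * tensor A1 B x) + (LINT x:S|lborel. partial (0,1) u x * tensor A B1 x)
      - k * (LINT x:S|lborel. u x * tensor A B x)"
    using i[OF uL1 cA(2) cB(1) supp(2,4)] i[OF uL2 cA(1) cB(2) supp(1,5)] i[OF uL(1) cA(1) cB(1) supp(1,4)]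
    by (simp add: set_integral_diff set_integral_add set_integrable_mult_right)
  also have "(LINT x:S|lborel. partial (1,0) u x * tensor A1 B x) = - (LINT x:S|lborel. u x * tensor A2 B x)"
    using parts(1) i[OF uL1 cA(2) cB(1) supp(2,4)] i[OF uL(1) A(3) cB(1) supp(3,4)]
    by (simp add: parts_defect_def partial_tensor[OF A(2) B(1)] set_integral_add eq_neg_iff_add_eq_0)
  also have "(LINT x:S|lborel. partial (0,1) u x * tensor A B1 x) = - (LINT x:S|lborel. u x * tensor A B2 x)"
    using parts(2) i[OF uL2 cA(1) cB(2) supp(1,5)] i[OF uL(1) cA(1) B(3) supp(1,6)]
    by (simp add: parts_defect_def partial_tensor[OF A(1) B(2)] set_integral_add eq_neg_iff_add_eq_0)
  finally have "(LINT x:S|lborel. u x * tensor A2 B x) + (LINT x:S|lborel. u x * tensor A B2 x)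
      + k * (LINT x:S|lborel. u x * tensor A B x) = (LINT x|\<sigma>. tensor A B x * g x)"
    by (simp add: algebra_simps neg_eq_iff_add_eq_0)
  moreover have "(LINT x:S|lborel. u x * (tensor A2 B x + tensor A B2 x + k * tensor A B x))
      = (LINT x:S|lborel. u x * tensor A2 B x + u x * tensor A B2 x + k * (u x * tensor A B x))"
    by (simp add: algebra_simps)
  ultimately show ?thesis
    using i[OF uL(1) A(3) cB(1) supp(3,4)] i[OF uL(1) cA(1) B(3) supp(1,6)] i[OF uL(1) cA(1) cB(1) supp(1,4)]
    by (simp add: set_integral_add set_integrable_mult_right)
qed

lemma has_vector_derivative_complex_of_real:
  assumes "(r has_real_derivative r') (at t)"
  shows "((\<lambda>t. complex_of_real (r t)) has_vector_derivative of_real r') (at t)"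
  using assms by (intro has_vector_derivative_of_real) (simp add: has_real_derivative_iff_has_vector_derivative)

section \<open>Cut-offs for the period cell\<close>

text \<open>Equal to \<open>1\<close> for \<open>\<bar>t\<bar> \<le> C + 1\<close> and to
  \<open>0\<close> for \<open>\<bar>t\<bar> \<ge> C + 2\<close>. When \<open>\<bar>f\<bar> \<le>
  C\<close>, it is \<open>1\<close> near the boundary, and its only transition inside the domain lies
  where the Rayleigh expansion is valid.\<close>

definition hat :: "real \<Rightarrow> real \<Rightarrow> complex" where
  "hat C t = of_real (step (t + C + 2) * step (C + 2 - t))"

definition hat' :: "real \<Rightarrow> real \<Rightarrow> complex" where
  "hat' C t = of_real (step' (t + C + 2) * step (C + 2 - t) - step (t + C + 2) * step' (C + 2 - t))"

definition hat'' :: "real \<Rightarrow> real \<Rightarrow> complex" where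
  "hat'' C t = of_real (step'' (t + C + 2) * step (C + 2 - t) - 2 * step' (t + C + 2) * step' (C + 2 - t)
     + step (t + C + 2) * step'' (C + 2 - t))"

lemma hat_deriv: "(hat C has_vector_derivative hat' C t) (at t)"
  unfolding hat_def[abs_def] hat'_def
  by (rule has_vector_derivative_complex_of_real)
     (auto intro!: derivative_eq_intros DERIV_chain2[OF step_deriv])

lemma hat'_deriv: "(hat' C has_vector_derivative hat'' C t) (at t)"
  unfolding hat'_def[abs_def] hat''_def
  by (rule has_vector_derivative_complex_of_real)
     (auto intro!: derivative_eq_intros DERIV_chain2[OF step_deriv] DERIV_chain2[OF step'_deriv] simp: algebra_simps)

lemma continuous_hat: "continuous_on A (hat C)" "continuous_on A (hat' C)" "continuous_on A (hat'' C)"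
  unfolding hat_def[abs_def] hat'_def[abs_def] hat''_def[abs_def] by (intro continuous_intros)+

lemma hat_eq_0:
  assumes "\<bar>t\<bar> \<ge> C + 2"
  shows "hat C t = 0" "hat' C t = 0" "hat'' C t = 0"
  using assms by (cases "t \<ge> 0"; auto simp: hat_def hat'_def hat''_def step_eq_0 step'_eq_0 step''_eq_0)+

lemma hat_plateau:
  assumes "\<bar>t\<bar> \<le> C + 1"
  shows "hat C t = 1" "hat' C t = 0" "hat'' C t = 0"
proof -
  have "t + C + 2 \<ge> 1" "C + 2 - t \<ge> 1" using assms by linarith+
  then show "hat C t = 1" "hat' C t = 0" "hat'' C t = 0"
    by (simp_all add: hat_def hat'_def hat''_def step_eq_1 step'_eq_0 step''_eq_0)
qed

lemma hat_norm_le: "norm (hat C t) \<le> 1"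
  unfolding hat_def norm_of_real using step_bounds mult_le_one[OF step_bounds(2) step_bounds] by simp

text \<open>As \<open>p\<close> grows, a \<open>C\<^sup>2\<close> approximation of the indicator
  function of \<open>{0<..L}\<close>. Its derivatives are differences of a function and its translate by
  the period \<open>L\<close>, hence orthogonal to periodic functions.\<close>

definition plateau :: "real \<Rightarrow> real \<Rightarrow> real \<Rightarrow> complex" where
  "plateau L p t = of_real (step (p * t)) - of_real (step (p * (t - L)))"

definition plateau' :: "real \<Rightarrow> real \<Rightarrow> real \<Rightarrow> complex" where
  "plateau' L p t = of_real (p * step' (p * t)) - of_real (p * step' (p * (t - L)))"

definition plateau'' :: "real \<Rightarrow> real \<Rightarrow> real \<Rightarrow> complex" where
  "plateau'' L p t = of_real (p\<^sup>2 * step'' (p * t)) - of_real (p\<^sup>2 * step'' (p * (t - L)))"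

lemma step_affine_deriv:
  "((\<lambda>t. step (p * (t - s))) has_real_derivative p * step' (p * (t - s))) (at t)"
  "((\<lambda>t. p * step' (p * (t - s))) has_real_derivative p\<^sup>2 * step'' (p * (t - s))) (at t)"
proof -
  have *: "((\<lambda>t. p * (t - s)) has_real_derivative p) (at t)" by (auto intro!: derivative_eq_intros)
  from DERIV_chain2[OF step_deriv *]
  show "((\<lambda>t. step (p * (t - s))) has_real_derivative p * step' (p * (t - s))) (at t)"
    by (simp add: mult.commute)
  from DERIV_cmult[OF DERIV_chain2[OF step'_deriv *], of p]
  show "((\<lambda>t. p * step' (p * (t - s))) has_real_derivative p\<^sup>2 * step'' (p * (t - s))) (at t)"
    by (simp add: power2_eq_square mult_ac)
qed

lemma plateau_deriv: "(plateau L p has_vector_derivative plateau' L p t) (at t)"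
  unfolding plateau_def[abs_def] plateau'_def
  using step_affine_deriv(1)[of p 0 t] step_affine_deriv(1)[of p L t]
  by (intro has_vector_derivative_diff has_vector_derivative_complex_of_real) simp_all

lemma plateau'_deriv: "(plateau' L p has_vector_derivative plateau'' L p t) (at t)"
  unfolding plateau'_def[abs_def] plateau''_def
  using step_affine_deriv(2)[of p 0 t] step_affine_deriv(2)[of p L t]
  by (intro has_vector_derivative_diff has_vector_derivative_complex_of_real) simp_all

lemma continuous_plateau:
  "continuous_on A (plateau L p)" "continuous_on A (plateau' L p)" "continuous_on A (plateau'' L p)"
  unfolding plateau_def[abs_def] plateau'_def[abs_def] plateau''_def[abs_def] by (intro continuous_intros)+

lemma plateau_eq_0:
  assumes "L > 0" "p * L \<ge> 1" "t < 0 \<or> t > 2 * L"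
  shows "plateau L p t = 0" "plateau' L p t = 0" "plateau'' L p t = 0"
proof -
  have p: "p > 0" using assms(1,2) by (metis less_le_trans mult_le_0_iff not_le zero_less_one order_less_imp_le)
  from assms(3) consider "p * t \<le> 0" "p * (t - L) \<le> 0" | "p * t \<ge> 1" "p * (t - L) \<ge> 1"
  proof
    assume "t < 0"
    then show ?thesis using p assms(1) that(1) by (simp add: mult_nonneg_nonpos)
  next
    assume t: "t > 2 * L"
    have "p * L \<le> p * t" "p * L \<le> p * (t - L)" using p t assms(1) by (intro mult_left_mono; simp)+
    then show ?thesis using assms(2) that(2) by linarith
  qed
  then show "plateau L p t = 0" "plateau' L p t = 0" "plateau'' L p t = 0"
    by (cases; simp add: plateau_def plateau'_def plateau''_def step_eq_0 step_eq_1 step'_eq_0 step''_eq_0)+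
qed

lemma plateau_norm_le: "norm (plateau L p t) \<le> 1"
proof -
  have "\<bar>step (p * t) - step (p * (t - L))\<bar> \<le> 1"
    using step_bounds[of "p * t"] step_bounds[of "p * (t - L)"] by linarith
  then show ?thesis unfolding plateau_def by (metis norm_of_real of_real_diff)
qed

lemma plateau_tendsto:
  assumes L: "L > 0"
  shows "(\<lambda>j. plateau L (real (Suc j) / L) t) \<longlonglongrightarrow> indicator {0<..L} t"
proof -
  have st: "(\<lambda>j. complex_of_real (step (real (Suc j) / L * s))) \<longlonglongrightarrow> indicator {0<..} s" for s
  proof (cases "s > 0")
    case True
    have "eventually (\<lambda>j. real (Suc j) / L * s \<ge> 1) sequentially"
      using True L by real_asymp
    then have "eventually (\<lambda>j. complex_of_real (step (real (Suc j) / L * s)) = 1) sequentially"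
      by eventually_elim (simp add: step_eq_1)
    with True show ?thesis by (auto intro: tendsto_eventually)
  next
    case False
    then have "real (Suc j) / L * s \<le> 0" for j using L by (intro mult_nonneg_nonpos) auto
    with False show ?thesis by (simp add: step_eq_0)
  qed
  have "(\<lambda>j. plateau L (real (Suc j) / L) t) \<longlonglongrightarrow> indicator {0<..} t - indicator {0<..} (t - L)"
    unfolding plateau_def by (intro tendsto_diff st)
  also have "indicator {0<..} t - indicator {0<..} (t - L) = (indicator {0<..L} t :: complex)"
    using L by (auto simp: indicator_def)
  finally show ?thesis .
qed

section \<open>Rayleigh expansions\<close>

lemma integral_exp_period:
  fixes m :: int
  assumes L: "L > 0"
  shows "((\<lambda>t. exp (2 * of_real pi * \<i> * of_int m / of_real L * of_real t)) has_integral (if m = 0 then of_real L else 0)) {0..L}"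
proof (cases "m = 0")
  case True
  with has_integral_const_real[of "1::complex" 0 L] L show ?thesis by (simp add: scaleR_conv_of_real)
next
  case False
  define z where "z = 2 * of_real pi * \<i> * of_int m / of_real L"
  have z: "z \<noteq> 0" using False L by (simp add: z_def)
  have "((\<lambda>t. exp (z * of_real t)) has_integral exp (z * of_real L) / z - exp (z * of_real 0) / z) {0..L}"
  proof (rule fundamental_theorem_of_calculus)
    fix t assume "t \<in> {0..L}"
    have "((\<lambda>t. exp (z * of_real t) / z) has_vector_derivative (z * exp (z * of_real t)) / z) (at t)"
      by (intro has_vector_derivative_divide exp_deriv)
    then show "((\<lambda>t. exp (z * of_real t) / z) has_vector_derivative exp (z * of_real t)) (at t within {0..L})"
      using z by (auto intro: has_vector_derivative_at_within)
  qed (use L in simp)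
  moreover have "exp (z * of_real L) = 1"
  proof -
    have "z * of_real L = 2 * of_real pi * \<i> * of_int m" using L by (simp add: z_def)
    then show ?thesis using exp_integer_2pi[of "of_int m"] by (simp add: mult_ac)
  qed
  ultimately show ?thesis using False by (simp add: z_def)
qed

text \<open>At a fixed height a Rayleigh expansion converges absolutely, hence uniformly over a period,
  and may be integrated termwise.\<close>

lemma rayleigh_coefficient:
  fixes d :: "int \<Rightarrow> complex" and n :: int
  assumes L: "L > 0"
    and sum: "\<And>t. t \<in> {0..L} \<Longrightarrow>
      ((\<lambda>m. d m * exp (2 * of_real pi * \<i> * of_int (m - n) / of_real L * of_real t)) has_sum g t) UNIV"
  shows "(g has_integral of_real L * d n) {0..L}" and "continuous_on {0..L} g"
proof -
  define e where "e = (\<lambda>m (t::real). exp (2 * of_real pi * \<i> * of_int (m - n) / of_real L * of_real t))"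
  have "(d has_sum g 0) UNIV" using sum[of 0] L by simp
  then have "d summable_on UNIV" by (auto simp: summable_on_def)
  then have abs: "(\<lambda>m. norm (d m)) summable_on UNIV"
    by (simp add: summable_on_iff_abs_summable_on_complex)
  have norm_e: "norm (e m t) = 1" for m t
  proof -
    have "2 * of_real pi * \<i> * of_int (m - n) / of_real L * of_real t = \<i> * of_real (2 * pi * of_int (m - n) / L * t)"
      by simp
    then show ?thesis unfolding e_def by (metis norm_exp_i_times)
  qed
  have unif: "uniform_limit {0..L} (\<lambda>X t. \<Sum>m\<in>X. d m * e m t) g (finite_subsets_at_top UNIV)"
    by (rule Weierstrass_m_test_general'[OF _ _ abs]) (use sum in \<open>auto simp: norm_mult norm_e e_def\<close>)
  have ce: "continuous_on {0..L} (e m)" for m unfolding e_def by (intro continuous_intros)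
  have cX: "continuous_on {0..L} (\<lambda>t. \<Sum>m\<in>X. d m * e m t)" for X by (intro continuous_intros ce)
  have nb: "finite_subsets_at_top (UNIV :: int set) \<noteq> bot" by simp
  show cg: "continuous_on {0..L} g"
    by (rule uniform_limit_theorem[OF _ unif nb]) (use cX in simp)
  obtain I J where I: "\<And>X. ((\<lambda>t. \<Sum>m\<in>X. d m * e m t) has_integral I X) {0..L}"
      and J: "(g has_integral J) {0..L}" "(I \<longlongrightarrow> J) (finite_subsets_at_top UNIV)"
    by (rule uniform_limit_integral[OF unif cX nb]) (rule that)
  have single: "((\<lambda>t. d m * e m t) has_integral (if m = n then of_real L * d n else 0)) {0..L}" for m
    using has_integral_mult_right[OF integral_exp_period[OF L, of "m - n"], of "d m"]
    by (cases "m = n") (simp_all add: e_def mult.commute)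
  have I_eq: "I X = of_real L * d n" if "finite X \<and> n \<in> X" for X
  proof -
    have "((\<lambda>t. \<Sum>m\<in>X. d m * e m t) has_integral (\<Sum>m\<in>X. if m = n then of_real L * d n else 0)) {0..L}"
      using that by (intro has_integral_sum single) simp
    then have "I X = (\<Sum>m\<in>X. if m = n then of_real L * d n else 0)"
      by (rule has_integral_unique[OF I])
    with that show ?thesis by simp
  qed
  have "\<forall>\<^sub>F X in finite_subsets_at_top UNIV. finite X \<and> n \<in> X"
    by (rule eventually_finite_subsets_at_top[THEN iffD2]) (auto intro!: exI[of _ "{n}"])
  then have "\<forall>\<^sub>F X in finite_subsets_at_top UNIV. I X = of_real L * d n"
    by (rule eventually_mono) (rule I_eq)
  then have "(I \<longlongrightarrow> of_real L * d n) (finite_subsets_at_top UNIV)" by (rule tendsto_eventually)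
  then have "J = of_real L * d n" using J(2) tendsto_unique[OF nb] by blast
  with J show "(g has_integral of_real L * d n) {0..L}" by simp
qed

section \<open>From the boundary to a strip above it\<close>

lemma Omega_plus_translate:
  assumes f: "continuous_on UNIV f" and per: "\<And>t. f (t + L) = f t"
  shows "x + (L, 0) \<in> Omega_plus f \<longleftrightarrow> x \<in> Omega_plus f"
  by (simp add: Omega_plus_eq[OF f] per)

text \<open>Green's identity with the plane wave \<open>W\<close>, cut off to a neighbourhood of one
  period cell. As \<open>W\<close> and \<open>u\<close> solve the same Helmholtz equation, only terms
  with derivatives of the cut-offs remain. Those of the horizontal cut-off cancel since \<open>u
  W\<close> is periodic; those of the vertical one live far above the boundary. Finally the horizontal
  cut-off is sharpened to the cell.\<close>

lemma boundary_moment_eq_cutoff_integral: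
  fixes f :: "real \<Rightarrow> real" and a b k c :: complex
  assumes f: "continuous_on UNIV f" and per: "\<And>t. f (t + L) = f t" and L: "L > 0" and C: "\<And>t. \<bar>f t\<bar> \<le> C"
  defines "S \<equiv> Omega_plus f" and "\<sigma> \<equiv> arclength f"
  assumes hnd: "has_normal_derivative S \<sigma> u g"
    and lap: "\<And>x. x \<in> S \<Longrightarrow> laplacian u x = - k * u x"
    and ab: "a\<^sup>2 + b\<^sup>2 + k = 0"
    and qp: "\<And>x. x \<in> S \<Longrightarrow> u (x + (L, 0)) = c * u x" and ac: "exp (a * of_real L) * c = 1"
    and parts: "\<And>A A' B B' e. (\<And>t. (A has_vector_derivative A' t) (at t)) \<Longrightarrow> continuous_on UNIV A' \<Longrightarrow>
      (\<And>t. (B has_vector_derivative B' t) (at t)) \<Longrightarrow> continuous_on UNIV B' \<Longrightarrow>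
      (\<And>t. A t \<noteq> 0 \<Longrightarrow> 0 \<le> t \<and> t \<le> 2 * L) \<Longrightarrow> (\<And>t. B t \<noteq> 0 \<Longrightarrow> \<bar>t\<bar> \<le> C + 2) \<Longrightarrow> e \<in> Basis \<Longrightarrow>
      parts_defect S e u (tensor A B) = 0"
  defines "W \<equiv> tensor (\<lambda>t. exp (a * of_real t)) (\<lambda>t. exp (b * of_real t))"
    and "\<zeta> \<equiv> \<lambda>y. 2 * b * hat' C y + hat'' C y"
  shows "(LINT x:S|lborel. u x * (W x * indicator {0<..L} (fst x) * \<zeta> (snd x)))
    = (LINT x|arclength_cell f L. W x * g x)"
proof -
  have C0: "C \<ge> 0" using C[of 0] by simp
  have S: "open S" unfolding S_def by (rule open_Omega_plus)
  have ST: "x + (L, 0) \<in> S \<longleftrightarrow> x \<in> S" for x unfolding S_def by (rule Omega_plus_translate[OF f per])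
  have u: "C1_on S u" "u \<in> H1_loc S" using hnd by (auto simp: has_normal_derivative_def C2_on_def)
  note uL = H1_loc_imp_L2_loc(1)[OF S u]
  have um: "(\<lambda>x. indicator S x *\<^sub>R u x) \<in> borel_measurable borel"
    using S C1_on_continuous_on[OF u(1)] by (intro borel_measurable_continuous_on_indicator) auto
  define R where "R = 2 * L + (C + 2)"
  have tens: "tensor G H x = 0" if "\<And>t. t < 0 \<or> t > 2 * L \<Longrightarrow> G t = 0" "\<And>t. \<bar>t\<bar> \<ge> C + 2 \<Longrightarrow> H t = 0" "norm x > R" for G H x
    using tensor_support[of G "2 * L" H "C + 2" x] that unfolding R_def
    by (smt (verit, ccfv_threshold))
  have cW: "continuous_on UNIV W" unfolding W_def by (intro continuous_on_tensor continuous_intros)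
  have c\<zeta>: "continuous_on UNIV \<zeta>" unfolding \<zeta>_def by (intro continuous_intros continuous_hat)
  have mfst: "(\<lambda>x::real \<times> real. G (fst x)) \<in> borel_measurable borel" if "continuous_on UNIV G" for G :: "real \<Rightarrow> complex"
    by (intro borel_measurable_continuous_onI continuous_on_compose2[OF that] continuous_intros) auto
  have msnd: "(\<lambda>x::real \<times> real. G (snd x)) \<in> borel_measurable borel" if "continuous_on UNIV G" for G :: "real \<Rightarrow> complex"
    by (intro borel_measurable_continuous_onI continuous_on_compose2[OF that] continuous_intros) auto
  have mW: "W \<in> borel_measurable borel" by (rule borel_measurable_continuous_onI[OF cW])
  have mI: "(\<lambda>x::real \<times> real. indicator {0<..L} (fst x) :: complex) \<in> borel_measurable borel"
  proof -
    have "{x::real \<times> real. 0 < fst x \<and> fst x \<le> L} = {x. 0 < fst x} \<inter> {x. fst x \<le> L}" by auto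
    moreover have "{x::real \<times> real. 0 < fst x} \<in> sets borel" "{x::real \<times> real. fst x \<le> L} \<in> sets borel"
      by (rule borel_open borel_closed, intro open_Collect_less closed_Collect_le continuous_intros)+
    ultimately have "{x::real \<times> real. 0 < fst x \<and> fst x \<le> L} \<in> sets borel" by auto
    then have "(indicator {x::real \<times> real. 0 < fst x \<and> fst x \<le> L} :: _ \<Rightarrow> complex) \<in> borel_measurable borel"
      by simp
    also have "(indicator {x::real \<times> real. 0 < fst x \<and> fst x \<le> L} :: _ \<Rightarrow> complex) = (\<lambda>x. indicator {0<..L} (fst x))"
      by (auto simp: indicator_def fun_eq_iff)
    finally show ?thesis .
  qed
  let ?p = "\<lambda>j. real (Suc j) / L"
  have p1: "?p j * L \<ge> 1" for j using L by simp
  define ch where "ch j = plateau L (?p j)" for j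
  have chi0: "ch j t = 0" if "t < 0 \<or> t > 2 * L" for j t
    unfolding ch_def by (rule plateau_eq_0(1)[OF L p1 that])
  let ?A = "\<lambda>j. modulate a (ch j)" and ?B = "modulate b (hat C)"
  let ?m = "\<lambda>j x. W x * ch j (fst x) * \<zeta> (snd x)" and ?m' = "\<lambda>x. W x * indicator {0<..L} (fst x) * \<zeta> (snd x)"
  let ?h = "\<lambda>j x. W x * ch j (fst x) * hat C (snd x)" and ?h' = "\<lambda>x. W x * indicator {0<..L} (fst x) * hat C (snd x)"
  let ?Q = "cbox (0, - (C + 2)) (2 * L, C + 2)" and ?u = "\<lambda>x. indicator (S \<inter> ball 0 (R + 1)) x *\<^sub>R u x"
  \<comment> \<open>Green's identity for each horizontal cut-off\<close>
  have green: "(LINT x:S|lborel. u x * (?m j x)) = (LINT x|\<sigma>. tensor (?A j) ?B x * g x)" for j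
  proof -
    define p where "p = ?p j"
    have pL: "p * L \<ge> 1" unfolding p_def by (rule p1)
    have p: "p > 0" using L by (simp add: p_def)
    let ?X0 = "plateau L p" and ?X1 = "plateau' L p" and ?X2 = "plateau'' L p"
    let ?A1 = "modulate a (\<lambda>t. a * ?X0 t + ?X1 t)" and ?A2 = "modulate a (\<lambda>t. a\<^sup>2 * ?X0 t + 2 * a * ?X1 t + ?X2 t)"
    let ?B1 = "modulate b (\<lambda>t. b * hat C t + hat' C t)" and ?B2 = "modulate b (\<lambda>t. b\<^sup>2 * hat C t + 2 * b * hat' C t + hat'' C t)"
    have A: "\<And>t. (modulate a ?X0 has_vector_derivative ?A1 t) (at t)" "\<And>t. (?A1 has_vector_derivative ?A2 t) (at t)"
      by (rule modulate_second_deriv[OF plateau_deriv plateau'_deriv])+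
    have B: "\<And>t. (?B has_vector_derivative ?B1 t) (at t)" "\<And>t. (?B1 has_vector_derivative ?B2 t) (at t)"
      by (rule modulate_second_deriv[OF hat_deriv hat'_deriv])+
    have cA: "continuous_on UNIV ?A1" "continuous_on UNIV ?A2" and cB: "continuous_on UNIV ?B1" "continuous_on UNIV ?B2"
      by (intro continuous_modulate continuous_intros continuous_plateau continuous_hat)+
    note X0 = plateau_eq_0[OF L pL] and H0 = hat_eq_0[of C]
    have zA: "modulate a ?X0 t = 0" "?A1 t = 0" "?A2 t = 0" if "t < 0 \<or> t > 2 * L" for t
      using X0[OF that] by (simp_all add: modulate_def)
    have zB: "?B t = 0" "?B1 t = 0" "?B2 t = 0" if "\<bar>t\<bar> \<ge> C + 2" for t
      using H0[OF that] by (simp_all add: modulate_def)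
    have far: "t < 0 \<or> t > 2 * L" if "\<bar>t\<bar> > 2 * L" for t using that by linarith
    have parts1: "parts_defect S (1,0) u (tensor ?A1 ?B) = 0"
      by (rule parts[OF A(2) cA(2) B(1) cB(1)]) (use zA(2) zB(1) in \<open>force simp: Basis_plane not_le\<close>)+
    have parts2: "parts_defect S (0,1) u (tensor (modulate a ?X0) ?B1) = 0"
      by (rule parts[OF A(1) cA(1) B(2) cB(2)]) (use zA(1) zB(2) in \<open>force simp: Basis_plane not_le\<close>)+
    have G: "(LINT x:S|lborel. u x * (tensor ?A2 ?B x + tensor (modulate a ?X0) ?B2 x + k * tensor (modulate a ?X0) ?B x))
        = (LINT x|\<sigma>. tensor (modulate a ?X0) ?B x * g x)"
      unfolding S_def \<sigma>_def
      by (rule green_second_identity[OF f hnd[unfolded S_def \<sigma>_def] lap[unfolded S_def] A cA(2) B cB(2), of "2 * L" "C + 2"])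
        (use zA zB far parts1 parts2 in \<open>auto simp: S_def\<close>)
    \<comment> \<open>The derivatives of the horizontal cut-off enter as \<open>q t - q (t - L)\<close>.\<close>
    define q where "q t = 2 * a * of_real (p * step' (p * t)) + of_real (p\<^sup>2 * step'' (p * t))" for t
    have q0: "q t = 0" if "t \<le> 0 \<or> t \<ge> L" for t
    proof -
      have "p * t \<le> 0 \<or> p * t \<ge> 1"
        using that
      proof
        assume "t \<ge> L"
        then have "p * L \<le> p * t" using p by simp
        with pL show ?thesis by linarith
      qed (use p in \<open>simp add: mult_nonneg_nonpos\<close>)
      then show ?thesis by (simp add: q_def step'_eq_0 step''_eq_0)
    qed
    have cq: "continuous_on UNIV q" "continuous_on UNIV (\<lambda>t. q (t - L))"
      unfolding q_def by (intro continuous_intros)+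
    let ?F1 = "tensor (\<lambda>t. exp (a * of_real t) * q t) ?B"
    let ?F2 = "tensor (\<lambda>t. exp (a * of_real t) * q (t - L)) ?B"
    let ?F3 = "?m j"
    have chp: "ch j = ?X0" by (simp add: ch_def p_def)
    have F3: "?F3 x = tensor (modulate a ?X0) (modulate b \<zeta>) x" for x
      by (simp add: W_def tensor_def modulate_def chp mult_ac)
    have split: "tensor ?A2 ?B x + tensor (modulate a ?X0) ?B2 x + k * tensor (modulate a ?X0) ?B x
        = (?F1 x - ?F2 x) + ?F3 x" for x
    proof -
      have k: "k = - (a\<^sup>2) - b\<^sup>2" using ab add_eq_0_iff[of "a\<^sup>2 + b\<^sup>2" k] by simp
      have X: "2 * a * ?X1 t + ?X2 t = q t - q (t - L)" for t
        by (simp add: plateau'_def plateau''_def q_def algebra_simps)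
      have "tensor ?A2 ?B x + tensor (modulate a ?X0) ?B2 x + k * tensor (modulate a ?X0) ?B x
        = exp (a * of_real (fst x)) * exp (b * of_real (snd x)) *
          ((2 * a * ?X1 (fst x) + ?X2 (fst x)) * hat C (snd x) + ?X0 (fst x) * (2 * b * hat' C (snd x) + hat'' C (snd x)))"
        unfolding k by (simp add: tensor_def modulate_def algebra_simps)
      also have "\<dots> = (?F1 x - ?F2 x) + ?F3 x"
        unfolding X by (simp add: tensor_def modulate_def \<zeta>_def W_def chp algebra_simps)
      finally show ?thesis .
    qed
    have iT: "set_integrable lborel S (\<lambda>x. u x * tensor G H x)"
      if "continuous_on UNIV G" "continuous_on UNIV H" "\<And>t. t < 0 \<or> t > 2 * L \<Longrightarrow> G t = 0" "\<And>t. \<bar>t\<bar> \<ge> C + 2 \<Longrightarrow> H t = 0" for G H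
      by (rule L2_loc_mult_integrable[OF S uL continuous_on_tensor[OF that(1,2)], of R]) (rule tens[OF that(3,4)])
    have i1: "set_integrable lborel S (\<lambda>x. u x * ?F1 x)"
      by (rule iT) (use q0 zB L in \<open>auto intro!: continuous_intros cq continuous_modulate continuous_hat\<close>)
    have i2: "set_integrable lborel S (\<lambda>x. u x * ?F2 x)"
      by (rule iT) (use q0 zB L in \<open>auto intro!: continuous_intros cq continuous_modulate continuous_hat\<close>)
    have i3: "set_integrable lborel S (\<lambda>x. u x * ?F3 x)"
      unfolding F3
    proof (rule iT)
      show "continuous_on UNIV (modulate a ?X0)" by (rule continuous_modulate[OF continuous_plateau(1)])
      show "continuous_on UNIV (modulate b \<zeta>)" by (rule continuous_modulate[OF c\<zeta>])
    qed (use X0 H0 in \<open>auto simp: modulate_def \<zeta>_def\<close>)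
    have "(LINT x:S|lborel. u x * ?F2 x) = (LINT x:S|lborel. u x * ?F1 x)"
    proof -
      have "(LINT x:S|lborel. u x * ?F2 x) = (LINT x|lborel. indicator S (x + (L, 0)) *\<^sub>R (u (x + (L, 0)) * ?F2 (x + (L, 0))))"
        unfolding set_lebesgue_integral_def
        by (rule lborel_integral_translate[symmetric]) (use borel_measurable_integrable[OF i2[unfolded set_integrable_def]] in simp)
      also have "\<dots> = (LINT x|lborel. indicator S x *\<^sub>R (u x * ?F1 x))"
      proof (rule Bochner_Integration.integral_cong[OF refl])
        fix x
        show "indicator S (x + (L, 0)) *\<^sub>R (u (x + (L, 0)) * ?F2 (x + (L, 0))) = indicator S x *\<^sub>R (u x * ?F1 x)"
        proof (cases "x \<in> S")
          case True
          have "u (x + (L, 0)) * ?F2 (x + (L, 0)) = (exp (a * of_real L) * c) * (u x * ?F1 x)"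
            unfolding qp[OF True] by (simp add: tensor_def exp_add algebra_simps)
          then show ?thesis using True ST[of x] by (simp add: ac)
        qed (use ST[of x] in simp)
      qed
      finally show ?thesis by (simp add: set_lebesgue_integral_def)
    qed
    then have "(LINT x:S|lborel. u x * ((?F1 x - ?F2 x) + ?F3 x)) = (LINT x:S|lborel. u x * ?F3 x)"
      using i1 i2 i3 by (simp add: distrib_left right_diff_distrib set_integral_add set_integral_diff)
    with G show ?thesis unfolding split by (simp add: ch_def p_def)
  qed
  \<comment> \<open>Both sides converge as the horizontal cut-off sharpens.\<close>
  obtain K where K: "K \<ge> 0" "\<And>x. x \<in> ?Q \<Longrightarrow> norm (W x) * (norm (\<zeta> (snd x)) + 1) \<le> K"
  proof -
    have "continuous_on (?Q) (\<lambda>x. norm (W x) * (norm (\<zeta> (snd x)) + 1))"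
      by (intro continuous_intros continuous_on_subset[OF cW] continuous_on_compose2[OF c\<zeta>]) auto
    then have "bounded ((\<lambda>x. norm (W x) * (norm (\<zeta> (snd x)) + 1)) ` ?Q)"
      by (intro compact_imp_bounded compact_continuous_image compact_cbox)
    then obtain K where "K > 0" "\<And>x. x \<in> ?Q \<Longrightarrow> norm (norm (W x) * (norm (\<zeta> (snd x)) + 1)) \<le> K"
      unfolding bounded_pos by blast
    then show ?thesis by (intro that[of K]) (auto simp: abs_mult)
  qed
  have \<zeta>0: "\<zeta> y = 0" if "\<bar>y\<bar> \<ge> C + 2" for y using hat_eq_0[OF that] by (simp add: \<zeta>_def)
  have inbox: "x \<in> ?Q" if "0 \<le> fst x" "fst x \<le> 2 * L" "\<bar>snd x\<bar> < C + 2" for x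
    using that by (cases x) (auto simp: cbox_Pair_eq)
  have Klim: "norm (W x * \<eta> * \<xi>) \<le> K" if "x \<in> ?Q" "norm \<eta> \<le> 1" "norm \<xi> \<le> norm (\<zeta> (snd x)) + 1"
    for x \<eta> \<xi>
  proof -
    have "norm (W x * \<eta> * \<xi>) \<le> norm (W x) * 1 * (norm (\<zeta> (snd x)) + 1)"
      unfolding norm_mult using that by (intro mult_mono) auto
    with K(2)[OF that(1)] show ?thesis by simp
  qed
  have bd1: "norm (?m j x) \<le> K" "norm x > R \<Longrightarrow> ?m j x = 0" for j x
  proof -
    have "norm (ch j (fst x)) \<le> 1" unfolding ch_def by (rule plateau_norm_le)
    then show "norm (?m j x) \<le> K"
      using Klim[OF inbox[of x], of "ch j (fst x)" "\<zeta> (snd x)"] chi0[of "fst x" j] \<zeta>0[of "snd x"] K(1)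
      by (cases "0 \<le> fst x \<and> fst x \<le> 2 * L \<and> \<bar>snd x\<bar> < C + 2") auto
    show "?m j x = 0" if "norm x > R"
      using tens[of "ch j" \<zeta> x] chi0 \<zeta>0 that by (auto simp: tensor_def)
  qed
  have m1: "(\<lambda>x. ?m j x) \<in> borel_measurable borel" for j
    unfolding ch_def by (intro borel_measurable_times mW mfst msnd continuous_plateau c\<zeta>)
  note dom = L2_loc_dominated[OF S uL m1 bd1]
  have lim1: "(\<lambda>j. LINT x:S|lborel. u x * (?m j x))
      \<longlonglongrightarrow> (LINT x:S|lborel. u x * (?m' x))"
    unfolding set_lebesgue_integral_def
  proof (rule integral_dominated_convergence[where w = "\<lambda>x. K * norm (?u x)"])
    show "integrable lborel (\<lambda>x. K * norm (?u x))"
      using L2_loc_set_integrable[OF S uL] unfolding set_integrable_def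
      by (intro integrable_mult_right integrable_norm)
    show "(\<lambda>x. indicator S x *\<^sub>R (u x * (?m j x))) \<in> borel_measurable lborel" for j
      using dom(1) unfolding set_integrable_def by (rule borel_measurable_integrable)
    have "(\<lambda>x. (indicator S x *\<^sub>R u x) * (?m' x)) \<in> borel_measurable borel"
      by (intro borel_measurable_times um mW mI msnd c\<zeta>)
    then show "(\<lambda>x. indicator S x *\<^sub>R (u x * (?m' x))) \<in> borel_measurable lborel"
      by (simp add: mult_scaleR_left)
    show "AE x in lborel. (\<lambda>j. indicator S x *\<^sub>R (u x * (?m j x)))
        \<longlonglongrightarrow> indicator S x *\<^sub>R (u x * (?m' x))"
      unfolding ch_def by (intro AE_I2 tendsto_scaleR tendsto_mult tendsto_const plateau_tendsto[OF L])
    show "AE x in lborel. norm (indicator S x *\<^sub>R (u x * (?m j x)))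
        \<le> K * norm (?u x)" for j
      by (intro AE_I2 dom(2))
  qed
  have ig: "integrable \<sigma> (\<lambda>x. indicator (ball 0 (R + 1)) x *\<^sub>R g x)"
  proof -
    have "R + 1 > 0" using L C0 by (simp add: R_def)
    then show ?thesis using hnd by (simp add: has_normal_derivative_def set_integrable_def)
  qed
  have m\<sigma>: "h \<in> borel_measurable \<sigma>" if "h \<in> borel_measurable borel" for h :: "real \<times> real \<Rightarrow> complex"
    using that by (simp add: \<sigma>_def measurable_cong_sets[OF sets_arclength refl])
  have bd2: "norm (?h j x) \<le> K" "norm x > R \<Longrightarrow> ?h j x = 0" for j x
  proof -
    have "norm (ch j (fst x)) \<le> 1" unfolding ch_def by (rule plateau_norm_le)
    moreover have "norm (hat C (snd x)) \<le> norm (\<zeta> (snd x)) + 1" using hat_norm_le[of C "snd x"] by (simp add: add_increasing)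
    ultimately show "norm (?h j x) \<le> K"
      using Klim[OF inbox[of x], of "ch j (fst x)" "hat C (snd x)"] chi0[of "fst x" j] hat_eq_0(1)[of C "snd x"] K(1)
      by (cases "0 \<le> fst x \<and> fst x \<le> 2 * L \<and> \<bar>snd x\<bar> < C + 2") auto
    show "?h j x = 0" if "norm x > R"
      using tens[of "ch j" "hat C" x] chi0 hat_eq_0(1) that by (auto simp: tensor_def)
  qed
  let ?g = "\<lambda>x. indicator (ball 0 (R + 1)) x *\<^sub>R g x"
  have AB: "tensor (?A j) ?B x * g x = (?h j x) * ?g x" for j x
  proof -
    have "tensor (?A j) ?B x = ?h j x"
      by (simp add: tensor_def modulate_def W_def)
    then show ?thesis using bd2(2)[of x j] by (auto simp: indicator_def not_less)
  qed
  have lim2: "(\<lambda>j. LINT x|\<sigma>. tensor (?A j) ?B x * g x)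
      \<longlonglongrightarrow> (LINT x|\<sigma>. (?h' x) * ?g x)"
    unfolding AB
  proof (rule integral_dominated_convergence[where w = "\<lambda>x. K * norm (?g x)"])
    show "integrable \<sigma> (\<lambda>x. K * norm (?g x))" by (intro integrable_mult_right integrable_norm ig)
    show "(\<lambda>x. (?h j x) * ?g x) \<in> borel_measurable \<sigma>" for j
      unfolding ch_def
      by (intro borel_measurable_times[OF m\<sigma> borel_measurable_integrable[OF ig]] borel_measurable_times mW mfst msnd continuous_plateau continuous_hat)
    show "(\<lambda>x. (?h' x) * ?g x) \<in> borel_measurable \<sigma>"
      by (intro borel_measurable_times[OF m\<sigma> borel_measurable_integrable[OF ig]] borel_measurable_times mW mI msnd continuous_hat)
    show "AE x in \<sigma>. (\<lambda>j. (?h j x) * ?g x)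
        \<longlonglongrightarrow> (?h' x) * ?g x"
      unfolding ch_def by (intro AE_I2 tendsto_mult tendsto_const plateau_tendsto[OF L])
    show "AE x in \<sigma>. norm ((?h j x) * ?g x) \<le> K * norm (?g x)" for j
      unfolding norm_mult[of _ "?g _"] by (intro AE_I2 mult_right_mono bd2(1) norm_ge_zero)
  qed
  have gc: "Gam_cell f L \<in> sets borel" by (rule Gam_cell_sets[OF f])
  have "(LINT x|\<sigma>. (?h' x) * ?g x)
      = (LINT x|\<sigma>. (W x * indicator (Gam_cell f L) x) * ?g x)"
  proof (rule integral_cong_AE)
    show "(\<lambda>x. (?h' x) * ?g x) \<in> borel_measurable \<sigma>"
      by (intro borel_measurable_times[OF m\<sigma> borel_measurable_integrable[OF ig]] borel_measurable_times mW mI msnd continuous_hat)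
    show "(\<lambda>x. (W x * indicator (Gam_cell f L) x) * ?g x) \<in> borel_measurable \<sigma>"
      by (intro borel_measurable_times[OF m\<sigma> borel_measurable_integrable[OF ig]] borel_measurable_times mW borel_measurable_indicator gc)
    show "AE x in \<sigma>. (?h' x) * ?g x = (W x * indicator (Gam_cell f L) x) * ?g x"
      using AE_arclength_on_graph[OF f] AE_arclength_fst_neq[OF f, of L] unfolding \<sigma>_def
    proof eventually_elim
      case (elim x)
      then have "\<bar>snd x\<bar> \<le> C + 1" using C[of "fst x"] by (simp add: Gam_def)
      then have "hat C (snd x) = 1" by (rule hat_plateau)
      moreover have "indicator {0<..L} (fst x) = (indicator (Gam_cell f L) x :: complex)"
        using elim by (auto simp: indicator_def Gam_cell_def)
      ultimately show ?case by simp
    qed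
  qed
  also have "\<dots> = (LINT x|\<sigma>. indicator (Gam_cell f L) x *\<^sub>R (W x * g x))"
  proof (rule Bochner_Integration.integral_cong[OF refl])
    fix x
    have "norm x < R + 1" if x: "x \<in> Gam_cell f L"
    proof -
      have "\<bar>fst x\<bar> \<le> L" "\<bar>snd x\<bar> \<le> C" using x C[of "fst x"] by (auto simp: Gam_cell_def Gam_def)
      then show ?thesis using norm_Pair_le[of "fst x" "snd x"] L by (simp add: R_def)
    qed
    then show "(W x * indicator (Gam_cell f L) x) * ?g x = indicator (Gam_cell f L) x *\<^sub>R (W x * g x)"
      by (auto simp: indicator_def)
  qed
  also have "\<dots> = (LINT x|arclength_cell f L. W x * g x)"
    unfolding arclength_cell_def \<sigma>_def using gc by (subst integral_restrict_space) auto
  finally show ?thesis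
    using LIMSEQ_unique[OF lim1[unfolded green] lim2] by simp
qed

lemma lborel_plane_integral_snd:
  fixes H :: "real \<times> real \<Rightarrow> complex"
  assumes "integrable lborel H"
  shows "(LINT x|lborel. H x) = (LINT y|lborel. LINT t|lborel. H (t, y))"
proof -
  have "integrable (lborel \<Otimes>\<^sub>M lborel) (case_prod (\<lambda>t y. H (t, y)))"
    using assms by (simp add: lborel_prod case_prod_eta)
  from lborel_pair.integral_snd[OF this] show ?thesis by (simp add: lborel_prod case_prod_eta)
qed

text \<open>The weight \<open>\<zeta>\<close> is supported, within the domain, in the strip \<open>C + 1
  \<le> x\<^sub>2 \<le> C + 2\<close>, which lies entirely above the graph. So the integral is one over
  a rectangle, to which Fubini's theorem applies.\<close>

lemma cutoff_integral_iterated: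
  fixes f :: "real \<Rightarrow> real" and a b :: complex
  assumes f: "continuous_on UNIV f" and L: "L > 0" and C: "\<And>t. \<bar>f t\<bar> \<le> C"
  defines "S \<equiv> Omega_plus f"
  assumes u: "continuous_on S u"
    and G: "\<And>y. y \<ge> C + 1 \<Longrightarrow> ((\<lambda>t. u (t, y) * exp (a * of_real t)) has_integral G y) {0..L}"
  defines "W \<equiv> tensor (\<lambda>t. exp (a * of_real t)) (\<lambda>t. exp (b * of_real t))"
    and "\<zeta> \<equiv> \<lambda>y. 2 * b * hat' C y + hat'' C y"
  shows "(LINT x:S|lborel. u x * (W x * indicator {0<..L} (fst x) * \<zeta> (snd x)))
    = (LINT y|lborel. indicator {C + 1..C + 2} y *\<^sub>R (exp (b * of_real y) * \<zeta> y * G y))"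
proof -
  define Q where "Q = cbox (0, C + 1) (L, C + 2)"
  have Seq: "S = {x. f (fst x) < snd x}" unfolding S_def by (rule Omega_plus_eq[OF f])
  have Qmem: "x \<in> Q \<longleftrightarrow> fst x \<in> {0..L} \<and> snd x \<in> {C + 1..C + 2}" for x
    by (cases x) (auto simp: Q_def cbox_Pair_eq)
  have QS: "Q \<subseteq> S"
  proof
    fix x assume "x \<in> Q"
    then show "x \<in> S" using C[of "fst x"] by (auto simp: Seq Qmem)
  qed
  have \<zeta>0: "\<zeta> y = 0" if "\<bar>y\<bar> \<ge> C + 2 \<or> \<bar>y\<bar> \<le> C + 1" for y
    using that hat_eq_0[of C y] hat_plateau[of y C] by (auto simp: \<zeta>_def)
  have c\<zeta>: "continuous_on UNIV \<zeta>" unfolding \<zeta>_def by (intro continuous_intros continuous_hat)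
  let ?J = "\<lambda>x. indicator Q x *\<^sub>R (u x * (W x * \<zeta> (snd x)))"
  let ?H = "\<lambda>x. indicator {x. 0 < fst x} x *\<^sub>R ?J x"
  have "continuous_on Q (\<lambda>x. u x * (W x * \<zeta> (snd x)))"
    unfolding W_def by (intro continuous_intros continuous_on_tensor continuous_on_subset[OF u QS]
        continuous_on_compose2[OF c\<zeta>]) auto
  then have "integrable lborel ?J"
    unfolding Q_def by (intro borel_integrable_compact compact_cbox)
  moreover have "{x::real \<times> real. 0 < fst x} \<in> sets lborel"
    by (simp, rule borel_open) (intro open_Collect_less continuous_intros)
  ultimately have iH: "integrable lborel ?H" by (rule integrable_mult_indicator[rotated])
  have "(LINT x:S|lborel. u x * (W x * indicator {0<..L} (fst x) * \<zeta> (snd x))) = (LINT x|lborel. ?H x)"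
    unfolding set_lebesgue_integral_def
  proof (rule Bochner_Integration.integral_cong[OF refl])
    fix x
    have inQ: "x \<in> Q" if "x \<in> S" "0 < fst x" "fst x \<le> L" "\<zeta> (snd x) \<noteq> 0"
    proof -
      have "\<not> C + 2 \<le> \<bar>snd x\<bar>" "\<not> \<bar>snd x\<bar> \<le> C + 1" using \<zeta>0[of "snd x"] that(4) by auto
      moreover have "snd x > - C" using that(1) C[of "fst x"] by (simp add: Seq abs_le_iff)
      ultimately have "C + 1 \<le> snd x" "snd x \<le> C + 2" by linarith+
      with that show ?thesis by (simp add: Qmem)
    qed
    show "indicator S x *\<^sub>R (u x * (W x * indicator {0<..L} (fst x) * \<zeta> (snd x))) = ?H x"
    proof (cases "x \<in> Q \<and> 0 < fst x")
      case True
      then have "x \<in> S" "fst x \<in> {0<..L}" using QS by (auto simp: Qmem)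
      with True show ?thesis by simp
    next
      case False
      then have H0: "?H x = 0" by auto
      from False inQ consider "x \<notin> S" | "fst x \<notin> {0<..L}" | "\<zeta> (snd x) = 0" by auto
      then show ?thesis unfolding H0 by cases simp_all
    qed
  qed
  also have "\<dots> = (LINT y|lborel. LINT t|lborel. ?H (t, y))"
    by (rule lborel_plane_integral_snd[OF iH])
  also have "\<dots> = (LINT y|lborel. indicator {C + 1..C + 2} y *\<^sub>R (exp (b * of_real y) * \<zeta> y * G y))"
  proof (rule Bochner_Integration.integral_cong[OF refl])
    fix y
    show "(LINT t|lborel. ?H (t, y)) = indicator {C + 1..C + 2} y *\<^sub>R (exp (b * of_real y) * \<zeta> y * G y)"
    proof (cases "y \<in> {C + 1..C + 2}")
      case True
      let ?h = "\<lambda>t. u (t, y) * exp (a * of_real t)"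
      have "continuous_on {0..L} ?h"
      proof (intro continuous_intros continuous_on_compose2[OF u])
        show "(\<lambda>t. (t, y)) ` {0..L} \<subseteq> S" using True QS by (force simp: Qmem)
      qed
      then have si: "set_integrable lborel {0..L} ?h" by (rule borel_integrable_atLeastAtMost')
      have "(LINT t|lborel. ?H (t, y)) = (LINT t|lborel. (exp (b * of_real y) * \<zeta> y) * (indicator {0<..L} t *\<^sub>R ?h t))"
        using True by (intro Bochner_Integration.integral_cong) (auto simp: Qmem W_def tensor_def indicator_def)
      also have "\<dots> = (LINT t|lborel. (exp (b * of_real y) * \<zeta> y) * (indicator {0..L} t *\<^sub>R ?h t))"
      proof (rule integral_cong_AE)
        have "set_integrable lborel {0<..L} ?h" by (rule set_integrable_subset[OF si]) auto
        then show "(\<lambda>t. (exp (b * of_real y) * \<zeta> y) * (indicator {0<..L} t *\<^sub>R ?h t)) \<in> borel_measurable lborel"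
          unfolding set_integrable_def by (intro borel_measurable_integrable integrable_mult_right)
        show "(\<lambda>t. (exp (b * of_real y) * \<zeta> y) * (indicator {0..L} t *\<^sub>R ?h t)) \<in> borel_measurable lborel"
          using si unfolding set_integrable_def by (intro borel_measurable_integrable integrable_mult_right)
        show "AE t in lborel. (exp (b * of_real y) * \<zeta> y) * (indicator {0<..L} t *\<^sub>R ?h t)
            = (exp (b * of_real y) * \<zeta> y) * (indicator {0..L} t *\<^sub>R ?h t)"
          using AE_lborel_singleton[of "0::real"] by eventually_elim (auto simp: indicator_def)
      qed
      also have "\<dots> = (exp (b * of_real y) * \<zeta> y) * (LINT t:{0..L}|lborel. ?h t)"
        unfolding set_lebesgue_integral_def by (rule integral_mult_right_zero)
      also have "(LINT t:{0..L}|lborel. ?h t) = G y"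
        using set_borel_integral_eq_integral(2)[OF si] integral_unique[OF G[of y]] True by simp
      finally show ?thesis using True by simp
    next
      case False
      have "(LINT t|lborel. ?H (t, y)) = (LINT t|(lborel :: real measure). (0 :: complex))"
      proof (rule Bochner_Integration.integral_cong[OF refl])
        show "?H (t, y) = 0" for t using False by (simp add: Qmem)
      qed
      with False show ?thesis by simp
    qed
  qed
  finally show ?thesis .
qed

text \<open>The weight \<open>exp (b y) (2 b \<eta>' + \<eta>'')\<close>, \<open>\<eta>\<close> being
  the cut-off, turns an upward wave \<open>exp (b y)\<close> into the derivative of \<open>exp (2 b y)
  \<eta>'\<close> and so annihilates it. It turns the downward wave \<open>exp (- b y)\<close> into the
  derivative of \<open>2 b \<eta> + \<eta>'\<close>, which drops from \<open>2 b\<close> to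
  \<open>0\<close>.\<close>

lemma cutoff_weight_integral:
  fixes b \<delta> d :: complex
  assumes C: "C \<ge> 0"
  shows "(LINT y|lborel. indicator {C + 1..C + 2} y *\<^sub>R (exp (b * of_real y) * (2 * b * hat' C y + hat'' C y)
      * (\<delta> * exp (- b * of_real y) + d * exp (b * of_real y)))) = - 2 * b * \<delta>"
proof -
  let ?P = "\<lambda>y. \<delta> * (2 * b * hat C y + hat' C y) + d * (exp (2 * b * of_real y) * hat' C y)"
  let ?D = "\<lambda>y. \<delta> * (2 * b * hat' C y + hat'' C y) + d * (exp (2 * b * of_real y) * hat'' C y + (2 * b * exp (2 * b * of_real y)) * hat' C y)"
  have eq: "exp (b * of_real y) * (2 * b * hat' C y + hat'' C y)
      * (\<delta> * exp (- b * of_real y) + d * exp (b * of_real y)) = ?D y" for y :: real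
  proof -
    have 1: "exp (b * of_real y) * exp (- b * of_real y) = 1" by (simp flip: exp_add)
    have 2: "exp (b * of_real y) * exp (b * of_real y) = exp (2 * b * of_real y)" by (simp add: mult.assoc flip: exp_add)
    have "exp (b * of_real y) * (2 * b * hat' C y + hat'' C y) * (\<delta> * exp (- b * of_real y) + d * exp (b * of_real y))
      = (2 * b * hat' C y + hat'' C y) * (\<delta> * (exp (b * of_real y) * exp (- b * of_real y)) + d * (exp (b * of_real y) * exp (b * of_real y)))"
      by (simp add: algebra_simps)
    also have "\<dots> = ?D y" unfolding 1 2 by (simp add: algebra_simps)
    finally show ?thesis .
  qed
  have "(LINT y|lborel. indicator {C + 1..C + 2} y *\<^sub>R ?D y) = ?P (C + 2) - ?P (C + 1)"
  proof (rule integral_FTC_atLeastAtMost)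
    fix y
    have "(?P has_vector_derivative ?D y) (at y)"
      by (intro has_vector_derivative_add has_vector_derivative_mult_right has_vector_derivative_mult
          hat_deriv hat'_deriv exp_deriv)
    then show "(?P has_vector_derivative ?D y) (at y within {C + 1..C + 2})"
      by (rule has_vector_derivative_at_within)
    show "continuous_on {C + 1..C + 2} ?D" by (intro continuous_intros continuous_hat)
  qed simp
  also have "\<dots> = - 2 * b * \<delta>"
    using C hat_eq_0[of C "C + 2"] hat_plateau[of "C + 1" C] by simp
  finally show ?thesis unfolding eq .
qed

section \<open>Best approximation\<close>

text \<open>For \<open>q\<close> in the span, \<open>p - q\<close> is in the span, too, and thus
  orthogonal to \<open>g - p\<close>. By Pythagoras' theorem the squared distance of \<open>q\<close>
  from \<open>g\<close> exceeds that of \<open>p\<close> by the squared norm of \<open>p -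
  q\<close>.\<close>

lemma best_L2_approx_if_orthogonal:
  assumes \<psi>: "\<And>i. i \<in> I \<Longrightarrow> \<psi> i \<in> L2 M" and g: "g \<in> L2 M" and p: "p \<in> L2_span M I \<psi>"
    and orth: "\<And>i. i \<in> I \<Longrightarrow> L2_inner M (\<lambda>x. g x - p x) (\<psi> i) = 0"
  shows "is_best_L2_approx M (L2_span M I \<psi>) g p"
proof -
  have pL: "p \<in> L2 M" using p by (simp add: L2_span_def)
  have e: "(\<lambda>x. g x - p x) \<in> L2 M" by (rule L2_diff[OF g pL])
  have pyth: "(LINT x|M. (norm (g x - q x))\<^sup>2) = (LINT x|M. (norm (g x - p x))\<^sup>2) + (LINT x|M. (norm (p x - q x))\<^sup>2)"
    if q: "q \<in> L2_span M I \<psi>" for q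
  proof -
    have qL: "q \<in> L2 M" using q by (simp add: L2_span_def)
    have r: "(\<lambda>x. p x - q x) \<in> L2 M" by (rule L2_diff[OF pL qL])
    obtain s t where s: "AE x in M. p x = (\<Sum>i\<in>I. s i * \<psi> i x)" and t: "AE x in M. q x = (\<Sum>i\<in>I. t i * \<psi> i x)"
      using p q by (auto simp: L2_span_def)
    have ier: "integrable M (\<lambda>x. (g x - p x) * cnj (p x - q x))" by (rule L2_integrable_mult[OF e L2_cnj[OF r]])
    have ie\<psi>: "integrable M (\<lambda>x. (g x - p x) * cnj (\<psi> i x))" if "i \<in> I" for i
      by (rule L2_integrable_mult[OF e L2_cnj[OF \<psi>[OF that]]])
    have isum: "integrable M (\<lambda>x. \<Sum>i\<in>I. cnj (s i - t i) * ((g x - p x) * cnj (\<psi> i x)))"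
      by (intro Bochner_Integration.integrable_sum integrable_mult_right ie\<psi>)
    have "(LINT x|M. (g x - p x) * cnj (p x - q x)) = (LINT x|M. (\<Sum>i\<in>I. cnj (s i - t i) * ((g x - p x) * cnj (\<psi> i x))))"
    proof (rule integral_cong_AE)
      show "AE x in M. (g x - p x) * cnj (p x - q x) = (\<Sum>i\<in>I. cnj (s i - t i) * ((g x - p x) * cnj (\<psi> i x)))"
        using s t
      proof eventually_elim
        case (elim x)
        have "p x - q x = (\<Sum>i\<in>I. (s i - t i) * \<psi> i x)"
          unfolding elim by (simp add: sum_subtractf left_diff_distrib)
        then show ?case by (simp add: sum_distrib_left mult_ac)
      qed
    qed (rule borel_measurable_integrable[OF ier] borel_measurable_integrable[OF isum])+
    also have "\<dots> = (\<Sum>i\<in>I. cnj (s i - t i) * (LINT x|M. (g x - p x) * cnj (\<psi> i x)))"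
      using ie\<psi> by (subst Bochner_Integration.integral_sum) auto
    also have "\<dots> = 0" using orth by (simp add: L2_inner_def)
    finally have zero: "(LINT x|M. (g x - p x) * cnj (p x - q x)) = 0" .
    have "(LINT x|M. Re ((g x - p x) * cnj (p x - q x))) = Re (LINT x|M. (g x - p x) * cnj (p x - q x))"
      by (rule integral_Re[OF ier])
    then have Re0: "(LINT x|M. Re ((g x - p x) * cnj (p x - q x))) = 0" by (simp only: zero) simp
    have expand: "(norm (g x - q x))\<^sup>2 = ((norm (g x - p x))\<^sup>2 + (norm (p x - q x))\<^sup>2) + 2 * Re ((g x - p x) * cnj (p x - q x))" for x
    proof -
      have "(norm (z + w))\<^sup>2 = (norm z)\<^sup>2 + (norm w)\<^sup>2 + 2 * Re (z * cnj w)" for z w :: complex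
        unfolding cmod_power2 by (simp add: power2_eq_square algebra_simps)
      from this[of "g x - p x" "p x - q x"] show ?thesis by simp
    qed
    have "(LINT x|M. (norm (g x - q x))\<^sup>2) = (LINT x|M. (norm (g x - p x))\<^sup>2) + (LINT x|M. (norm (p x - q x))\<^sup>2)
        + 2 * (LINT x|M. Re ((g x - p x) * cnj (p x - q x)))"
      unfolding expand
        Bochner_Integration.integral_add[OF Bochner_Integration.integrable_add[OF L2_integrable_square[OF e]
          L2_integrable_square[OF r]] integrable_mult_right[OF integrable_Re[OF ier]]]
        Bochner_Integration.integral_add[OF L2_integrable_square[OF e] L2_integrable_square[OF r]]
      by (simp only: integral_mult_right_zero)
    then show ?thesis by (simp only: Re0 mult_zero_right add_0_right)
  qed
  have pos: "(LINT x|M. (norm (p x - q x))\<^sup>2) \<ge> 0" for q by (intro Bochner_Integration.integral_nonneg) simp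
  show ?thesis unfolding is_best_L2_approx_def
  proof (intro conjI ballI impI p)
    fix q assume q: "q \<in> L2_span M I \<psi>"
    show "L2_norm M (\<lambda>x. g x - p x) \<le> L2_norm M (\<lambda>x. g x - q x)"
      unfolding L2_norm_def pyth[OF q] using pos[of q] by simp
    assume "L2_norm M (\<lambda>x. g x - q x) = L2_norm M (\<lambda>x. g x - p x)"
    then have 0: "(LINT x|M. (norm (p x - q x))\<^sup>2) = 0" unfolding L2_norm_def pyth[OF q] by simp
    have "(\<lambda>x. p x - q x) \<in> L2 M" using L2_diff[OF pL] q by (simp add: L2_span_def)
    from integral_nonneg_eq_0_iff_AE[OF L2_integrable_square[OF this]] 0
    have "AE x in M. (norm (p x - q x))\<^sup>2 = 0" by simp
    then show "AE x in M. q x = p x" by eventually_elim simp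
  qed
qed

section \<open>The moments of the normal derivative\<close>

lemma incident_field_tensor:
  "incident_field k \<theta>I = tensor (\<lambda>t. exp ((\<i> * of_real (k * sin \<theta>I)) * of_real t))
    (\<lambda>t. exp ((- \<i> * of_real (k * cos \<theta>I)) * of_real t))"
  by (simp add: fun_eq_iff incident_field_def tensor_def algebra_simps flip: exp_add)

lemma tensor_exp:
  fixes p q :: complex
  defines "w \<equiv> tensor (\<lambda>t. exp (p * of_real t)) (\<lambda>t. exp (q * of_real t))"
  shows "partial (1,0) w = (\<lambda>x. p * w x)" "partial (0,1) w = (\<lambda>x. q * w x)" "C1_on S w"
proof -
  show "partial (1,0) w = (\<lambda>x. p * w x)" "partial (0,1) w = (\<lambda>x. q * w x)"
    unfolding w_def partial_tensor[OF exp_deriv exp_deriv] by (simp_all add: tensor_def fun_eq_iff)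
  show "C1_on S w" unfolding w_def
    by (rule C1_on_tensor[OF exp_deriv exp_deriv]) (intro continuous_intros)+
qed

lemma alpha_0: "k > 0 \<Longrightarrow> alpha k L \<theta>I 0 = sin \<theta>I"
  by (simp add: alpha_def quasi_momentum_def)

lemma beta_0:
  assumes "k > 0" "- pi / 2 < \<theta>I" "\<theta>I < pi / 2"
  shows "beta k L \<theta>I 0 = of_real (cos \<theta>I)"
proof -
  have "cos \<theta>I > 0" using assms by (intro cos_gt_zero_pi) auto
  moreover have "sqrt (1 - (sin \<theta>I)\<^sup>2) = \<bar>cos \<theta>I\<bar>"
    by (metis cos_squared_eq real_sqrt_abs)
  ultimately show ?thesis by (simp add: beta_def alpha_0[OF assms(1)] abs_sin_le_one)
qed

lemma alpha_beta_square: "(of_real (alpha k L \<theta>I n))\<^sup>2 + (beta k L \<theta>I n)\<^sup>2 = 1"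
proof (cases "\<bar>alpha k L \<theta>I n\<bar> \<le> 1")
  case True
  then have "(alpha k L \<theta>I n)\<^sup>2 \<le> 1" by (simp add: abs_square_le_1)
  then have "(complex_of_real (sqrt (1 - (alpha k L \<theta>I n)\<^sup>2)))\<^sup>2 = of_real (1 - (alpha k L \<theta>I n)\<^sup>2)"
    by (metis diff_ge_0_iff_ge of_real_power real_sqrt_pow2)
  with True show ?thesis by (simp add: beta_def)
next
  case False
  then have "(alpha k L \<theta>I n)\<^sup>2 \<ge> 1" by (metis abs_square_le_1 linear)
  then have "(complex_of_real (sqrt ((alpha k L \<theta>I n)\<^sup>2 - 1)))\<^sup>2 = of_real ((alpha k L \<theta>I n)\<^sup>2 - 1)"
    by (metis diff_ge_0_iff_ge of_real_power real_sqrt_pow2)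
  with False show ?thesis by (simp add: beta_def power_mult_distrib)
qed

lemma alpha_diff:
  assumes "k > 0" "L > 0"
  shows "k * (alpha k L \<theta>I m - alpha k L \<theta>I n) = 2 * pi * of_int (m - n) / L"
  using assms by (simp add: alpha_def field_simps)

lemma laplacian_total_field:
  assumes S: "open S" and uS: "C2_on S uS" and x: "x \<in> S"
    and H: "laplacian uS x + of_real (k\<^sup>2) * uS x = 0"
  shows "laplacian (total_field k \<theta>I uS) x = - of_real (k\<^sup>2) * total_field k \<theta>I uS x"
proof -
  define v where "v = incident_field k \<theta>I"
  define p q where "p = \<i> * of_real (k * sin \<theta>I)" and "q = - \<i> * of_real (k * cos \<theta>I)"
  have v: "partial (1,0) v = (\<lambda>x. p * v x)" "partial (0,1) v = (\<lambda>x. q * v x)" and C1v: "C1_on T v" for T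
    unfolding v_def incident_field_tensor p_def q_def by (rule tensor_exp)+
  have C1u: "C1_on S uS" "C1_on S (partial (1,0) uS)" "C1_on S (partial (0,1) uS)"
    using uS by (auto simp: C2_on_def Basis_plane)
  have tot: "total_field k \<theta>I uS = (\<lambda>x. v x + uS x)" by (simp add: total_field_def v_def fun_eq_iff)
  have C1pv: "C1_on S (\<lambda>x. z * v x)" for z by (rule C1_on_mult[OF C1_on_const C1v])
  have second: "partial e (partial e (\<lambda>x. v x + uS x)) x = z * (z * v x) + partial e (partial e uS) x"
    if e: "partial e v = (\<lambda>x. z * v x)" "C1_on S (partial e uS)" for e z
  proof -
    have "partial e (partial e (\<lambda>x. v x + uS x)) x = partial e (\<lambda>x. z * v x + partial e uS x) x"
      by (rule partial_cong_open[OF S x]) (simp add: partial_add[OF C1v C1u(1)] e(1))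
    also have "\<dots> = z * (z * v x) + partial e (partial e uS) x"
      using partial_add[OF C1pv e(2) x] partial_cmult[OF C1v x] by (simp add: e(1))
    finally show ?thesis .
  qed
  have pq: "p * p + q * q = - of_real (k\<^sup>2)"
  proof -
    have "p * p + q * q = - of_real ((k * sin \<theta>I) * (k * sin \<theta>I) + (k * cos \<theta>I) * (k * cos \<theta>I))"
      by (simp add: p_def q_def algebra_simps)
    also have "(k * sin \<theta>I) * (k * sin \<theta>I) + (k * cos \<theta>I) * (k * cos \<theta>I) = k\<^sup>2 * ((sin \<theta>I)\<^sup>2 + (cos \<theta>I)\<^sup>2)"
      by (simp only: power2_eq_square distrib_left mult_ac)
    finally show ?thesis by simp
  qed
  have "laplacian (\<lambda>x. v x + uS x) x = (p * p + q * q) * v x + laplacian uS x"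
    using second[OF v(1) C1u(2)] second[OF v(2) C1u(3)]
    by (simp add: laplacian_def sum_Basis_plane algebra_simps)
  also have "\<dots> = - of_real (k\<^sup>2) * (v x + uS x)"
    using H by (simp add: pq algebra_simps add_eq_0_iff)
  finally show ?thesis by (simp add: tot)
qed

text \<open>Above the boundary, \<open>u\<close> consists of the downward incident wave and of upward
  scattered waves. Integration over a period in \<open>x\<^sub>1\<close> extracts the
  \<open>n\<close>-th mode, and the vertical weight annihilates the unknown upward wave. Only the
  incident wave contributes, and it belongs to the mode \<open>n = 0\<close>. This is why the moments,
  unlike \<open>\<partial>\<^sub>\<nu> u\<close> itself, are known explicitly.\<close>

lemma normal_derivative_moment:
  fixes k L \<theta>I :: real and f :: "real \<Rightarrow> real" and n :: int
  assumes k: "k > 0" and L: "L > 0"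
    and bd: "bounded (range f)" and lip: "M-lipschitz_on UNIV f" and per: "\<And>t. f (t + L) = f t"
    and \<theta>I: "- pi / 2 < \<theta>I" "\<theta>I < pi / 2"
    and sc: "is_scattered_field k L f \<theta>I uS"
    and hnd: "has_normal_derivative (Omega_plus f) (arclength f) (total_field k \<theta>I uS) g"
  defines "a \<equiv> - \<i> * of_real (k * alpha k L \<theta>I n)" and "b \<equiv> \<i> * of_real k * beta k L \<theta>I n"
  shows "(LINT x|arclength_cell f L. tensor (\<lambda>t. exp (a * of_real t)) (\<lambda>t. exp (b * of_real t)) x * g x)
    = - 2 * \<i> * of_real k * of_real L * beta k L \<theta>I 0 * (if n = 0 then 1 else 0)"
proof -
  define S where "S = Omega_plus f"
  define v where "v = incident_field k \<theta>I"
  define u where "u = total_field k \<theta>I uS"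
  have u_eq: "u = (\<lambda>x. v x + uS x)" by (simp add: total_field_def v_def u_def fun_eq_iff)
  have cf: "continuous_on UNIV f" by (rule lipschitz_UNIV_continuous[OF lip])
  obtain C where C: "\<And>t. \<bar>f t\<bar> \<le> C" using bd by (auto simp: bounded_iff)
  have C0: "C \<ge> 0" using C[of 0] by simp
  have S: "open S" unfolding S_def by (rule open_Omega_plus)
  have ST: "x + (L, 0) \<in> S \<longleftrightarrow> x \<in> S" for x unfolding S_def by (rule Omega_plus_translate[OF cf per])
  have C2: "C2_on S uS" and uSqp: "\<And>x. x \<in> S \<Longrightarrow> uS (fst x + L, snd x) = exp (\<i> * of_real (quasi_momentum k \<theta>I * L)) * uS x"
    and helm: "\<And>x. x \<in> S \<Longrightarrow> laplacian uS x + of_real (k\<^sup>2) * uS x = 0"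
    using sc by (auto simp: is_scattered_field_def C2_quasi_periodic_def S_def)
  have C1S: "C1_on S uS" using C2 by (simp add: C2_on_def)
  obtain h where tr: "has_trace S (arclength f) uS h" and h: "AE x in arclength_cell f L. h x = - v x"
    using sc by (auto simp: is_scattered_field_def S_def v_def)
  have "RERC k L f \<theta>I uS" using sc by (simp add: is_scattered_field_def)
  then obtain d where d: "\<And>x. snd x > (SUP t. f t) \<Longrightarrow> ((\<lambda>m. d m * exp (\<i> * of_real k *
         (of_real (alpha k L \<theta>I m) * of_real (fst x) + beta k L \<theta>I m * of_real (snd x)))) has_sum uS x) UNIV"
    unfolding RERC_def by blast
  have C1v: "C1_on T v" for T unfolding v_def incident_field_tensor by (rule tensor_exp)
  have u: "C1_on S u" "u \<in> H1_loc S" using hnd by (auto simp: has_normal_derivative_def C2_on_def S_def u_def)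
  note uL = H1_loc_imp_L2_loc[OF S u]
  have lap: "laplacian u x = - of_real (k\<^sup>2) * u x" if "x \<in> S" for x
    unfolding u_def by (rule laplacian_total_field[OF S C2 that helm[OF that]])
  define c where "c = exp (\<i> * of_real (quasi_momentum k \<theta>I * L))"
  have qp: "u (x + (L, 0)) = c * u x" if "x \<in> S" for x
  proof -
    have "v (x + (L, 0)) = c * v x"
      by (simp add: v_def incident_field_def c_def quasi_momentum_def algebra_simps flip: exp_add)
    moreover have "x + (L, 0) = (fst x + L, snd x)" by (simp add: prod_eq_iff)
    ultimately show ?thesis using uSqp[OF that] by (simp add: u_eq c_def algebra_simps)
  qed
  \<comment> \<open>\<open>k \<alpha>\<^sub>n\<close> and the quasi-momentum differ by a multiple of \<open>2 \<pi> / L\<close>, so \<open>u\<close> times the plane wave is periodic.\<close>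
  have kalpha: "k * alpha k L \<theta>I n * L = quasi_momentum k \<theta>I * L + 2 * pi * of_int n"
    using k L by (simp add: alpha_def field_simps)
  have ac: "exp (a * of_real L) * c = 1"
  proof -
    have aL: "a * of_real L = - (\<i> * of_real (quasi_momentum k \<theta>I * L + 2 * pi * of_int n))"
      unfolding kalpha[symmetric] by (simp add: a_def)
    have "a * of_real L + \<i> * of_real (quasi_momentum k \<theta>I * L) = - (\<i> * of_real (2 * pi * of_int n))"
      unfolding aL by (simp add: algebra_simps)
    then have "exp (a * of_real L) * c = exp (- (\<i> * of_real (2 * pi * of_int n)))"
      unfolding c_def exp_add[symmetric] by (rule arg_cong)
    also have "\<dots> = 1" using exp_integer_2pi[of "of_int (- n)"] by (simp add: mult_ac)
    finally show ?thesis .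
  qed
  have ab: "a\<^sup>2 + b\<^sup>2 + of_real (k\<^sup>2) = 0"
  proof -
    have "a\<^sup>2 + b\<^sup>2 + of_real (k\<^sup>2) = of_real (k\<^sup>2) * (1 - ((of_real (alpha k L \<theta>I n))\<^sup>2 + (beta k L \<theta>I n)\<^sup>2))"
      by (simp add: a_def b_def power_mult_distrib algebra_simps)
    then show ?thesis by (simp add: alpha_beta_square)
  qed
  \<comment> \<open>the Dirichlet condition on one period of the boundary\<close>
  have h0: "AE x in arclength f. 0 < fst x \<and> fst x < L \<longrightarrow> v x + h x = 0"
  proof -
    have "AE x in arclength f. x \<in> Gam_cell f L \<longrightarrow> h x = - v x"
      using h Gam_cell_sets[OF cf] unfolding arclength_cell_def by (subst (asm) AE_restrict_space_iff) auto
    with AE_arclength_on_graph[OF cf] show ?thesis by eventually_elim (auto simp: Gam_cell_def)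
  qed
  have parts: "parts_defect S e u (tensor A B) = 0"
    if A: "\<And>t. (A has_vector_derivative A' t) (at t)" "continuous_on UNIV A'"
      and B: "\<And>t. (B has_vector_derivative B' t) (at t)" "continuous_on UNIV B'"
      and supp: "\<And>t. A t \<noteq> 0 \<Longrightarrow> 0 \<le> t \<and> t \<le> 2 * L" "\<And>t. B t \<noteq> 0 \<Longrightarrow> \<bar>t\<bar> \<le> C + 2" and e: "e \<in> Basis"
    for A A' B B' e
  proof (rule parts_defect_eq_0[OF S ST u(1) uL(1) uL(2)[OF e] qp e _ h0 AE_arclength_fst_neq[OF cf] A B supp])
    fix \<psi> :: "real \<times> real \<Rightarrow> complex" and R assume \<psi>: "C1_on UNIV \<psi>" "\<And>x. \<psi> x \<noteq> 0 \<Longrightarrow> norm x \<le> R"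
    show "integrable (arclength f) (\<lambda>x. norm (v x + h x) * norm (\<psi> x)) \<and>
      norm (parts_defect S e u \<psi>) \<le> 2 * (M + 1) * (LINT x|arclength f. norm (v x + h x) * norm (\<psi> x))"
      using has_trace_imp_defect_le[OF lip C1S[unfolded S_def] tr[unfolded S_def] C1v \<psi> e]
      by (simp add: S_def u_eq)
  qed
  have "(LINT x|arclength_cell f L. tensor (\<lambda>t. exp (a * of_real t)) (\<lambda>t. exp (b * of_real t)) x * g x)
    = (LINT x:S|lborel. u x * (tensor (\<lambda>t. exp (a * of_real t)) (\<lambda>t. exp (b * of_real t)) x
        * indicator {0<..L} (fst x) * (2 * b * hat' C (snd x) + hat'' C (snd x))))"
    unfolding S_def u_def
    by (rule boundary_moment_eq_cutoff_integral[OF cf per L C hnd lap[unfolded S_def u_def] ab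
        qp[unfolded S_def u_def] ac parts[unfolded S_def u_def], symmetric])
  also have "\<dots> = (LINT y|lborel. indicator {C + 1..C + 2} y *\<^sub>R (exp (b * of_real y) * (2 * b * hat' C y + hat'' C y)
      * (of_real L * (if n = 0 then exp (- \<i> * of_real (k * cos \<theta>I) * of_real y) else 0) + of_real L * (d n * exp (b * of_real y)))))"
    unfolding S_def
  proof (rule cutoff_integral_iterated[OF cf L C])
    show "continuous_on (Omega_plus f) u" using C1_on_continuous_on[OF u(1)] by (simp add: S_def)
    fix y assume y: "y \<ge> C + 1"
    have "(SUP t. f t) \<le> C" using C by (intro cSUP_least) (auto simp: abs_le_iff)
    with y have ySUP: "y > (SUP t. f t)" by linarith
    have phase: "exp (\<i> * of_real (k * alpha k L \<theta>I m * t)) * exp (a * of_real t)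
        = exp (2 * of_real pi * \<i> * of_int (m - n) / of_real L * of_real t)" for m and t :: real
    proof -
      have "\<i> * of_real (k * alpha k L \<theta>I m * t) + a * of_real t
          = \<i> * of_real (k * (alpha k L \<theta>I m - alpha k L \<theta>I n) * t)"
        by (simp add: a_def algebra_simps)
      also have "\<dots> = 2 * of_real pi * \<i> * of_int (m - n) / of_real L * of_real t"
        unfolding alpha_diff[OF k L] by simp
      finally show ?thesis by (simp flip: exp_add)
    qed
    have "((\<lambda>m. (d m * exp (\<i> * of_real k * beta k L \<theta>I m * of_real y)) *
        exp (2 * of_real pi * \<i> * of_int (m - n) / of_real L * of_real t)) has_sum uS (t, y) * exp (a * of_real t)) UNIV" for t
    proof -
      have "((\<lambda>m. d m * exp (\<i> * of_real k *
         (of_real (alpha k L \<theta>I m) * of_real t + beta k L \<theta>I m * of_real y)) * exp (a * of_real t))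
         has_sum uS (t, y) * exp (a * of_real t)) UNIV"
        using has_sum_cmult_left[OF d[of "(t, y)"]] ySUP by simp
      moreover have "d m * exp (\<i> * of_real k *
         (of_real (alpha k L \<theta>I m) * of_real t + beta k L \<theta>I m * of_real y)) * exp (a * of_real t)
         = (d m * exp (\<i> * of_real k * beta k L \<theta>I m * of_real y)) *
        exp (2 * of_real pi * \<i> * of_int (m - n) / of_real L * of_real t)" for m
        unfolding phase[symmetric] by (simp add: distrib_left exp_add mult_ac)
      ultimately show ?thesis by simp
    qed
    from rayleigh_coefficient(1)[OF L this]
    have 1: "((\<lambda>t. uS (t, y) * exp (a * of_real t)) has_integral of_real L * (d n * exp (b * of_real y))) {0..L}"
      by (simp add: b_def)
    have "v (t, y) * exp (a * of_real t) = exp (- \<i> * of_real (k * cos \<theta>I) * of_real y) *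
        exp (2 * of_real pi * \<i> * of_int (- n) / of_real L * of_real t)" for t
      using phase[of 0 t] unfolding v_def incident_field_tensor alpha_0[OF k]
      by (simp add: tensor_def mult_ac)
    then have 2: "((\<lambda>t. v (t, y) * exp (a * of_real t)) has_integral
        exp (- \<i> * of_real (k * cos \<theta>I) * of_real y) * (if n = 0 then of_real L else 0)) {0..L}"
      using has_integral_mult_right[OF integral_exp_period[OF L, of "- n"]] by simp
    have split: "(\<lambda>t. u (t, y) * exp (a * of_real t))
        = (\<lambda>t. v (t, y) * exp (a * of_real t) + uS (t, y) * exp (a * of_real t))"
      by (simp add: u_eq distrib_right)
    show "((\<lambda>t. u (t, y) * exp (a * of_real t)) has_integral
        (of_real L * (if n = 0 then exp (- \<i> * of_real (k * cos \<theta>I) * of_real y) else 0) + of_real L * (d n * exp (b * of_real y)))) {0..L}"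
      unfolding split using has_integral_add[OF 2 1] by (cases "n = 0") (simp_all add: mult.commute)
  qed
  also have "\<dots> = (LINT y|lborel. indicator {C + 1..C + 2} y *\<^sub>R (exp (b * of_real y) * (2 * b * hat' C y + hat'' C y)
      * ((if n = 0 then of_real L else 0) * exp (- b * of_real y) + (of_real L * d n) * exp (b * of_real y))))"
  proof -
    have "b = \<i> * of_real (k * cos \<theta>I)" if "n = 0"
      unfolding b_def that beta_0[OF k \<theta>I] by simp
    then show ?thesis by (cases "n = 0") (simp_all add: mult.assoc)
  qed
  also have "\<dots> = - 2 * b * (if n = 0 then of_real L else 0)" by (rule cutoff_weight_integral[OF C0])
  also have "\<dots> = - 2 * \<i> * of_real k * of_real L * beta k L \<theta>I 0 * (if n = 0 then 1 else 0)"
    by (simp add: b_def)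
  finally show ?thesis .
qed

theorem theorem4p6:
  fixes k L \<theta>I :: real and f :: "real \<Rightarrow> real"
    and uS dnu_u :: "real \<times> real \<Rightarrow> complex"
    and \<theta> :: "int \<Rightarrow> complex"
    and N :: nat and n :: "nat \<Rightarrow> int"
    and P Q :: "(real \<times> real \<Rightarrow> complex) set"
    and b :: "nat \<Rightarrow> real \<times> real \<Rightarrow> complex" and c :: "nat \<Rightarrow> complex"
    and \<phi> :: "real \<times> real \<Rightarrow> complex"
  assumes "k > 0" and "L > 0"
    and "bounded (range f)" and "\<exists>M. M-lipschitz_on UNIV f" and "\<forall>t. f (t + L) = f t"
    and "- pi / 2 < \<theta>I" and "\<theta>I < pi / 2"
    and "is_scattered_field k L f \<theta>I uS"
    and "has_normal_derivative (Omega_plus f) (arclength f) (total_field k \<theta>I uS) dnu_u"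
    and "dnu_u \<in> L2 (arclength_cell f L)"
    and "\<forall>m. cos (\<theta> m) = - of_real (alpha k L \<theta>I m) \<and> sin (\<theta> m) = beta k L \<theta>I m"
    and "inj_on n {1..N}"
    and "P = L2_span (arclength_cell f L) {1..N} (\<lambda>j. psi k \<theta> (n j))"
    and "Q = P"
    and "L2_basis (arclength_cell f L) Q {1..N} b"
    and "\<phi> = (\<lambda>x. \<Sum>m = 1..N. c m * b m x)"
    and "\<forall>j\<in>{1..N}.
           (\<Sum>m = 1..N. L2_inner (arclength_cell f L) (b m) (psi k \<theta> (n j)) * c m)
           = - 2 * \<i> * of_real k * of_real L * beta k L \<theta>I 0 * (if n j = 0 then 1 else 0)"
  shows "is_best_L2_approx (arclength_cell f L) P dnu_u \<phi>"
proof -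
  define T where "T = arclength_cell f L"
  obtain M where lip: "M-lipschitz_on UNIV f" using assms(4) by blast
  have cf: "continuous_on UNIV f" by (rule lipschitz_UNIV_continuous[OF lip])
  have gc: "Gam_cell f L \<in> sets borel" by (rule Gam_cell_sets[OF cf])
  have wave: "gen_plane_wave k x (\<theta> m)
      = tensor (\<lambda>t. exp ((- \<i> * of_real (k * alpha k L \<theta>I m)) * of_real t)) (\<lambda>t. exp ((\<i> * of_real k * beta k L \<theta>I m) * of_real t)) x" for m x
    using assms(11) by (simp add: gen_plane_wave_def tensor_def algebra_simps flip: exp_add)
  have \<psi>: "psi k \<theta> m \<in> L2 T" for m
  proof -
    have cw: "continuous_on UNIV (\<lambda>x. psi k \<theta> m x)"
      unfolding psi_def gen_plane_wave_def by (intro continuous_intros)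
    obtain C where C: "\<And>t. \<bar>f t\<bar> \<le> C" using assms(3) by (auto simp: bounded_iff)
    have "Gam_cell f L \<subseteq> cbox (0, - C) (L, C)"
    proof
      fix x assume "x \<in> Gam_cell f L"
      then show "x \<in> cbox (0, - C) (L, C)"
        using C[of "fst x"] by (cases x) (auto simp: Gam_cell_def Gam_def cbox_Pair_eq abs_le_iff)
    qed
    then have "bounded (Gam_cell f L)" by (rule bounded_subset[OF bounded_cbox])
    then show ?thesis unfolding T_def arclength_cell_def by (rule continuous_L2_arclength[OF lip gc _ cw])
  qed
  have moment: "L2_inner T dnu_u (psi k \<theta> m)
      = - 2 * \<i> * of_real k * of_real L * beta k L \<theta>I 0 * (if m = 0 then 1 else 0)" for m
    using normal_derivative_moment[OF assms(1-3) lip _ assms(6-9), of m] assms(5)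
    by (simp add: L2_inner_def psi_def wave T_def mult.commute)
  have bL: "b m \<in> L2 T" if "m \<in> {1..N}" for m
    using assms(15) that by (simp add: L2_basis_def T_def)
  have \<phi>L: "\<phi> \<in> L2 T" unfolding assms(16) by (intro L2_sum L2_mult_const bL)
  have "\<phi> \<in> L2_span T {1..N} b"
    using \<phi>L unfolding L2_span_def assms(16) by auto
  then have \<phi>P: "\<phi> \<in> P" using assms(14,15) by (simp add: L2_basis_def T_def)
  have "L2_inner T (\<lambda>x. dnu_u x - \<phi> x) (psi k \<theta> (n j)) = 0" if j: "j \<in> {1..N}" for j
  proof -
    let ?\<psi> = "psi k \<theta> (n j)"
    have i: "integrable T (\<lambda>x. h x * cnj (?\<psi> x))" if "h \<in> L2 T" for h
      by (rule L2_integrable_mult[OF that L2_cnj[OF \<psi>]])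
    have dL: "dnu_u \<in> L2 T" using assms(10) by (simp add: T_def)
    have "L2_inner T \<phi> ?\<psi> = (LINT x|T. (\<Sum>m = 1..N. c m * (b m x * cnj (?\<psi> x))))"
      by (simp add: L2_inner_def assms(16) sum_distrib_right mult.assoc)
    also have "\<dots> = (\<Sum>m = 1..N. LINT x|T. c m * (b m x * cnj (?\<psi> x)))"
      by (intro Bochner_Integration.integral_sum integrable_mult_right i bL)
    also have "\<dots> = (\<Sum>m = 1..N. L2_inner T (b m) ?\<psi> * c m)"
      by (simp add: L2_inner_def mult.commute)
    also have "\<dots> = L2_inner T dnu_u ?\<psi>"
      using assms(17) j unfolding moment by (simp add: T_def)
    finally have "L2_inner T dnu_u ?\<psi> - L2_inner T \<phi> ?\<psi> = 0" by simp
    then show ?thesis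
      unfolding L2_inner_def left_diff_distrib
      by (subst Bochner_Integration.integral_diff[OF i[OF dL] i[OF \<phi>L]])
  qed
  then show ?thesis
    using best_L2_approx_if_orthogonal[of "{1..N}" "\<lambda>j. psi k \<theta> (n j)" T dnu_u \<phi>] \<psi> assms(10,13) \<phi>P
    by (simp add: T_def)
qed

end
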